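(* Let $F$ be a field with $\mathrm{Br}(F)=\{0\}$. Let $V$ be an $F$-vector space of finite dimension $N>1$, $G$ a group and $\rho:G\to\mathrm{Aut}_F(V)$ a group homomorphism. Let $H$ be a normal subgroup of $G$ such that: (i) if $H'$ is a subgroup of $H$ of finite index $N'$ and $N'$ divides $N$, then $H'=H$; (ii) $H$ is a simple non-abelian group, and either $H=G$ or $H$ is the only nontrivial proper normal subgroup of $G$; (iii) the $H$-module $V$ is absolutely simple, i.e., $V$ is an irreducible representation of $H$ and $\mathrm{End}_H(V)=F\cdot\mathrm{Id}$. Let $R\subset\mathrm{End}_F(V)$ be a $G$-normal subalgebra. Then there are positive integers $a,b$ such that: (a) $N=ab$; (b) the $F$-algebra $R$ is isomorphic to the matrix algebra $\mathrm{Mat}_a(F)$; the $R$-module $V$ is semisimple, isotypic, and isomorphic to a direct sum of $b$ copies of a simple $R$-module of $F$-dimension $a$; (c) the centralizer $\tilde R=\mathrm{End}_R(V)$ is a $G$-normal subalgebra isomorphic to $\mathrm{Mat}_b(F)$; (d) if $a\ne1$ and $b\ne1$, then both homomorphisms $\mathrm{Ad}_R:G\to\mathrm{Aut}_F(R)\cong R^*/F^*\cong\mathrm{PGL}(a,F)$ and $\mathrm{Ad}_{\tilde R}:G\to\mathrm{Aut}_F(\tilde R)\cong\tilde R^*/F^*\cong\mathrm{PGL}(b,F)$, given by $\sigma\mapsto(u\mapsto\rho(\sigma)u\rho(\sigma)^{-1})$, are injective, and moreover $\mathrm{Ad}_R(H)\subset\mathrm{PSL}(a,F)$ and $\mathrm{Ad}_{\tilde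 R}(H)\subset\mathrm{PSL}(b,F)$; (e) the $H$-module $V$ is central simple.
   Context: An $F$-subalgebra $R\subset\mathrm{End}_F(V)$ containing the identity is $G$-normal if $\rho(\sigma)R\rho(\sigma)^{-1}\subset R$ for all $\sigma\in G$. A module is central simple if every normal subalgebra (for the relevant group) of $\mathrm{End}_F(V)$ is a central simple $F$-algebra. $\mathrm{PGL}(m,F)=\mathrm{GL}(m,F)/F^*$ and $\mathrm{PSL}(m,F)$ denotes the image of $\mathrm{SL}(m,F)$ in $\mathrm{PGL}(m,F)$; the identifications $\mathrm{Aut}_F(R)\cong\mathrm{PGL}(a,F)$, $\mathrm{Aut}_F(\tilde R)\cong\mathrm{PGL}(b,F)$ are those induced by the isomorphisms $R\cong\mathrm{Mat}_a(F)$, $\tilde R\cong\mathrm{Mat}_b(F)$ (all automorphisms being inner). *)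

theory Defs
  imports
    "HOL-Algebra.Bij"
    "HOL-Algebra.QuotRing"
    "HOL-Algebra.Subrings"
    "Jordan_Normal_Form.VS_Connect"
    "Jordan_Normal_Form.Determinant"
begin

section \<open>Associative algebras over a field\<close>

text \<open>The library's \<open>algebra\<close> locale is for commutative algebras. Here an \<open>F\<close>-algebra (associative
  and unital, not necessarily commutative) is a \<open>module\<close> record over the field given by the type
  \<open>'f\<close>; its multiplication and unit fields carry the ring structure.\<close>

definition F_algebra :: "('f::field, 'a) module \<Rightarrow> bool" where
  "F_algebra A \<longleftrightarrow> ring A \<and> Module.module class_ring A \<and>
     (\<forall>c. \<forall>x\<in>carrier A. \<forall>y\<in>carrier A.
        (c \<odot>\<^bsub>A\<^esub> x) \<otimes>\<^bsub>A\<^esub> y = c \<odot>\<^bsub>A\<^esub> (x \<otimes>\<^bsub>A\<^esub> y) \<and> x \<otimes>\<^bsub>A\<^esub> (c \<odot>\<^bsub>A\<^esub> y) = c \<odot>\<^bsub>A\<^esub> (x \<otimes>\<^bsub>A\<^esub> y))"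

definition finite_dim_algebra :: "('f::field, 'a) module \<Rightarrow> bool" where
  "finite_dim_algebra A \<longleftrightarrow>
     (\<exists>B. finite B \<and> B \<subseteq> carrier A \<and>
        (\<forall>x\<in>carrier A. \<exists>c :: 'a \<Rightarrow> 'f. x = (\<Oplus>\<^bsub>A\<^esub>b\<in>B. c b \<odot>\<^bsub>A\<^esub> b)))"

definition algebra_center :: "('f::field, 'a) module \<Rightarrow> 'a set" where
  "algebra_center A = {z \<in> carrier A. \<forall>x\<in>carrier A. z \<otimes>\<^bsub>A\<^esub> x = x \<otimes>\<^bsub>A\<^esub> z}"

definition simple_algebra :: "('f::field, 'a) module \<Rightarrow> bool" where
  "simple_algebra A \<longleftrightarrow> carrier A \<noteq> {\<zero>\<^bsub>A\<^esub>} \<and>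
     (\<forall>I. ideal I A \<longrightarrow> I = {\<zero>\<^bsub>A\<^esub>} \<or> I = carrier A)"

definition central_simple_algebra :: "('f::field, 'a) module \<Rightarrow> bool" where
  "central_simple_algebra A \<longleftrightarrow> F_algebra A \<and> finite_dim_algebra A \<and> simple_algebra A \<and>
     algebra_center A = {c \<odot>\<^bsub>A\<^esub> \<one>\<^bsub>A\<^esub> | c. True}"

definition alg_iso :: "('f::field, 'a) module \<Rightarrow> ('f, 'b) module \<Rightarrow> ('a \<Rightarrow> 'b) set" where
  "alg_iso A B = {\<phi> \<in> ring_iso A B. \<forall>c. \<forall>x\<in>carrier A. \<phi> (c \<odot>\<^bsub>A\<^esub> x) = c \<odot>\<^bsub>B\<^esub> \<phi> x}"

definition unital_subalgebra :: "'a set \<Rightarrow> ('f::field, 'a) module \<Rightarrow> bool" where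
  "unital_subalgebra S A \<longleftrightarrow> subring S A \<and> (\<forall>c. \<forall>x\<in>S. c \<odot>\<^bsub>A\<^esub> x \<in> S)"

definition alg_Aut :: "('f::field, 'a) module \<Rightarrow> ('a \<Rightarrow> 'a) monoid" where
  "alg_Aut A = BijGroup (carrier A)\<lparr>carrier := alg_iso A A \<inter> Bij (carrier A)\<rparr>"

section \<open>The Brauer group\<close>

definition base_algebra :: "('f::field, 'f) module" where
  "base_algebra = \<lparr>carrier = UNIV, mult = (*), one = 1, zero = 0, add = (+), smult = (*)\<rparr>"

definition matrix_algebra :: "nat \<Rightarrow> ('f::field, 'a) module \<Rightarrow> ('f, nat \<times> nat \<Rightarrow> 'a) module" where
  "matrix_algebra n A = (let I = {..<n} \<times> {..<n} in
     \<lparr>carrier = I \<rightarrow>\<^sub>E carrier A,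
      mult = (\<lambda>X Y. restrict (\<lambda>(i, j). \<Oplus>\<^bsub>A\<^esub>k\<in>{..<n}. X (i, k) \<otimes>\<^bsub>A\<^esub> Y (k, j)) I),
      one = restrict (\<lambda>(i, j). if i = j then \<one>\<^bsub>A\<^esub> else \<zero>\<^bsub>A\<^esub>) I,
      zero = restrict (\<lambda>_. \<zero>\<^bsub>A\<^esub>) I,
      add = (\<lambda>X Y. restrict (\<lambda>p. X p \<oplus>\<^bsub>A\<^esub> Y p) I),
      smult = (\<lambda>c X. restrict (\<lambda>p. c \<odot>\<^bsub>A\<^esub> X p) I)\<rparr>)"

definition brauer_equivalent :: "('f::field, 'a) module \<Rightarrow> ('f, 'b) module \<Rightarrow> bool" where
  "brauer_equivalent A B \<longleftrightarrow>
     (\<exists>m>0. \<exists>n>0. alg_iso (matrix_algebra m A) (matrix_algebra n B) \<noteq> {})"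

text \<open>\<open>Br(F) = {0}\<close>: every Brauer class is the class of \<open>F\<close>. Every finite-dimensional \<open>F\<close>-algebra
  is isomorphic to one whose carrier is a set of coordinate tuples, so it loses nothing to let the
  algebras range over those with carrier in \<open>nat \<Rightarrow> 'f\<close>.\<close>

definition brauer_trivial :: "'f::field itself \<Rightarrow> bool" where
  "brauer_trivial _ \<longleftrightarrow>
     (\<forall>A :: ('f, nat \<Rightarrow> 'f) module.
        central_simple_algebra A \<longrightarrow> brauer_equivalent A (base_algebra :: ('f, 'f) module))"

section \<open>Projective unit groups\<close>

definition scalar_units :: "('f::field, 'a) module \<Rightarrow> 'a set" where
  "scalar_units A = {c \<odot>\<^bsub>A\<^esub> \<one>\<^bsub>A\<^esub> | c. c \<noteq> 0}"

text \<open>The group \<open>A\<^sup>*/F\<^sup>*\<close>.\<close>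

definition proj_units :: "('f::field, 'a) module \<Rightarrow> 'a set monoid" where
  "proj_units A = units_of A Mod scalar_units A"

abbreviation Mat :: "nat \<Rightarrow> ('f::field, 'f mat) module" where
  "Mat n \<equiv> module_mat TYPE('f) n n"

abbreviation PGL :: "nat \<Rightarrow> 'f::field mat set monoid" where
  "PGL n \<equiv> proj_units (Mat n)"

definition PSL :: "nat \<Rightarrow> 'f::field mat set set" where
  "PSL n = {scalar_units (Mat n) #>\<^bsub>units_of (Mat n)\<^esub> P | P. P \<in> carrier_mat n n \<and> det P = 1}"

text \<open>The map from automorphisms to \<open>A\<^sup>*/F\<^sup>*\<close>: if \<open>A\<close> is central simple and \<open>\<alpha>\<close> is conjugation by \<open>u\<close>,
  then the value at \<open>\<alpha>\<close> is the coset \<open>F\<^sup>* u\<close>. Given an isomorphism \<open>\<phi>\<close> of \<open>A\<close> with \<open>Mat n\<close>, taking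
  images of cosets under \<open>\<phi>\<close> leads on to \<open>PGL n\<close>.\<close>

definition inner_class :: "('f::field, 'a) module \<Rightarrow> ('a \<Rightarrow> 'a) \<Rightarrow> 'a set" where
  "inner_class A \<alpha> =
     {u \<in> Units A. \<forall>x\<in>carrier A. \<alpha> x = u \<otimes>\<^bsub>A\<^esub> x \<otimes>\<^bsub>A\<^esub> inv\<^bsub>A\<^esub> u}"

section \<open>Linear representations and algebras of operators\<close>

definition End_alg ::
  "('f::field \<Rightarrow> 'v::ab_group_add \<Rightarrow> 'v) \<Rightarrow> ('f, 'v \<Rightarrow> 'v) module" where
  "End_alg scale =
     \<lparr>carrier = {f. Vector_Spaces.linear scale scale f}, mult = (\<circ>), one = id,
      zero = (\<lambda>_. 0), add = (\<lambda>f g x. f x + g x), smult = (\<lambda>c f x. scale c (f x))\<rparr>"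

abbreviation Aut_V :: "('f::field \<Rightarrow> 'v::ab_group_add \<Rightarrow> 'v) \<Rightarrow> ('v \<Rightarrow> 'v) monoid" where
  "Aut_V scale \<equiv> units_of (End_alg scale)"

abbreviation op_alg ::
  "('f::field \<Rightarrow> 'v::ab_group_add \<Rightarrow> 'v) \<Rightarrow> ('v \<Rightarrow> 'v) set \<Rightarrow> ('f, 'v \<Rightarrow> 'v) module" where
  "op_alg scale R \<equiv> End_alg scale\<lparr>carrier := R\<rparr>"

text \<open>For a set \<open>S\<close> of operators on \<open>V\<close>, the endomorphisms of \<open>V\<close> commuting with \<open>S\<close>:
  \<open>End_R(V)\<close> is \<open>End_over scale R\<close>, and \<open>End_H(V)\<close> is \<open>End_over scale (\<rho> ` H)\<close>. The same
  convention applies to the notions of submodule and simple submodule.\<close>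

definition End_over ::
  "('f::field \<Rightarrow> 'v::ab_group_add \<Rightarrow> 'v) \<Rightarrow> ('v \<Rightarrow> 'v) set \<Rightarrow> ('v \<Rightarrow> 'v) set" where
  "End_over scale S = {f \<in> carrier (End_alg scale). \<forall>u\<in>S. f \<circ> u = u \<circ> f}"

definition submod ::
  "('f::field \<Rightarrow> 'v::ab_group_add \<Rightarrow> 'v) \<Rightarrow> ('v \<Rightarrow> 'v) set \<Rightarrow> 'v set \<Rightarrow> bool" where
  "submod scale S W \<longleftrightarrow> Modules.module.subspace scale W \<and> (\<forall>u\<in>S. \<forall>w\<in>W. u w \<in> W)"

definition simple_submod ::
  "('f::field \<Rightarrow> 'v::ab_group_add \<Rightarrow> 'v) \<Rightarrow> ('v \<Rightarrow> 'v) set \<Rightarrow> 'v set \<Rightarrow> bool" where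
  "simple_submod scale S W \<longleftrightarrow> submod scale S W \<and> W \<noteq> {0} \<and>
     (\<forall>U. submod scale S U \<and> U \<subseteq> W \<longrightarrow> U = {0} \<or> U = W)"

definition submod_iso ::
  "('f::field \<Rightarrow> 'v::ab_group_add \<Rightarrow> 'v) \<Rightarrow> ('v \<Rightarrow> 'v) set \<Rightarrow> 'v set \<Rightarrow> 'v set \<Rightarrow> bool" where
  "submod_iso scale S W W' \<longleftrightarrow>
     (\<exists>f. bij_betw f W W' \<and>
        (\<forall>x\<in>W. \<forall>y\<in>W. f (x + y) = f x + f y) \<and>
        (\<forall>c. \<forall>x\<in>W. f (scale c x) = scale c (f x)) \<and>
        (\<forall>u\<in>S. \<forall>x\<in>W. f (u x) = u (f x)))"

definition semisimple_mod ::
  "('f::field \<Rightarrow> 'v::ab_group_add \<Rightarrow> 'v) \<Rightarrow> ('v \<Rightarrow> 'v) set \<Rightarrow> bool" where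
  "semisimple_mod scale S \<longleftrightarrow> Modules.module.span scale (\<Union>{W. simple_submod scale S W}) = UNIV"

definition isotypic_mod ::
  "('f::field \<Rightarrow> 'v::ab_group_add \<Rightarrow> 'v) \<Rightarrow> ('v \<Rightarrow> 'v) set \<Rightarrow> bool" where
  "isotypic_mod scale S \<longleftrightarrow> semisimple_mod scale S \<and>
     (\<forall>W W'. simple_submod scale S W \<and> simple_submod scale S W' \<longrightarrow> submod_iso scale S W W')"

text \<open>\<open>V\<close> is isomorphic to the external direct sum of \<open>b\<close> copies of its submodule \<open>W\<close>.\<close>

definition iso_copies ::
  "('f::field \<Rightarrow> 'v::ab_group_add \<Rightarrow> 'v) \<Rightarrow> ('v \<Rightarrow> 'v) set \<Rightarrow> nat \<Rightarrow> 'v set \<Rightarrow> bool" where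
  "iso_copies scale S b W \<longleftrightarrow>
     (\<exists>f :: 'v \<Rightarrow> nat \<Rightarrow> 'v. bij_betw f UNIV ({..<b} \<rightarrow>\<^sub>E W) \<and>
        (\<forall>i<b. \<forall>x y. f (x + y) i = f x i + f y i) \<and>
        (\<forall>i<b. \<forall>c x. f (scale c x) i = scale c (f x i)) \<and>
        (\<forall>i<b. \<forall>u\<in>S. \<forall>x. f (u x) i = u (f x i)))"

definition abs_simple_rep ::
  "('f::field \<Rightarrow> 'v::ab_group_add \<Rightarrow> 'v) \<Rightarrow> ('g \<Rightarrow> 'v \<Rightarrow> 'v) \<Rightarrow> 'g set \<Rightarrow> bool" where
  "abs_simple_rep scale \<rho> K \<longleftrightarrow> simple_submod scale (\<rho> ` K) UNIV \<and>
     End_over scale (\<rho> ` K) = {scale c | c. True}"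

definition normal_subalgebra ::
  "('f::field \<Rightarrow> 'v::ab_group_add \<Rightarrow> 'v) \<Rightarrow> ('g \<Rightarrow> 'v \<Rightarrow> 'v) \<Rightarrow> 'g set \<Rightarrow> ('v \<Rightarrow> 'v) set \<Rightarrow> bool" where
  "normal_subalgebra scale \<rho> K R \<longleftrightarrow> unital_subalgebra R (End_alg scale) \<and>
     (\<forall>\<sigma>\<in>K. \<forall>u\<in>R. \<rho> \<sigma> \<circ> u \<circ> inv_into UNIV (\<rho> \<sigma>) \<in> R)"

definition central_simple_rep ::
  "('f::field \<Rightarrow> 'v::ab_group_add \<Rightarrow> 'v) \<Rightarrow> ('g \<Rightarrow> 'v \<Rightarrow> 'v) \<Rightarrow> 'g set \<Rightarrow> bool" where
  "central_simple_rep scale \<rho> K \<longleftrightarrow>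
     (\<forall>R. normal_subalgebra scale \<rho> K R \<longrightarrow> central_simple_algebra (op_alg scale R))"

definition Ad :: "('g \<Rightarrow> 'v \<Rightarrow> 'v) \<Rightarrow> ('v \<Rightarrow> 'v) set \<Rightarrow> 'g \<Rightarrow> ('v \<Rightarrow> 'v) \<Rightarrow> ('v \<Rightarrow> 'v)" where
  "Ad \<rho> R \<sigma> = restrict (\<lambda>u. \<rho> \<sigma> \<circ> u \<circ> inv_into UNIV (\<rho> \<sigma>)) R"

definition Ad_PGL ::
  "('f::field \<Rightarrow> 'v::ab_group_add \<Rightarrow> 'v) \<Rightarrow> ('g \<Rightarrow> 'v \<Rightarrow> 'v) \<Rightarrow> ('v \<Rightarrow> 'v) set \<Rightarrow>
    (('v \<Rightarrow> 'v) \<Rightarrow> 'f mat) \<Rightarrow> 'g \<Rightarrow> 'f mat set" where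
  "Ad_PGL scale \<rho> R \<phi> \<sigma> = \<phi> ` inner_class (op_alg scale R) (Ad \<rho> R \<sigma>)"

section \<open>Simple groups\<close>

text \<open>The library locale \<open>simple_group\<close> demands \<open>order G > 1\<close>, which excludes infinite groups.\<close>

definition is_simple_group :: "('g, 'm) monoid_scheme \<Rightarrow> bool" where
  "is_simple_group G \<longleftrightarrow> group G \<and> carrier G \<noteq> {\<one>\<^bsub>G\<^esub>} \<and>
     (\<forall>K. K \<lhd> G \<longrightarrow> K = {\<one>\<^bsub>G\<^esub>} \<or> K = carrier G)"

end

theory Submission
  imports Defs "HOL-Library.Function_Algebras" "HOL-Library.Nat_Bijection"
begin

text \<open>
  Write \<open>K\<close> for the normal subgroup \<open>H\<close> acting on \<open>V\<close>. The heart of the matter is that a commutative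
  \<open>K\<close>-stable algebra \<open>Z\<close> of operators consists of scalars. Among the nonzero common kernels of
  subsets of \<open>Z\<close> take one, \<open>U\<close>, of minimal dimension: its translates under \<open>K\<close> are independent and
  span \<open>V\<close>, so their number divides \<open>dim V\<close>, the hypothesis on indices forces \<open>U = V\<close>, and \<open>Z\<close> is a
  field. For \<open>z \<in> Z\<close> the polynomial whose roots are the conjugates of \<open>z\<close> has invariant, hence
  scalar, coefficients; so the size of the orbit of \<open>z\<close> is the degree of \<open>F[z]\<close>, which divides
  \<open>dim V\<close>, and \<open>z\<close> is fixed by \<open>K\<close>.

  Now let \<open>R\<close> be any \<open>K\<close>-stable algebra. The centres of \<open>R\<close> and of \<open>End\<^sub>R(V)\<close> are scalar, and \<open>V\<close>
  is a semisimple \<open>R\<close>-module; this makes \<open>R\<close> central simple. Triviality of the Brauer group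
  exhibits \<open>R\<close> as a corner of a matrix algebra over \<open>F\<close>, hence gives an idempotent \<open>e \<in> R\<close> with
  \<open>eRe = Fe\<close>, and from \<open>e\<close> one builds matrix units of \<open>R\<close>; a basis of \<open>eV\<close> then yields matrix units
  of \<open>End\<^sub>R(V)\<close>. If \<open>Ad\<close> had a nontrivial kernel, the kernel would contain \<open>H\<close> and the algebra would
  be scalar. Finally the preimage of \<open>PSL\<close> in the simple group \<open>H\<close> is normal and contains all
  commutators.
\<close>


section \<open>Orbits and linear representations\<close>

text \<open>The index hypothesis enters the linear algebra in one form only: an orbit of
  \<open>K\<close> whose size divides \<open>dim V\<close> is a single point, since its size is the
  index of a stabiliser. Both halves of the treatment of \<open>Z\<close> produce such an orbit, of
  subspaces and then of operators. Independence of the translates of \<open>U\<close> comes from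
  minimality: every element of \<open>Z\<close> is zero or injective on each translate, and products
  of elements of \<open>Z\<close> separate one translate from finitely many others. The orbit of
  \<open>z\<close> is finite because a scalar polynomial that kills \<open>z\<close> kills all its
  conjugates.

  \<open>V\<close> is semisimple over \<open>R\<close> by Clifford's argument: the
  \<open>K\<close>-translates of a simple \<open>R\<close>-submodule are simple and span
  \<open>V\<close>. Simplicity of \<open>R\<close> rests on the commutant: an ideal \<open>I\<close>
  splits \<open>V\<close> into its annihilator and \<open>I V\<close>, and the projection is central
  in \<open>End_R(V)\<close>, hence scalar.

  The structure of \<open>R\<close> is obtained from \<open>H\<close> alone; \<open>G\<close>
  matters for the normality of the commutant and for \<open>Ad\<close>. \<open>R\<close> has to be
  copied onto coordinate sequences, because triviality of the Brauer group speaks of algebras with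
  that carrier.\<close>

lemma End_alg_simps [simp]:
  "carrier (End_alg s) = {f. Vector_Spaces.linear s s f}"
  "mult (End_alg s) = (\<circ>)"
  "one (End_alg s) = id"
  "zero (End_alg s) = (\<lambda>_. 0)"
  "add (End_alg s) = (\<lambda>f g x. f x + g x)"
  "smult (End_alg s) = (\<lambda>c f x. s c (f x))"
  by (simp_all add: End_alg_def)

text \<open>A point \<open>y = act (inv a) x\<close> of the orbit corresponds to the coset
  \<open>S #> a\<close> of all \<open>g\<close> that carry \<open>y\<close> back to
  \<open>x\<close>; the direction from \<open>y\<close> to \<open>x\<close> is what yields right
  cosets. The action laws are asked at \<open>x\<close> alone, so \<open>act\<close> may be any
  function on any type, and the bijection also compares infinite orbits.\<close>

lemma (in group) card_rcosets_stabilizer: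
  fixes act :: "'a \<Rightarrow> 'x \<Rightarrow> 'x"
  assumes one: "act \<one> x = x"
    and mult: "\<And>g h. g \<in> carrier G \<Longrightarrow> h \<in> carrier G \<Longrightarrow> act (g \<otimes> h) x = act g (act h x)"
  defines "S \<equiv> {g \<in> carrier G. act g x = x}"
  shows "subgroup S G"
    and "bij_betw (\<lambda>y. {g \<in> carrier G. act g y = x}) ((\<lambda>g. act g x) ` carrier G) (rcosets S)"
proof -
  show "subgroup S G"
  proof (rule subgroupI)
    fix g assume "g \<in> S"
    then show "inv g \<in> S"
      using one mult[of "inv g" g] by (simp add: S_def)
  qed (use one mult in \<open>auto simp: S_def\<close>)
  let ?\<Phi> = "\<lambda>y. {g \<in> carrier G. act g y = x}"
  have coset: "?\<Phi> (act (inv a) x) = S #> a" if a: "a \<in> carrier G" for a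
  proof -
    have "g \<in> S #> a \<longleftrightarrow> g \<otimes> inv a \<in> S" if "g \<in> carrier G" for g
    proof
      assume "g \<otimes> inv a \<in> S"
      then show "g \<in> S #> a"
        using a that unfolding r_coset_def by (intro UN_I[of "g \<otimes> inv a"]) (auto simp: m_assoc)
    qed (use a in \<open>auto simp: r_coset_def S_def m_assoc\<close>)
    moreover have "S #> a \<subseteq> carrier G"
      using a by (auto simp: r_coset_def S_def)
    ultimately show ?thesis
      using a by (auto simp: S_def mult)
  qed
  have orbit: "(\<lambda>g. act g x) ` carrier G = (\<lambda>g. act (inv g) x) ` carrier G"
    by (auto simp: image_iff) (metis inv_inv inv_closed)
  show "bij_betw ?\<Phi> ((\<lambda>g. act g x) ` carrier G) (rcosets S)"
  proof (rule bij_betw_imageI)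
    show "?\<Phi> ` (\<lambda>g. act g x) ` carrier G = rcosets S"
      unfolding orbit image_image RCOSETS_def using coset by auto
    show "inj_on ?\<Phi> ((\<lambda>g. act g x) ` carrier G)"
    proof (rule inj_onI)
      fix y z assume "y \<in> (\<lambda>g. act g x) ` carrier G" "z \<in> (\<lambda>g. act g x) ` carrier G"
        and eq: "?\<Phi> y = ?\<Phi> z"
      then obtain a b where a: "a \<in> carrier G" "y = act (inv a) x"
        and b: "b \<in> carrier G" "z = act (inv b) x"
        unfolding orbit by auto
      have "act a y = x"
        using a one mult[of a "inv a"] by simp
      then have "act a z = x"
        using eq a by auto
      then have "act (a \<otimes> inv b) x = x"
        using a b mult by simp
      then have "act (inv a \<otimes> (a \<otimes> inv b)) x = act (inv a) x"
        using a b mult[of "inv a" "a \<otimes> inv b"] by simp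
      then show "y = z"
        using a b by (simp add: m_assoc[symmetric])
    qed
  qed
qed

section \<open>Algebras of operators on a finite-dimensional space\<close>

locale operator_space = finite_dimensional_vector_space scale Basis
  for scale :: "'a::field \<Rightarrow> 'b::ab_group_add \<Rightarrow> 'b" and Basis
begin

text \<open>Pointwise form of \<open>unital_subalgebra R (End_alg scale)\<close>, with which it is
  shown to agree below. Zero and negatives come from the scalars 0 and -1.\<close>

definition operator_algebra :: "('b \<Rightarrow> 'b) set \<Rightarrow> bool" where
  "operator_algebra R \<longleftrightarrow> (\<forall>f\<in>R. Vector_Spaces.linear scale scale f) \<and> id \<in> R \<and>
     (\<forall>f\<in>R. \<forall>g\<in>R. (\<lambda>x. f x + g x) \<in> R \<and> f \<circ> g \<in> R) \<and> (\<forall>c. \<forall>f\<in>R. (\<lambda>x. scale c (f x)) \<in> R)"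

lemma linearI:
  assumes "\<And>x y. f (x + y) = f x + f y" "\<And>c x. f (scale c x) = scale c (f x)"
  shows "Vector_Spaces.linear scale scale f"
  using assms by (simp add: Vector_Spaces.linear_iff vector_space_axioms)

lemma
  assumes "Vector_Spaces.linear scale scale f"
  shows lin_add: "f (x + y) = f x + f y"
    and lin_scale: "f (scale c x) = scale c (f x)"
    and lin_zero: "f 0 = 0"
    and lin_neg: "f (- x) = - f x"
    and lin_diff: "f (x - y) = f x - f y"
    and lin_sum: "f (sum h A) = (\<Sum>i\<in>A. f (h i))"
proof -
  interpret l: Vector_Spaces.linear scale scale f by fact
  show "f (x + y) = f x + f y" "f (scale c x) = scale c (f x)" "f 0 = 0"
    "f (- x) = - f x" "f (x - y) = f x - f y" "f (sum h A) = (\<Sum>i\<in>A. f (h i))"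
    by (rule l.add l.scale l.zero l.neg l.diff l.sum)+
qed

lemma lin_kernel_subspace:
  "Vector_Spaces.linear scale scale f \<Longrightarrow> subspace {v. f v = 0}"
  by (rule subspaceI) (auto simp: lin_zero lin_add lin_scale)

lemma lin_injI:
  "Vector_Spaces.linear scale scale f \<Longrightarrow> (\<And>v. f v = 0 \<Longrightarrow> v = 0) \<Longrightarrow> inj f"
  by (metis lin_diff injI right_minus_eq)

lemma operator_algebraD:
  fixes f g :: "'b \<Rightarrow> 'b" and c :: "'a"
  assumes "operator_algebra R"
  shows "f \<in> R \<Longrightarrow> Vector_Spaces.linear scale scale f"
    and "id \<in> R"
    and "f \<in> R \<Longrightarrow> g \<in> R \<Longrightarrow> (\<lambda>x. f x + g x) \<in> R"
    and "f \<in> R \<Longrightarrow> g \<in> R \<Longrightarrow> f \<circ> g \<in> R"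
    and "f \<in> R \<Longrightarrow> (\<lambda>x. scale c (f x)) \<in> R"
    and "(\<lambda>_. 0) \<in> R"
    and "f \<in> R \<Longrightarrow> (\<lambda>x. - f x) \<in> R"
    and "f \<in> R \<Longrightarrow> g \<in> R \<Longrightarrow> (\<lambda>x. f x - g x) \<in> R"
    and "scale c \<in> R"
proof -
  have sc: "f \<in> R \<Longrightarrow> (\<lambda>x. scale c (f x)) \<in> R" for c f
    using assms by (auto simp: operator_algebra_def)
  have ad: "f \<in> R \<Longrightarrow> g \<in> R \<Longrightarrow> (\<lambda>x. f x + g x) \<in> R" for f g
    using assms by (auto simp: operator_algebra_def)
  have ng: "f \<in> R \<Longrightarrow> (\<lambda>x. - f x) \<in> R" for f
    using sc[of f "-1"] by (simp add: scale_minus_left)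
  show "f \<in> R \<Longrightarrow> Vector_Spaces.linear scale scale f" "id \<in> R"
    "f \<in> R \<Longrightarrow> g \<in> R \<Longrightarrow> (\<lambda>x. f x + g x) \<in> R" "f \<in> R \<Longrightarrow> g \<in> R \<Longrightarrow> f \<circ> g \<in> R"
    "f \<in> R \<Longrightarrow> (\<lambda>x. scale c (f x)) \<in> R"
    using assms by (auto simp: operator_algebra_def)
  show "(\<lambda>_. 0) \<in> R"
    using sc[of id 0] assms by (auto simp: operator_algebra_def)
  show "scale c \<in> R"
    using sc[of id c] assms by (auto simp: operator_algebra_def)
  show "f \<in> R \<Longrightarrow> (\<lambda>x. - f x) \<in> R"
    by (rule ng)
  show "f \<in> R \<Longrightarrow> g \<in> R \<Longrightarrow> (\<lambda>x. f x - g x) \<in> R"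
    using ad[of f "\<lambda>x. - g x"] ng[of g] by simp
qed

lemma operator_algebra_sum:
  assumes R: "operator_algebra R" and "finite A" "\<And>i. i \<in> A \<Longrightarrow> h i \<in> R"
  shows "(\<lambda>x. \<Sum>i\<in>A. h i x) \<in> R"
  using assms(2,3) by induction (auto simp: operator_algebraD[OF R])

lemma End_ring: "ring (End_alg scale)"
proof (rule ringI)
  show "abelian_group (End_alg scale)"
  proof (rule abelian_groupI)
    fix f assume f: "f \<in> carrier (End_alg scale)"
    show "\<exists>g\<in>carrier (End_alg scale). g \<oplus>\<^bsub>End_alg scale\<^esub> f = \<zero>\<^bsub>End_alg scale\<^esub>"
      using f by (intro bexI[of _ "\<lambda>x. - f x"])
        (auto intro!: linearI simp: lin_add lin_scale scale_minus_right)
  qed (auto intro!: linearI simp: lin_add lin_scale lin_zero scale_right_distrib algebra_simps)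
  show "monoid (End_alg scale)"
    by (rule monoidI) (auto intro!: linearI simp: lin_add lin_scale)
qed (auto simp: lin_add)

lemma unital_subalgebra_iff_operator_algebra:
  "unital_subalgebra R (End_alg scale) \<longleftrightarrow> operator_algebra R"
proof
  assume "unital_subalgebra R (End_alg scale)"
  then have "subring R (End_alg scale)" "\<forall>c. \<forall>f\<in>R. (\<lambda>x. scale c (f x)) \<in> R"
    by (auto simp: unital_subalgebra_def)
  then show "operator_algebra R"
    using subringE[of R "End_alg scale"] by (auto simp: operator_algebra_def)
next
  assume R: "operator_algebra R"
  interpret E: ring "End_alg scale" by (rule End_ring)
  have "\<ominus>\<^bsub>End_alg scale\<^esub> f = (\<lambda>x. - f x)" if "f \<in> R" for f
    using that operator_algebraD[OF R] by (intro E.minus_equality) auto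
  then show "unital_subalgebra R (End_alg scale)"
    using operator_algebraD[OF R] by (auto simp: unital_subalgebra_def intro!: E.subringI)
qed

end


text \<open>The group is a parameter because the locale is used twice in the end: for
  \<open>G\<close> itself, where \<open>Ad\<close> is studied, and for \<open>G\<close> with carrier
  \<open>H\<close>, where the algebra is done.\<close>

locale linear_representation = operator_space scale Basis + K: group K
  for scale :: "'a::field \<Rightarrow> 'b::ab_group_add \<Rightarrow> 'b" and Basis and K :: "('g, 'm) monoid_scheme" (structure) +
  fixes \<rho> :: "'g \<Rightarrow> 'b \<Rightarrow> 'b"
  assumes rep: "\<rho> \<in> hom K (Aut_V scale)"
begin

lemma rep_mult: "g \<in> carrier K \<Longrightarrow> h \<in> carrier K \<Longrightarrow> \<rho> (g \<otimes> h) = \<rho> g \<circ> \<rho> h"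
  using hom_mult[OF rep] by (simp add: units_of_def)

lemma rep_linear: "g \<in> carrier K \<Longrightarrow> Vector_Spaces.linear scale scale (\<rho> g)"
  using hom_carrier[OF rep] by (auto simp: units_of_def Units_def)

lemma rep_bij:
  assumes "g \<in> carrier K"
  shows "bij (\<rho> g)"
proof -
  have "\<rho> g \<in> Units (End_alg scale)"
    using hom_carrier[OF rep] assms by (auto simp: units_of_def)
  then show ?thesis
    by (auto simp: Units_def intro: o_bij)
qed

lemma rep_one: "\<rho> \<one> = id"
proof -
  \<comment> \<open>Membership in \<open>hom\<close> does not mention the unit; but an injective
    idempotent is the identity.\<close>
  have "\<rho> \<one> \<circ> \<rho> \<one> = \<rho> \<one>"
    using rep_mult[of \<one> \<one>] by simp
  then show ?thesis
    using rep_bij[of \<one>] by (metis K.one_closed bij_is_inj fun_eq_iff comp_apply id_apply injD)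
qed

lemma rep_inv [simp]:
  assumes "g \<in> carrier K"
  shows "\<rho> (inv g) (\<rho> g v) = v" "\<rho> g (\<rho> (inv g) v) = v"
  using assms rep_mult[of g "inv g"] rep_mult[of "inv g" g] rep_one by (auto simp: fun_eq_iff)

lemma inv_rep: "g \<in> carrier K \<Longrightarrow> inv_into UNIV (\<rho> g) = \<rho> (inv g)"
  by (rule inv_equality) auto

text \<open>Using \<open>\<rho> (inv g)\<close> in place of \<open>inv_into UNIV (\<rho> g)\<close>
  makes the action laws consequences of the group laws; \<open>inv_rep\<close> links the
  two.\<close>

definition conj :: "'g \<Rightarrow> ('b \<Rightarrow> 'b) \<Rightarrow> 'b \<Rightarrow> 'b" where
  "conj g u = \<rho> g \<circ> u \<circ> \<rho> (inv g)"

definition stable_algebra :: "('b \<Rightarrow> 'b) set \<Rightarrow> bool" where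
  "stable_algebra R \<longleftrightarrow> operator_algebra R \<and> (\<forall>g\<in>carrier K. \<forall>u\<in>R. conj g u \<in> R)"

lemma conj_one: "conj \<one> u = u"
  by (simp add: conj_def rep_one)

lemma conj_mult:
  "g \<in> carrier K \<Longrightarrow> h \<in> carrier K \<Longrightarrow> conj (g \<otimes> h) u = conj g (conj h u)"
  by (auto simp: conj_def rep_mult K.inv_mult_group)

lemma conj_inv: "g \<in> carrier K \<Longrightarrow> conj g (conj (inv g) u) = u"
  by (simp flip: conj_mult add: conj_one)

lemma conj_rep: "g \<in> carrier K \<Longrightarrow> conj g u (\<rho> g v) = \<rho> g (u v)"
  by (simp add: conj_def)

lemma rep_image_subspace:
  assumes "g \<in> carrier K" "subspace W"
  shows "subspace (\<rho> g ` W)"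
proof -
  interpret l: Vector_Spaces.linear scale scale "\<rho> g" by (rule rep_linear) fact
  show ?thesis by (rule l.subspace_image) fact
qed

lemma dim_rep_image: "g \<in> carrier K \<Longrightarrow> dim (\<rho> g ` W) = dim W"
proof -
  assume g: "g \<in> carrier K"
  interpret p: finite_dimensional_vector_space_pair_1 scale Basis scale ..
  show ?thesis
    using p.dim_image_eq[OF rep_linear[OF g]] rep_bij[OF g] by (metis bij_is_inj inj_on_subset subset_UNIV)
qed

end

text \<open>Hypotheses (i) and (iii) read for a group \<open>K\<close>, which will be
  \<open>H\<close>. Hypothesis (ii) comes in with the kernel of \<open>Ad\<close> and with
  \<open>PSL\<close>.\<close>

locale irreducible_operators = linear_representation scale Basis K \<rho>
  for scale :: "'a::field \<Rightarrow> 'b::ab_group_add \<Rightarrow> 'b" and Basis and K :: "('g, 'm) monoid_scheme" (structure)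
    and \<rho> :: "'g \<Rightarrow> 'b \<Rightarrow> 'b" +
  assumes irreducible: "\<And>W. submod scale (\<rho> ` carrier K) W \<Longrightarrow> W = {0} \<or> W = UNIV"
    and nonzero_space: "(UNIV :: 'b set) \<noteq> {0}"
    and commutant: "\<And>f. Vector_Spaces.linear scale scale f \<Longrightarrow>
          (\<And>g. g \<in> carrier K \<Longrightarrow> f \<circ> \<rho> g = \<rho> g \<circ> f) \<Longrightarrow> \<exists>c. f = scale c"
    and index: "\<And>S. subgroup S K \<Longrightarrow> finite (rcosets S) \<Longrightarrow>
          card (rcosets S) dvd dim UNIV \<Longrightarrow> S = carrier K"
begin

text \<open>The orbit has as many points as the stabiliser has cosets, so \<open>index\<close> makes
  the stabiliser all of \<open>K\<close>. It is applied to translates of a subspace and to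
  conjugates of an operator.\<close>

lemma small_orbit_fixed:
  fixes act :: "'g \<Rightarrow> 'x \<Rightarrow> 'x"
  assumes "act \<one> x = x"
    and "\<And>g h. g \<in> carrier K \<Longrightarrow> h \<in> carrier K \<Longrightarrow> act (g \<otimes> h) x = act g (act h x)"
    and "finite ((\<lambda>g. act g x) ` carrier K)" "card ((\<lambda>g. act g x) ` carrier K) dvd dim UNIV"
    and "g \<in> carrier K"
  shows "act g x = x"
proof -
  note st = K.card_rcosets_stabilizer[of act x, OF assms(1,2)]
  have "{g \<in> carrier K. act g x = x} = carrier K"
    using index[OF st(1)] assms(3,4) bij_betw_finite[OF st(2)] bij_betw_same_card[OF st(2)] by auto
  then show ?thesis
    using assms(5) by auto
qed

lemma irreducibleD:
  assumes "subspace W" "\<And>g v. g \<in> carrier K \<Longrightarrow> v \<in> W \<Longrightarrow> \<rho> g v \<in> W" "v \<in> W" "v \<noteq> 0"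
  shows "W = UNIV"
  using irreducible[of W] assms by (auto simp: submod_def)

lemma span_orbit:
  assumes v: "v \<in> W" "v \<noteq> 0"
  shows "span (\<Union>g\<in>carrier K. \<rho> g ` W) = UNIV"
proof (rule irreducibleD[OF subspace_span])
  show "v \<in> span (\<Union>g\<in>carrier K. \<rho> g ` W)"
    using v by (intro span_base UN_I[of \<one>]) (auto simp: rep_one)
  fix h w assume h: "h \<in> carrier K" and w: "w \<in> span (\<Union>g\<in>carrier K. \<rho> g ` W)"
  have "span (\<Union>g\<in>carrier K. \<rho> g ` W) \<subseteq> {w. \<rho> h w \<in> span (\<Union>g\<in>carrier K. \<rho> g ` W)}"
  proof (rule span_minimal)
    show "subspace {w. \<rho> h w \<in> span (\<Union>g\<in>carrier K. \<rho> g ` W)}"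
      by (rule subspaceI) (auto simp: lin_zero lin_add lin_scale rep_linear[OF h] span_zero span_add span_scale)
    show "(\<Union>g\<in>carrier K. \<rho> g ` W) \<subseteq> {w. \<rho> h w \<in> span (\<Union>g\<in>carrier K. \<rho> g ` W)}"
    proof clarsimp
      fix g w assume "g \<in> carrier K" "w \<in> W"
      then show "\<rho> h (\<rho> g w) \<in> span (\<Union>g\<in>carrier K. \<rho> g ` W)"
        using h by (intro span_base UN_I[of "h \<otimes> g"]) (auto simp: rep_mult)
    qed
  qed
  then show "\<rho> h w \<in> span (\<Union>g\<in>carrier K. \<rho> g ` W)"
    using w by auto
qed (use v in auto)

end

section \<open>Common kernels of a commutative stable algebra\<close>

context irreducible_operators begin

text \<open>On a common kernel \<open>U\<close> of least dimension the dichotomy for elements of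
  \<open>Z\<close> is immediate from minimality. The work lies in showing \<open>U = UNIV\<close>,
  which turns it into the claim.\<close>

lemma stable_commutative_zero_or_inj:
  assumes Z: "stable_algebra Z" and comm: "\<And>u v. u \<in> Z \<Longrightarrow> v \<in> Z \<Longrightarrow> u \<circ> v = v \<circ> u"
    and z: "z \<in> Z"
  shows "z = (\<lambda>_. 0) \<or> inj z"
proof -
  have alg: "operator_algebra Z" and st: "\<And>g u. g \<in> carrier K \<Longrightarrow> u \<in> Z \<Longrightarrow> conj g u \<in> Z"
    using Z by (auto simp: stable_algebra_def)
  note lin = operator_algebraD(1)[OF alg]
  have commZ: "u (v x) = v (u x)" if "u \<in> Z" "v \<in> Z" for u v x
    using comm[OF that] by (simp add: fun_eq_iff)
  define ann where "ann S = {v. \<forall>s\<in>S. s v = (0::'b)}" for S :: "('b \<Rightarrow> 'b) set"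
  define P where "P U \<longleftrightarrow> (\<exists>S\<subseteq>Z. U = ann S) \<and> U \<noteq> {0}" for U
  have "P UNIV"
    using nonzero_space by (auto simp: P_def ann_def intro!: exI[of _ "{}"])
  then obtain U where U: "P U" and min: "\<And>U'. P U' \<Longrightarrow> dim U \<le> dim U'"
    using ex_has_least_nat[of P UNIV dim] by blast
  have sub: "subspace U'" if "P U'" for U'
    using that lin by (auto simp: P_def ann_def subset_iff lin_zero lin_add lin_scale intro!: subspaceI)
  have zero: "0 \<in> U'" if "P U'" for U'
    using sub[OF that] by (rule subspace_0)
  have inv: "u v \<in> U'" if "P U'" "u \<in> Z" "v \<in> U'" for U' u v
    using that commZ lin_zero[OF lin] by (auto simp: P_def ann_def subset_iff) metis
  define \<U> where "\<U> = (\<lambda>g. \<rho> g ` U) ` carrier K"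
  \<comment> \<open>A translate of the common kernel of \<open>S\<close> by \<open>g\<close> is the
    common kernel of the conjugates of \<open>S\<close> by \<open>g\<close>, which lie in
    \<open>Z\<close> by stability. So every translate is again a common kernel of least
    dimension.\<close>
  have P\<U>: "P U'" and dim\<U>: "dim U' = dim U" if U': "U' \<in> \<U>" for U'
  proof -
    obtain g where g: "g \<in> carrier K" "U' = \<rho> g ` U"
      using U' by (auto simp: \<U>_def)
    obtain S where S: "S \<subseteq> Z" "U = ann S"
      using U by (auto simp: P_def)
    have "\<rho> g ` U = ann (conj g ` S)"
    proof (intro equalityI subsetI)
      fix v assume "v \<in> ann (conj g ` S)"
      then have "\<rho> (inv g) v \<in> U"
        unfolding S using g
        by (auto simp: ann_def conj_def) (metis K.inv_closed lin_zero rep_inv(1) rep_linear)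
      then show "v \<in> \<rho> g ` U"
        using g by (intro image_eqI[of _ _ "\<rho> (inv g) v"]) auto
    qed (use g in \<open>auto simp: S ann_def conj_rep lin_zero[OF rep_linear]\<close>)
    moreover have "\<rho> g ` U \<noteq> {0}"
      using U zero[OF U] g rep_bij[OF g(1)] lin_zero[OF rep_linear[OF g(1)]]
      by (metis (no_types, lifting) P_def bij_is_inj image_empty image_insert inj_image_eq_iff)
    ultimately show "P U'"
      using g S st by (auto simp: P_def intro!: exI[of _ "conj g ` S"])
    show "dim U' = dim U"
      using g dim_rep_image by simp
  qed
  \<comment> \<open>If \<open>U'\<close> meets the kernel of \<open>u\<close> nontrivially, the
    intersection is the common kernel of \<open>insert u S\<close>, so by minimality it is all of
    \<open>U'\<close>.\<close>
  have dich: "(\<forall>v\<in>U'. u v = 0) \<or> (\<forall>v\<in>U'. u v = 0 \<longrightarrow> v = 0)" if U': "U' \<in> \<U>" and u: "u \<in> Z" for U' u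
  proof (cases "U' \<inter> {v. u v = 0} = {0}")
    case False
    obtain S where S: "S \<subseteq> Z" "U' = ann S"
      using P\<U>[OF U'] by (auto simp: P_def)
    have P: "P (U' \<inter> {v. u v = 0})"
      unfolding P_def using False S u by (intro conjI exI[of _ "insert u S"]) (auto simp: ann_def)
    have "U' \<inter> {v. u v = 0} = U'"
      using min[OF P] dim\<U>[OF U'] sub[OF P] sub[OF P\<U>[OF U']] by (intro subspace_dim_equal) auto
    then show ?thesis by auto
  qed auto
  \<comment> \<open>Distinct translates have equal dimension, hence neither contains the other. Some
    \<open>s\<close> in the set that cuts out \<open>U1\<close> is therefore nonzero on
    \<open>U2\<close>, and by \<open>dich\<close> injective there.\<close>
  have sep: "\<exists>s\<in>Z. (\<forall>v\<in>U1. s v = 0) \<and> (\<forall>v\<in>U2. s v = 0 \<longrightarrow> v = 0)"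
    if U1: "U1 \<in> \<U>" and U2: "U2 \<in> \<U>" and ne: "U1 \<noteq> U2" for U1 U2
  proof -
    obtain S where S: "S \<subseteq> Z" "U1 = ann S"
      using P\<U>[OF U1] by (auto simp: P_def)
    have "\<not> U2 \<subseteq> U1"
      using ne subspace_dim_equal[of U2 U1] sub P\<U> U1 U2 dim\<U> by auto
    then obtain s v where "s \<in> S" "v \<in> U2" "s v \<noteq> 0"
      by (auto simp: S ann_def)
    then show ?thesis
      using dich[OF U2, of s] S by (intro bexI[of _ s]) (auto simp: ann_def)
  qed
  have sep_fin: "\<exists>s\<in>Z. (\<forall>v\<in>\<Union>\<F>. s v = 0) \<and> (\<forall>v\<in>U2. s v = 0 \<longrightarrow> v = 0)"
    if "finite \<F>" "\<F> \<subseteq> \<U>" "U2 \<in> \<U>" "U2 \<notin> \<F>" for \<F> U2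
    using that
  proof (induction \<F>)
    case empty
    show ?case
      using operator_algebraD(2)[OF alg] by (intro bexI[of _ id]) auto
  next
    case (insert U1 \<F>)
    then obtain s where s: "s \<in> Z" "\<forall>v\<in>\<Union>\<F>. s v = 0" "\<forall>v\<in>U2. s v = 0 \<longrightarrow> v = 0"
      by auto
    obtain t where t: "t \<in> Z" "\<forall>v\<in>U1. t v = 0" "\<forall>v\<in>U2. t v = 0 \<longrightarrow> v = 0"
      using sep[of U1 U2] insert by auto
    show ?case
    \<comment> \<open>The product kills \<open>U1\<close> through \<open>t\<close>, and kills the
      other members through \<open>s\<close> because the factors commute. It stays injective on
      \<open>U2\<close> because \<open>t\<close> maps \<open>U2\<close> into itself.\<close>
    proof (intro bexI[of _ "s \<circ> t"] conjI ballI impI)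
      fix v assume v: "v \<in> \<Union>(insert U1 \<F>)"
      show "(s \<circ> t) v = 0"
        using v s t commZ[OF s(1) t(1), of v] lin_zero[OF lin[OF s(1)]] lin_zero[OF lin[OF t(1)]] by auto
    next
      fix v assume "v \<in> U2" "(s \<circ> t) v = 0"
      then show "v = 0"
        using s t inv[OF P\<U>, of U2 t v] insert by auto
    qed (use s t operator_algebraD(4)[OF alg] in auto)
  qed
  \<comment> \<open>A separating \<open>s\<close> vanishes on the span of the old members and is
    injective on the new one, so the new member meets that span in 0.\<close>
  have dimF: "dim (span (\<Union>\<F>)) = card \<F> * dim U" if "finite \<F>" "\<F> \<subseteq> \<U>" for \<F>
    using that
  proof (induction \<F>)
    case (insert U1 \<F>)
    have s1: "subspace U1"
      using insert sub P\<U> by auto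
    obtain s where s: "s \<in> Z" "\<forall>v\<in>\<Union>\<F>. s v = 0" "\<forall>v\<in>U1. s v = 0 \<longrightarrow> v = 0"
      using sep_fin[of \<F> U1] insert by auto
    have "span (\<Union>\<F>) \<subseteq> {v. s v = 0}"
      using s by (intro span_minimal lin_kernel_subspace lin) auto
    then have "U1 \<inter> span (\<Union>\<F>) = {0}"
      using s subspace_0[OF s1] span_zero by auto
    moreover have "span (\<Union>(insert U1 \<F>)) = {x + y |x y. x \<in> U1 \<and> y \<in> span (\<Union>\<F>)}"
      using span_Un[of U1 "\<Union>\<F>"] span_eq_iff[THEN iffD2, OF s1] by simp
    ultimately show ?case
      using dim_sums_Int[OF s1 subspace_span, of "\<Union>\<F>"] insert dim\<U>[of U1] by simp
  qed simp
  have dimU: "dim U > 0"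
    using U zero[OF U] by (auto simp: P_def)
  have fin: "finite \<U>"
  proof (rule ccontr)
    assume "infinite \<U>"
    then obtain \<F> where F: "\<F> \<subseteq> \<U>" "finite \<F>" "card \<F> = Suc (dim UNIV)"
      using infinite_arbitrarily_large by blast
    have "dim (span (\<Union>\<F>)) \<le> dim UNIV"
      by (rule dim_subset) auto
    moreover have "card \<F> \<le> card \<F> * dim U"
      using dimU by simp
    ultimately show False
      using dimF[OF F(2,1)] F(3) by simp
  qed
  obtain v where v: "v \<in> U" "v \<noteq> 0"
    using U zero[OF U] by (auto simp: P_def)
  \<comment> \<open>The translates span \<open>V\<close>, so \<open>dim V\<close> is
    \<open>card \<U> * dim U\<close>; this is the divisibility that hypothesis (i) needs.\<close>
  have "card \<U> dvd dim UNIV"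
    using dimF[OF fin] span_orbit[OF v] by (simp add: \<U>_def)
  then have "\<rho> g ` U = U" if "g \<in> carrier K" for g
    using small_orbit_fixed[of "\<lambda>g W. \<rho> g ` W" U g] fin that
    by (auto simp: \<U>_def rep_one rep_mult image_comp)
  then have "U = UNIV"
    using irreducibleD[OF sub[OF U], of v] v by auto
  moreover have "U \<in> \<U>"
    unfolding \<U>_def by (intro image_eqI[of _ _ \<one>]) (auto simp: rep_one)
  ultimately show ?thesis
    using dich[of U z] z lin_injI[OF lin[OF z]] by (auto simp: fun_eq_iff)
qed
end

section \<open>Commutative stable algebras are scalar\<close>

text \<open>Horner evaluation, constant term first. The coefficient ring \<open>Z\<close> is a set
  of operators and not a type, so its polynomials are kept as bare lists of operators.\<close>

fun op_eval :: "('b::ab_group_add \<Rightarrow> 'b) list \<Rightarrow> ('b \<Rightarrow> 'b) \<Rightarrow> 'b \<Rightarrow> 'b" where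
  "op_eval [] x = (\<lambda>_. 0)"
| "op_eval (c # cs) x = (\<lambda>v. c v + x (op_eval cs x v))"

text \<open>Synthetic division by \<open>X - a\<close>: the coefficients of the quotient are the
  values at \<open>a\<close> of the successive tails of the polynomial.\<close>

fun op_quot :: "('b::ab_group_add \<Rightarrow> 'b) list \<Rightarrow> ('b \<Rightarrow> 'b) \<Rightarrow> ('b \<Rightarrow> 'b) list" where
  "op_quot [] a = []"
| "op_quot [c] a = []"
| "op_quot (c # d # cs) a = op_eval (d # cs) a # op_quot (d # cs) a"

text \<open>Multiplication of a polynomial by \<open>X - a\<close>, followed by addition of the constant \<open>c\<close>.\<close>

fun op_mul_linear :: "('b::ab_group_add \<Rightarrow> 'b) \<Rightarrow> ('b \<Rightarrow> 'b) \<Rightarrow> ('b \<Rightarrow> 'b) list \<Rightarrow> ('b \<Rightarrow> 'b) list" where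
  "op_mul_linear a c [] = [c]"
| "op_mul_linear a c (d # cs) = (\<lambda>v. c v - a (d v)) # op_mul_linear a d cs"

lemma length_op_quot: "length (op_quot cs a) = length cs - 1"
  by (induction cs a rule: op_quot.induct) auto

lemma length_op_mul_linear: "length (op_mul_linear a c cs) = Suc (length cs)"
  by (induction a c cs rule: op_mul_linear.induct) auto

lemma last_op_mul_linear: "last (op_mul_linear a c cs) = (if cs = [] then c else last cs)"
proof (induction a c cs rule: op_mul_linear.induct)
  case (2 a c d cs)
  then show ?case
    using length_op_mul_linear[of a d cs] by auto
qed auto

section \<open>Independent families and relations among powers\<close>

context operator_space begin

text \<open>Independence of an indexed family says more than independence of its image: two equal
  members would satisfy the relation with coefficients 1 and -1. Hence injectivity, and the
  dimension is the size of the index set.\<close>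

lemma dim_span_family:
  assumes "finite I" and ind: "\<And>c. (\<Sum>i\<in>I. scale (c i) (w i)) = 0 \<Longrightarrow> \<forall>i\<in>I. c i = 0"
  shows "inj_on w I" "independent (w ` I)" "dim (span (w ` I)) = card I"
proof -
  show inj: "inj_on w I"
  proof (rule inj_onI, rule ccontr)
    fix i j assume ij: "i \<in> I" "j \<in> I" "w i = w j" "i \<noteq> j"
    let ?c = "\<lambda>k. if k = i then 1 else if k = j then - 1 else 0"
    have "(\<Sum>k\<in>I. scale (?c k) (w k)) = (\<Sum>k\<in>I. (if k = i then w i else 0) + (if k = j then - w j else 0))"
      using ij(4) by (intro sum.cong) (auto simp: scale_minus_left)
    also have "\<dots> = 0"
      using ij assms(1) by (simp add: sum.distrib)
    finally show False
      using ind[of ?c] ij by auto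
  qed
  show "independent (w ` I)"
  proof
    assume "dependent (w ` I)"
    then obtain u where u: "\<exists>v\<in>w ` I. u v \<noteq> 0" "(\<Sum>v\<in>w ` I. scale (u v) v) = 0"
      using dependent_finite[of "w ` I"] assms(1) by auto
    then have "(\<Sum>i\<in>I. scale (u (w i)) (w i)) = 0"
      by (simp add: sum.reindex[OF inj])
    then show False
      using ind[of "\<lambda>i. u (w i)"] u by auto
  qed
  then show "dim (span (w ` I)) = card I"
    by (simp add: dim_eq_card_independent card_image[OF inj])
qed

lemma large_family_dependent:
  fixes w :: "nat \<Rightarrow> 'b"
  shows "\<exists>c. (\<Sum>i<Suc (dim UNIV). scale (c i) (w i)) = 0 \<and> (\<exists>i<Suc (dim UNIV). c i \<noteq> 0)"
proof (rule ccontr)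
  assume "\<not> ?thesis"
  then have "\<forall>i\<in>{..<Suc (dim UNIV)}. c i = 0" if "(\<Sum>i\<in>{..<Suc (dim UNIV)}. scale (c i) (w i)) = 0" for c
    using that by blast
  from dim_span_family(3)[OF finite_lessThan this]
  have "dim (span (w ` {..<Suc (dim UNIV)})) = Suc (dim UNIV)"
    by simp
  then show False
    using dim_subset[of "span (w ` {..<Suc (dim UNIV)})" UNIV] by simp
qed

lemma op_eval_scale_list:
  assumes z: "Vector_Spaces.linear scale scale z"
  shows "op_eval (map scale ds) z v = (\<Sum>i<length ds. scale (ds ! i) ((z ^^ i) v))"
proof (induction ds)
  case (Cons d ds)
  have "z (op_eval (map scale ds) z v) = (\<Sum>i<length ds. scale (ds ! i) ((z ^^ Suc i) v))"
    using Cons by (simp add: lin_sum[OF z] lin_scale[OF z])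
  then show ?case
    by (simp add: sum.lessThan_Suc_shift del: sum.lessThan_Suc)
qed simp

lemma op_eval_diff:
  assumes z: "Vector_Spaces.linear scale scale z"
  shows "length cs = length ds \<Longrightarrow>
    op_eval (map2 (\<lambda>f g v. f v - g v) cs ds) z v = op_eval cs z v - op_eval ds z v"
  by (induction cs ds rule: list_induct2) (auto simp: lin_diff[OF z])

lemma op_eval_snoc_zero:
  "Vector_Spaces.linear scale scale z \<Longrightarrow> op_eval (cs @ [\<lambda>_. 0]) z = op_eval cs z"
  by (induction cs) (auto simp: lin_zero)

end

text \<open>"Zero or injective" stands in for the existence of inverses. It allows cancellation, and
  in finite dimension an injective operator is bijective.\<close>

locale operator_field = operator_space scale Basis
  for scale :: "'a::field \<Rightarrow> 'b::ab_group_add \<Rightarrow> 'b" and Basis +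
  fixes Z :: "('b \<Rightarrow> 'b) set"
  assumes alg: "operator_algebra Z"
    and comm: "\<And>u v. u \<in> Z \<Longrightarrow> v \<in> Z \<Longrightarrow> u \<circ> v = v \<circ> u"
    and zero_or_inj: "\<And>u. u \<in> Z \<Longrightarrow> u = (\<lambda>_. 0) \<or> inj u"
begin

lemmas lin = operator_algebraD(1)[OF alg]

lemma comm_apply: "u \<in> Z \<Longrightarrow> v \<in> Z \<Longrightarrow> u (v x) = v (u x)"
  using comm[of u v] by (simp add: fun_eq_iff)

lemma op_eval_closed: "set cs \<subseteq> Z \<Longrightarrow> x \<in> Z \<Longrightarrow> op_eval cs x \<in> Z"
proof (induction cs)
  case (Cons c cs)
  then show ?case
    using operator_algebraD(3)[OF alg, of c "x \<circ> op_eval cs x"] operator_algebraD(4)[OF alg, of x "op_eval cs x"]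
    by (auto simp: comp_def)
qed (auto simp: operator_algebraD(6)[OF alg])

lemma op_quot_closed: "set cs \<subseteq> Z \<Longrightarrow> a \<in> Z \<Longrightarrow> set (op_quot cs a) \<subseteq> Z"
proof (induction cs a rule: op_quot.induct)
  case (3 c d cs a)
  then show ?case
    using op_eval_closed[of "d # cs" a] by auto
qed auto

text \<open>Division with remainder, \<open>p(x) = p(a) + (x - a) q(x)\<close>. With
  \<open>p = c + X p1\<close> and the identity for \<open>p1\<close>, commutativity of
  \<open>x\<close> and \<open>a\<close> gives the identity for \<open>p\<close>.\<close>

lemma op_eval_quot:
  assumes "set cs \<subseteq> Z" "a \<in> Z" and x: "x \<in> Z"
  shows "op_eval cs x v = op_eval cs a v + (x (op_eval (op_quot cs a) x v) - a (op_eval (op_quot cs a) x v))"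
  using assms(1,2)
proof (induction cs a arbitrary: v rule: op_quot.induct)
  case (1 a)
  then show ?case by (simp add: lin_zero[OF lin] x)
next
  case (2 c a)
  then show ?case by (simp add: lin_zero[OF lin] x)
next
  case (3 c d cs a)
  have a: "a \<in> Z"
    using 3 by auto
  have e: "op_eval (d # cs) x v =
      op_eval (d # cs) a v + (x (op_eval (op_quot (d # cs) a) x v) - a (op_eval (op_quot (d # cs) a) x v))"
    using 3 by simp
  have "op_eval (c # d # cs) x v = c v + x (op_eval (d # cs) x v)"
    by simp
  then show ?case
    unfolding e by (simp add: lin_add[OF lin] lin_diff[OF lin] x a comm_apply[OF a x] del: op_eval.simps(2))
      (simp add: lin_add[OF lin] lin_diff[OF lin] x a comm_apply[OF a x])
qed

text \<open>The head of the quotient is the value of the tail at \<open>a\<close>; once it vanishes,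
  \<open>p(a) = 0\<close> forces the constant term to vanish, and the tail satisfies the same
  hypotheses.\<close>

lemma op_quot_zero:
  assumes "set cs \<subseteq> Z" "a \<in> Z" "\<forall>v. op_eval cs a v = 0" "\<forall>q\<in>set (op_quot cs a). q = (\<lambda>_. 0)"
  shows "\<forall>c\<in>set cs. c = (\<lambda>_. 0)"
  using assms
proof (induction cs a rule: op_quot.induct)
  case (2 c a)
  then show ?case by (auto simp: lin_zero[OF lin])
next
  case (3 c d cs a)
  have q: "\<forall>q\<in>insert (op_eval (d # cs) a) (set (op_quot (d # cs) a)). q = (\<lambda>_. 0)"
    using 3(5) unfolding op_quot.simps(3) list.set .
  have e: "op_eval (d # cs) a = (\<lambda>_. 0)"
    by (rule bspec[OF q insertI1])
  have a: "a 0 = 0"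
    by (rule lin_zero[OF lin[OF 3(3)]])
  have "op_eval (c # d # cs) a = c"
    unfolding op_eval.simps(2)[of c] e a by simp
  then have "c v = 0" for v
    using spec[OF 3(4), of v] by (simp only:)
  moreover have "\<forall>c\<in>set (d # cs). c = (\<lambda>_. 0)"
  proof (rule 3(1))
    show "set (d # cs) \<subseteq> Z"
      using 3(2) by simp
    show "\<forall>v. op_eval (d # cs) a v = 0"
      unfolding e by simp
    show "\<forall>q\<in>set (op_quot (d # cs) a). q = (\<lambda>_. 0)"
      using q by blast
  qed (rule 3(3))
  ultimately show ?case
    unfolding list.set(2)[of c] by (simp only: ball_simps fun_eq_iff) simp
qed auto

text \<open>A polynomial has no more roots than its degree. The length of the list exceeds the
  degree bound by one, so \<open>length cs \<le> card A\<close> means more roots than the degree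
  permits.\<close>

lemma op_eval_roots:
  assumes "set cs \<subseteq> Z" "finite A" "A \<subseteq> Z" "length cs \<le> card A"
    and "\<And>x v. x \<in> A \<Longrightarrow> op_eval cs x v = 0"
  shows "\<forall>c\<in>set cs. c = (\<lambda>_. 0)"
  using assms
proof (induction "length cs" arbitrary: cs A)
  case (Suc n)
  then obtain a where a: "a \<in> A"
    by fastforce
  have "\<forall>q\<in>set (op_quot cs a). q = (\<lambda>_. 0)"
  proof (rule Suc.hyps(1))
    show "n = length (op_quot cs a)"
      using Suc by (simp add: length_op_quot)
    show "set (op_quot cs a) \<subseteq> Z"
      using op_quot_closed Suc a by blast
    show "finite (A - {a})" "A - {a} \<subseteq> Z" "length (op_quot cs a) \<le> card (A - {a})"
      using Suc a by (auto simp: length_op_quot)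
    fix x v assume x: "x \<in> A - {a}"
    have xZ: "x \<in> Z" "a \<in> Z"
      using Suc x a by auto
    let ?q = "op_eval (op_quot cs a) x v"
    \<comment> \<open>Both \<open>x\<close> and \<open>a\<close> are roots, so division leaves
      \<open>(x - a) q(x) = 0\<close>; the difference \<open>x - a\<close> is a nonzero element of
      \<open>Z\<close>, hence injective.\<close>
    have "x ?q - a ?q = 0"
      using op_eval_quot[of cs a x v] Suc x a xZ by auto
    moreover have "(\<lambda>v. x v - a v) \<in> Z"
      using operator_algebraD(8)[OF alg] xZ by auto
    moreover have "(\<lambda>v. x v - a v) \<noteq> (\<lambda>_. 0)"
      using x by (auto simp: fun_eq_iff)
    ultimately have "inj (\<lambda>v. x v - a v)" "(\<lambda>v. x v - a v) ?q = (\<lambda>v. x v - a v) 0"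
      using zero_or_inj xZ by (auto simp: lin_zero[OF lin])
    then show "?q = 0"
      by (metis injD)
  qed
  then show ?case
    using op_quot_zero Suc a by (metis subsetD)
qed simp

lemma op_mul_linear_closed:
  "set cs \<subseteq> Z \<Longrightarrow> a \<in> Z \<Longrightarrow> c \<in> Z \<Longrightarrow> set (op_mul_linear a c cs) \<subseteq> Z"
proof (induction a c cs rule: op_mul_linear.induct)
  case (2 a c d cs)
  then show ?case
    using operator_algebraD(8)[OF alg, of c "a \<circ> d"] operator_algebraD(4)[OF alg, of a d] by (auto simp: comp_def)
qed auto

lemma op_eval_mul_linear:
  "set cs \<subseteq> Z \<Longrightarrow> a \<in> Z \<Longrightarrow> x \<in> Z \<Longrightarrow>
    op_eval (op_mul_linear a c cs) x v = c v + (x (op_eval cs x v) - a (op_eval cs x v))"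
proof (induction a c cs rule: op_mul_linear.induct)
  case (1 a c)
  then show ?case by (simp add: lin_zero[OF lin])
next
  case (2 a c d cs)
  then show ?case
    by (simp add: lin_add[OF lin] lin_diff[OF lin] comm_apply[of a x])
qed

lemma monic_vanishing:
  assumes "finite A" "A \<subseteq> Z"
  shows "\<exists>cs. set cs \<subseteq> Z \<and> length cs = Suc (card A) \<and> last cs = id \<and> (\<forall>x\<in>A. \<forall>v. op_eval cs x v = 0)"
  using assms
proof (induction A)
  case empty
  then show ?case
    using operator_algebraD(2)[OF alg] by (intro exI[of _ "[id]"]) auto
next
  case (insert a A)
  then obtain cs where cs: "set cs \<subseteq> Z" "length cs = Suc (card A)" "last cs = id"
    "\<forall>x\<in>A. \<forall>v. op_eval cs x v = 0"
    by blast
  have [simp]: "cs \<noteq> []"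
    using cs by auto
  show ?case
  \<comment> \<open>With added constant 0 this is exactly the product with \<open>X - a\<close>, and
    its leading coefficient is still \<open>id\<close>.\<close>
  proof (intro exI[of _ "op_mul_linear a (\<lambda>_. 0) cs"] conjI ballI allI)
    show "set (op_mul_linear a (\<lambda>_. 0) cs) \<subseteq> Z"
      using op_mul_linear_closed cs insert operator_algebraD(6)[OF alg] by auto
    fix x v assume "x \<in> insert a A"
    then show "op_eval (op_mul_linear a (\<lambda>_. 0) cs) x v = 0"
      using op_eval_mul_linear[of cs a x "\<lambda>_. 0" v] cs insert by (auto simp: lin_zero[OF lin])
  qed (use cs insert in \<open>auto simp: length_op_mul_linear last_op_mul_linear\<close>)
qed

text \<open>The leading coefficients cancel in the difference, which then has degree below
  \<open>card A\<close> and still vanishes on \<open>A\<close>. Uniqueness is what will make the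
  coefficients invariant under conjugation.\<close>

lemma monic_vanishing_unique:
  assumes "finite A" "A \<subseteq> Z"
    and c: "set cs \<subseteq> Z" "length cs = Suc (card A)" "last cs = id" "\<forall>x\<in>A. \<forall>v. op_eval cs x v = 0"
    and d: "set ds \<subseteq> Z" "length ds = Suc (card A)" "last ds = id" "\<forall>x\<in>A. \<forall>v. op_eval ds x v = 0"
  shows "cs = ds"
proof -
  let ?D = "\<lambda>f g v. f v - g v :: 'b"
  obtain as bs where ab: "cs = as @ [id]" "ds = bs @ [id]"
    using c d by (metis append_butlast_last_id length_0_conv nat.distinct(1))
  have len: "length as = card A" "length bs = card A"
    using ab c d by auto
  let ?e = "map2 ?D as bs"
  have e: "map2 ?D cs ds = ?e @ [\<lambda>_. 0]"
    using ab len by simp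
  have "\<forall>f\<in>set ?e. f = (\<lambda>_. 0)"
  proof (rule op_eval_roots)
    show "set ?e \<subseteq> Z"
    proof
      fix f assume "f \<in> set ?e"
      then obtain a b where "(a, b) \<in> set (zip as bs)" "f = ?D a b"
        by auto
      then show "f \<in> Z"
        using ab c d operator_algebraD(8)[OF alg, of a b] set_zip_leftD[of a b as bs] set_zip_rightD[of a b as bs]
        by (auto simp: subset_iff)
    qed
    fix x v assume x: "x \<in> A"
    then have "op_eval (map2 ?D cs ds) x v = 0"
      using op_eval_diff[of x cs ds v] c d assms(2) lin by (auto simp: subset_iff)
    then show "op_eval ?e x v = 0"
      unfolding e using x assms(2) lin by (auto simp: op_eval_snoc_zero subset_iff)
  qed (use assms len in auto)
  then have "as ! i = bs ! i" if "i < card A" for i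
    using that len nth_mem[of i ?e] by (auto simp: fun_eq_iff)
  then have "as = bs"
    using len by (intro nth_equalityI) auto
  then show ?thesis
    using ab by simp
qed

text \<open>The powers \<open>1, z, \<dots>, z\<^sup>m\<^sup>-\<^sup>1\<close> form a basis of the field \<open>F[z]\<close>, so \<open>V\<close> is an \<open>F[z]\<close>-vector space.\<close>

lemma degree_dvd_dim:
  assumes z: "z \<in> Z"
    and rel: "\<And>v. (z ^^ m) v \<in> span ((\<lambda>i. (z ^^ i) v) ` {..<m})"
    and ind: "\<And>c v. (\<And>v. (\<Sum>i<m. scale (c i) ((z ^^ i) v)) = 0) \<Longrightarrow> \<forall>i<m. c i = 0"
    and m: "m > 0"
  shows "m dvd dim UNIV"
proof -
  \<comment> \<open>Take such a \<open>U\<close> of largest dimension. A vector \<open>v\<close>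
    outside would allow \<open>F[z]v\<close>, of dimension \<open>m\<close>, to be added to
    it.\<close>
  define P where "P U \<longleftrightarrow> subspace U \<and> (\<forall>u\<in>U. z u \<in> U) \<and> m dvd dim U" for U
  have "P {0}"
    using subspace_single_0 by (simp add: P_def lin_zero[OF lin[OF z]])
  then obtain U where U: "P U" and max: "\<And>U'. P U' \<Longrightarrow> dim U' \<le> dim U"
    using ex_has_greatest_nat[of P "{0}" dim "Suc (dim UNIV)"] dim_subset[OF subset_UNIV] le_imp_less_Suc
    by (metis (no_types, lifting))
  have sU: "subspace U" and zU: "\<And>u. u \<in> U \<Longrightarrow> z u \<in> U" and dU: "m dvd dim U"
    using U by (auto simp: P_def)
  have "U = UNIV"
  proof (rule ccontr)
    assume "U \<noteq> UNIV"
    then obtain v where v: "v \<notin> U" by auto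
    let ?w = "\<lambda>i. (z ^^ i) v"
    let ?C = "span (?w ` {..<m})"
    define k where "k c x = (\<Sum>i<m. scale (c i) ((z ^^ i) x))" for c x
    have pow: "z ^^ i \<in> Z" for i
      using z operator_algebraD(2,4)[OF alg] by (induction i) (auto simp: id_def)
    have kZ: "k c \<in> Z" for c
      unfolding k_def using operator_algebra_sum[OF alg, of "{..<m}" "\<lambda>i x. scale (c i) ((z ^^ i) x)"]
        operator_algebraD(5)[OF alg pow] by auto
    have powU: "(z ^^ i) u \<in> U" if "u \<in> U" for i u
      using that zU by (induction i) auto
    have kU: "k c u \<in> U" if "u \<in> U" for c u
      unfolding k_def using that powU by (intro subspace_sum[OF sU] subspace_scale[OF sU]) auto
    \<comment> \<open>If the element \<open>k c\<close> of \<open>F[z]\<close> were injective, it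
      would map \<open>U\<close> onto itself for reasons of dimension; then
      \<open>k c v \<in> U\<close> would put \<open>v\<close> in \<open>U\<close>. The case
      \<open>k c v = 0\<close> gives independence of the powers applied to \<open>v\<close>.\<close>
    have key: "k c = (\<lambda>_. 0)" if kv: "k c v \<in> U" for c
    proof (rule ccontr)
      assume "k c \<noteq> (\<lambda>_. 0)"
      then have inj: "inj (k c)"
        using zero_or_inj[OF kZ] by auto
      interpret p: finite_dimensional_vector_space_pair_1 scale Basis scale ..
      interpret l: Vector_Spaces.linear scale scale "k c" by (rule lin[OF kZ])
      have "dim (k c ` U) = dim U"
        using p.dim_image_eq[OF lin[OF kZ]] inj by (metis inj_on_subset subset_UNIV)
      then have "k c ` U = U"
        using kU by (intro subspace_dim_equal l.subspace_image sU) auto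
      then obtain u where "u \<in> U" "k c v = k c u"
        using kv by force
      then show False
        using inj v by (metis injD)
    qed
    have indv: "\<forall>i\<in>{..<m}. c i = 0" if "(\<Sum>i\<in>{..<m}. scale (c i) (?w i)) = 0" for c
    proof -
      have "k c = (\<lambda>_. 0)"
        using that subspace_0[OF sU] by (intro key) (simp add: k_def)
      then show ?thesis
        using ind[of c] by (auto simp: k_def fun_eq_iff)
    qed
    have dC: "dim ?C = m"
      using dim_span_family(3)[OF finite_lessThan indv] by simp
    have inC: "\<exists>c. x = k c v" if "x \<in> ?C" for x
    proof -
      obtain c where "x = (\<Sum>y\<in>?w ` {..<m}. scale (c y) y)"
        using \<open>x \<in> ?C\<close> unfolding span_finite[OF finite_imageI[OF finite_lessThan]] by auto
      then show ?thesis
        unfolding k_def using dim_span_family(1)[OF finite_lessThan indv]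
        by (intro exI[of _ "\<lambda>i. c (?w i)"]) (simp add: sum.reindex)
    qed
    have "U \<inter> ?C = {0}"
      using inC key subspace_0[OF sU] span_zero by force
    then have dd: "dim {x + y |x y. x \<in> U \<and> y \<in> ?C} = dim U + m"
      using dim_sums_Int[OF sU subspace_span[of "?w ` {..<m}"]] dC by simp
    \<comment> \<open>Only the top power needs an argument: \<open>rel\<close> rewrites the
      \<open>m\<close>-th power by lower ones.\<close>
    have zC: "z y \<in> ?C" if "y \<in> ?C" for y
    proof -
      have "?C \<subseteq> {y. z y \<in> ?C}"
      proof (rule span_minimal)
        show "subspace {y. z y \<in> ?C}"
          by (rule subspaceI) (auto simp: lin_zero lin_add lin_scale lin[OF z] span_zero span_add span_scale)
        show "?w ` {..<m} \<subseteq> {y. z y \<in> ?C}"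
        proof clarsimp
          fix i assume "i < m"
          then show "z ((z ^^ i) v) \<in> ?C"
            using rel[of v] span_base[OF imageI[of "Suc i" "{..<m}" ?w]] by (cases "Suc i = m") auto
        qed
      qed
      then show ?thesis using that by auto
    qed
    have "P {x + y |x y. x \<in> U \<and> y \<in> ?C}"
      unfolding P_def dd using dU zU zC subspace_sums[OF sU subspace_span]
      by (auto simp: lin_add[OF lin[OF z]]) metis
    then show False
      using max dd m by fastforce
  qed
  then show ?thesis using dU by simp
qed

end

section \<open>Conjugates of an operator and its minimal polynomial\<close>

context irreducible_operators begin

lemma conj_eval:
  assumes g: "g \<in> carrier K"
  shows "op_eval (map (conj g) cs) (conj g x) v = conj g (op_eval cs x) v"
  by (induction cs) (auto simp: conj_def lin_add lin_zero rep_linear[OF g] g)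

lemma conj_scale: "g \<in> carrier K \<Longrightarrow> conj g (scale c) = scale c"
  by (auto simp: conj_def lin_scale rep_linear)

lemma conj_id: "g \<in> carrier K \<Longrightarrow> conj g id = id"
  by (auto simp: conj_def)

lemma conj_fixed_imp_scalar:
  assumes "Vector_Spaces.linear scale scale f" "\<And>g. g \<in> carrier K \<Longrightarrow> conj g f = f"
  shows "\<exists>c. f = scale c"
proof (rule commutant)
  fix g assume g: "g \<in> carrier K"
  show "f \<circ> \<rho> g = \<rho> g \<circ> f"
    using conj_rep[OF g, of f] assms(2)[OF g] by (auto simp: fun_eq_iff)
qed fact

theorem stable_commutative_scalar:
  assumes Z: "stable_algebra Z" and comm: "\<And>u v. u \<in> Z \<Longrightarrow> v \<in> Z \<Longrightarrow> u \<circ> v = v \<circ> u"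
    and z: "z \<in> Z"
  shows "\<exists>c. z = scale c"
proof -
  have alg: "operator_algebra Z" and st: "\<And>g u. g \<in> carrier K \<Longrightarrow> u \<in> Z \<Longrightarrow> conj g u \<in> Z"
    using Z by (auto simp: stable_algebra_def)
  interpret operator_field scale Basis Z
    using alg comm stable_commutative_zero_or_inj[OF Z comm] by unfold_locales auto
  have scZ: "scale c \<in> Z" for c
    by (rule operator_algebraD(9)[OF alg])
  let ?O = "(\<lambda>g. conj g z) ` carrier K"
  have OZ: "?O \<subseteq> Z"
    using st z by auto
  \<comment> \<open>Conjugation fixes scalar coefficients, so a scalar polynomial that kills
    \<open>z\<close> kills every conjugate of \<open>z\<close>.\<close>
  have root: "op_eval (map scale ds) x v = 0" if ds: "op_eval (map scale ds) z = (\<lambda>_. 0)" "x \<in> ?O" for ds x v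
  proof -
    obtain g where g: "g \<in> carrier K" "x = conj g z"
      using ds by auto
    have m: "map (conj g) (map scale ds) = map scale ds"
      using conj_scale[OF g(1)] by simp
    show ?thesis
      using conj_eval[OF g(1), of "map scale ds" z v] unfolding m ds(1) g(2)
      by (simp add: conj_def lin_zero rep_linear g)
  qed
  have few: "\<forall>d\<in>set ds. d = 0"
    if ds: "op_eval (map scale ds) z = (\<lambda>_. 0)" "A \<subseteq> ?O" "finite A" "length ds \<le> card A" for ds A
  proof -
    have "\<forall>f\<in>set (map scale ds). f = (\<lambda>_. 0)"
      using ds root OZ scZ by (intro op_eval_roots[of _ A]) auto
    then show ?thesis
      using nonzero_space by (auto simp: fun_eq_iff)
  qed
  \<comment> \<open>For a single \<open>v \<noteq> 0\<close> the first \<open>dim V + 1\<close>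
    powers of \<open>z\<close> applied to \<open>v\<close> are dependent. The resulting scalar
    polynomial in \<open>z\<close> lies in \<open>Z\<close> and kills \<open>v\<close>, hence is
    zero; an infinite orbit would give it too many roots.\<close>
  have fin: "finite ?O"
  proof (rule ccontr)
    assume "infinite ?O"
    then obtain A where A: "A \<subseteq> ?O" "finite A" "card A = Suc (dim UNIV)"
      using infinite_arbitrarily_large by blast
    obtain v :: 'b where v: "v \<noteq> 0"
      using nonzero_space by auto
    obtain c where c: "(\<Sum>i<Suc (dim UNIV). scale (c i) ((z ^^ i) v)) = 0" "\<exists>i<Suc (dim UNIV). c i \<noteq> 0"
      using large_family_dependent[of "\<lambda>i. (z ^^ i) v"] by blast
    define ds where "ds = map c [0..<Suc (dim UNIV)]"
    have "op_eval (map scale ds) z v = 0"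
      unfolding op_eval_scale_list[OF lin[OF z]] ds_def using c(1) by (simp del: sum.lessThan_Suc upt_Suc)
    moreover have "op_eval (map scale ds) z \<in> Z"
      using scZ z by (intro op_eval_closed) auto
    ultimately have "op_eval (map scale ds) z = (\<lambda>_. 0)"
      using zero_or_inj v by (metis injD lin lin_zero)
    then have "\<forall>d\<in>set ds. d = 0"
      using A by (intro few) (auto simp: ds_def)
    then show False
      using c(2) by (auto simp: ds_def simp del: upt_Suc)
  qed
  define m where "m = card ?O"
  have mpos: "m > 0"
    using fin K.one_closed by (auto simp: m_def card_gt_0_iff)
  obtain cs where cs: "set cs \<subseteq> Z" "length cs = Suc m" "last cs = id" "\<forall>x\<in>?O. \<forall>v. op_eval cs x v = 0"
    using monic_vanishing[OF fin OZ] m_def by auto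
  have csne: "cs \<noteq> []"
    using cs by auto
  \<comment> \<open>Conjugating the coefficients gives another monic polynomial with the same roots,
    since \<open>g\<close> permutes the orbit.\<close>
  have cs_fixed: "map (conj g) cs = cs" if g: "g \<in> carrier K" for g
  proof (rule monic_vanishing_unique[OF fin OZ])
    show "set (map (conj g) cs) \<subseteq> Z"
      using cs st g by auto
    show "last (map (conj g) cs) = id"
      using cs csne g by (simp add: last_map conj_id)
    show "\<forall>x\<in>?O. \<forall>v. op_eval (map (conj g) cs) x v = 0"
    proof (intro ballI allI)
      fix x v assume "x \<in> ?O"
      then obtain h where h: "h \<in> carrier K" "x = conj h z" by auto
      have x: "x = conj g (conj (inv g \<otimes> h) z)"
        using g h by (simp add: conj_mult conj_inv)
      have "\<forall>v. op_eval cs (conj (inv g \<otimes> h) z) v = 0"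
        using cs(4) g h by auto
      then show "op_eval (map (conj g) cs) x v = 0"
        unfolding x conj_eval[OF g] using g by (simp add: conj_def lin_zero rep_linear)
    qed
  qed (use cs m_def in auto)
  have "\<exists>c. f = scale c" if f: "f \<in> set cs" for f
  proof (rule conj_fixed_imp_scalar)
    show "Vector_Spaces.linear scale scale f"
      using f cs lin by auto
    fix g assume "g \<in> carrier K"
    then show "conj g f = f"
      using cs_fixed f by (metis map_idI in_set_conv_nth length_map nth_map)
  qed
  then obtain k where k: "\<And>f. f \<in> set cs \<Longrightarrow> f = scale (k f)"
    by metis
  define ks where "ks = map k cs"
  have cs_ks: "cs = map scale ks"
    using k by (simp add: ks_def map_idI comp_def)
  have len: "length ks = Suc m"
    using cs by (simp add: ks_def)
  have zO: "z \<in> ?O"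
    using conj_one[of z] by (intro image_eqI[of _ _ \<one>]) auto
  have last: "scale (ks ! m) = id"
    using cs csne len unfolding cs_ks by (metis diff_Suc_1 last_conv_nth length_map lessI nth_map)
  \<comment> \<open>As \<open>z\<close> belongs to its own orbit, the monic scalar polynomial of
    degree \<open>m\<close> kills it.\<close>
  have rel: "(z ^^ m) v \<in> span ((\<lambda>i. (z ^^ i) v) ` {..<m})" for v
  proof -
    have "op_eval (map scale ks) z v = 0"
      using cs(4) zO cs_ks by auto
    then have "(\<Sum>i<m. scale (ks ! i) ((z ^^ i) v)) + (z ^^ m) v = 0"
      unfolding op_eval_scale_list[OF lin[OF z]] len using last by simp
    then have "(z ^^ m) v = - (\<Sum>i<m. scale (ks ! i) ((z ^^ i) v))"
      by (simp add: eq_neg_iff_add_eq_0 add.commute)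
    also have "\<dots> \<in> span ((\<lambda>i. (z ^^ i) v) ` {..<m})"
      by (intro span_neg span_sum span_scale span_base) auto
    finally show ?thesis .
  qed
  \<comment> \<open>A relation of degree below \<open>m\<close> would have all \<open>m\<close>
    conjugates as roots. With \<open>rel\<close> this makes \<open>m\<close> the degree of
    \<open>F[z]\<close>.\<close>
  have ind: "\<forall>i<m. c i = 0" if c: "\<And>v. (\<Sum>i<m. scale (c i) ((z ^^ i) v)) = 0" for c
  proof -
    define ds where "ds = map c [0..<m]"
    have "op_eval (map scale ds) z = (\<lambda>_. 0)"
      unfolding op_eval_scale_list[OF lin[OF z]] fun_eq_iff ds_def using c by simp
    then have "\<forall>d\<in>set ds. d = 0"
      using fin by (intro few[of ds ?O]) (auto simp: ds_def m_def)
    then show ?thesis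
      by (auto simp: ds_def)
  qed
  have "m dvd dim UNIV"
    using degree_dvd_dim[OF z rel ind mpos] by simp
  then have "conj g z = z" if "g \<in> carrier K" for g
    using small_orbit_fixed[of conj z g] fin that conj_one conj_mult by (auto simp: m_def)
  then show ?thesis
    using conj_fixed_imp_scalar lin[OF z] by auto
qed

end

section \<open>Stable algebras are central simple\<close>

context operator_space begin

lemma submodI:
  "subspace W \<Longrightarrow> (\<And>u w. u \<in> S \<Longrightarrow> w \<in> W \<Longrightarrow> u w \<in> W) \<Longrightarrow> submod scale S W"
  by (simp add: submod_def)

lemma submodD:
  assumes "submod scale S W"
  shows "subspace W" "u \<in> S \<Longrightarrow> w \<in> W \<Longrightarrow> u w \<in> W"
  using assms by (auto simp: submod_def)

lemma submod_sums:
  assumes lin: "\<And>u. u \<in> S \<Longrightarrow> Vector_Spaces.linear scale scale u"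
    and A: "submod scale S A" and B: "submod scale S B"
  shows "submod scale S {x + y |x y. x \<in> A \<and> y \<in> B}"
proof (rule submodI)
  show "subspace {x + y |x y. x \<in> A \<and> y \<in> B}"
    by (rule subspace_sums) (use submodD(1)[OF A] submodD(1)[OF B] in auto)
next
  fix u w assume u: "u \<in> S" and "w \<in> {x + y |x y. x \<in> A \<and> y \<in> B}"
  then obtain x y where "w = x + y" "x \<in> A" "y \<in> B" by auto
  then show "u w \<in> {x + y |x y. x \<in> A \<and> y \<in> B}"
    using lin_add[OF lin[OF u], of x y] submodD(2)[OF A u, of x] submodD(2)[OF B u, of y] by blast
qed

lemma submod_Int: "submod scale S A \<Longrightarrow> submod scale S B \<Longrightarrow> submod scale S (A \<inter> B)"
  by (auto simp: submod_def subspace_inter)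

lemma submod_span:
  assumes lin: "\<And>u. u \<in> S \<Longrightarrow> Vector_Spaces.linear scale scale u"
    and A: "\<And>u w. u \<in> S \<Longrightarrow> w \<in> A \<Longrightarrow> u w \<in> span A"
  shows "submod scale S (span A)"
proof (rule submodI[OF subspace_span])
  fix u w assume u: "u \<in> S" and w: "w \<in> span A"
  have "span A \<subseteq> {w. u w \<in> span A}"
  proof (rule span_minimal)
    show "subspace {w. u w \<in> span A}"
      by (rule subspaceI) (auto simp: lin_zero lin_add lin_scale lin[OF u] span_zero span_add span_scale)
  qed (use A u in auto)
  then show "u w \<in> span A"
    using w by auto
qed

lemma simple_submod_exists:
  assumes M: "submod scale S M" "M \<noteq> {0}"
  shows "\<exists>W\<subseteq>M. simple_submod scale S W"
proof -
  define P where "P W \<longleftrightarrow> submod scale S W \<and> W \<noteq> {0} \<and> W \<subseteq> M" for W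
  obtain W where W: "P W" and min: "\<And>U. P U \<Longrightarrow> dim W \<le> dim U"
    using ex_has_least_nat[of P M dim] M by (auto simp: P_def)
  have "simple_submod scale S W"
    unfolding simple_submod_def
  proof (intro conjI allI impI)
    fix U assume U: "submod scale S U \<and> U \<subseteq> W"
    show "U = {0} \<or> U = W"
    proof (cases "U = {0}")
      case False
      then have "P U"
        using U W by (auto simp: P_def)
      then have "U = W"
        using min[of U] U W by (intro subspace_dim_equal) (auto simp: P_def submod_def)
      then show ?thesis ..
    qed simp
  qed (use W in \<open>auto simp: P_def\<close>)
  then show ?thesis
    using W by (auto simp: P_def)
qed

text \<open>Choose \<open>C\<close> of largest dimension with \<open>U \<inter> C = {0}\<close>. If
  \<open>U + C\<close> missed some simple \<open>W\<close>, it would meet \<open>W\<close> in 0, and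
  \<open>C + W\<close> would be a larger choice.\<close>

lemma semisimple_complement:
  assumes lin: "\<And>u. u \<in> S \<Longrightarrow> Vector_Spaces.linear scale scale u"
    and ss: "semisimple_mod scale S" and U: "submod scale S U"
  shows "\<exists>C. submod scale S C \<and> U \<inter> C = {0} \<and> (\<forall>v. \<exists>u\<in>U. \<exists>c\<in>C. v = u + c)"
proof -
  define P where "P C \<longleftrightarrow> submod scale S C \<and> U \<inter> C = {0}" for C
  have "P {0}"
    using subspace_0[OF submodD(1)[OF U]] lin_zero[OF lin] subspace_single_0 by (auto simp: P_def submod_def)
  then obtain C where C: "P C" and max: "\<And>D. P D \<Longrightarrow> dim D \<le> dim C"
    using ex_has_greatest_nat[of P "{0}" dim "Suc (dim UNIV)"] dim_subset[OF subset_UNIV] le_imp_less_Suc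
    by (metis (no_types, lifting))
  define M where "M = {x + y |x y. x \<in> U \<and> y \<in> C}"
  have sC: "submod scale S C" and UC: "U \<inter> C = {0}"
    using C by (auto simp: P_def)
  have sM: "submod scale S M"
    using submod_sums[OF lin U sC] by (simp add: M_def)
  have "M = UNIV"
  proof (rule ccontr)
    assume "M \<noteq> UNIV"
    then obtain W where W: "simple_submod scale S W" "\<not> W \<subseteq> M"
      using ss span_minimal[of "\<Union>{W. simple_submod scale S W}" M] submodD(1)[OF sM]
      unfolding semisimple_mod_def by blast
    have sW: "submod scale S W" "W \<noteq> {0}"
      using W by (auto simp: simple_submod_def)
    have "W \<inter> M = {0} \<or> W \<inter> M = W"
      using W submod_Int[OF sW(1) sM] unfolding simple_submod_def by blast
    then have WM: "w = 0" if "w \<in> W" "w \<in> M" for w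
      using that W(2) by blast
    have z: "0 \<in> U" "0 \<in> C" "0 \<in> W"
      using U sC sW by (auto simp: submod_def subspace_0)
    have CM: "c \<in> M" if "c \<in> C" for c
      using that z by (force simp: M_def)
    let ?D = "{x + y |x y. x \<in> C \<and> y \<in> W}"
    have "C \<inter> W = {0}"
      using z CM WM by blast
    then have "dim ?D = dim C + dim W"
      using dim_sums_Int[OF submodD(1)[OF sC] submodD(1)[OF sW(1)]] by simp
    moreover have "dim W > 0"
      using sW z by (metis dim_eq_0 gr_zeroI subset_singletonD empty_iff)
    moreover have "P ?D"
      unfolding P_def
    proof (intro conjI equalityI subsetI)
      show "submod scale S ?D"
        using submod_sums[OF lin sC sW(1)] by simp
      fix u assume "u \<in> U \<inter> ?D"
      then obtain c w where u: "u \<in> U" "u = c + w" "c \<in> C" "w \<in> W" by auto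
      have "- c \<in> C"
        using u submodD(1)[OF sC] by (simp add: subspace_neg)
      then have "u + - c \<in> M"
        unfolding M_def using u by blast
      then have "w = 0"
        using u WM[of w] by simp
      then show "u \<in> {0}"
        using u UC by auto
    qed (use z in force)
    ultimately show False
      using max[of ?D] by linarith
  qed
  then have "\<exists>u\<in>U. \<exists>c\<in>C. v = u + c" for v
    using UNIV_I[of v] unfolding M_def by blast
  then show ?thesis
    using sC UC by blast
qed

text \<open>The last clause is the purpose: the projection commutes with every operator that
  preserves both summands, which later places it in a commutant and in a centre.\<close>

lemma projection_exists:
  assumes A: "subspace A" and B: "subspace B" and AB: "A \<inter> B = {0}" "\<And>v. \<exists>a\<in>A. \<exists>b\<in>B. v = a + b"
  obtains \<pi> where "Vector_Spaces.linear scale scale \<pi>" "\<And>v. v \<in> A \<Longrightarrow> \<pi> v = v" "\<And>v. \<pi> v \<in> A"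
    "\<And>f v. Vector_Spaces.linear scale scale f \<Longrightarrow> f ` A \<subseteq> A \<Longrightarrow> f ` B \<subseteq> B \<Longrightarrow> f (\<pi> v) = \<pi> (f v)"
proof -
  obtain \<pi> where \<pi>: "\<And>v. \<pi> v \<in> A" "\<And>v. v - \<pi> v \<in> B"
    using AB(2) by (metis add_diff_cancel_left')
  \<comment> \<open>Linearity and the commutation clause both follow from this characterisation of
    the value.\<close>
  have uniq: "\<pi> v = a" if "a \<in> A" "v - a \<in> B" for a v
  proof -
    have "\<pi> v - a \<in> A"
      using subspace_diff[OF A] \<pi> that by auto
    moreover have "(v - a) - (v - \<pi> v) \<in> B"
      using subspace_diff[OF B] \<pi> that by blast
    ultimately have "\<pi> v - a \<in> A \<inter> B"
      by simp
    then show ?thesis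
      using AB by simp
  qed
  have id: "\<pi> v = v" if "v \<in> A" for v
    using that subspace_0[OF B] by (intro uniq) auto
  have lin: "Vector_Spaces.linear scale scale \<pi>"
  proof (rule linearI)
    fix x y c
    show "\<pi> (x + y) = \<pi> x + \<pi> y"
      using subspace_add[OF A \<pi>(1) \<pi>(1)] subspace_add[OF B \<pi>(2)[of x] \<pi>(2)[of y]]
      by (intro uniq) (auto simp: algebra_simps)
    show "\<pi> (scale c x) = scale c (\<pi> x)"
      using subspace_scale[OF A \<pi>(1)] subspace_scale[OF B \<pi>(2)[of x], of c]
      by (intro uniq) (auto simp: algebra_simps scale_right_diff_distrib)
  qed
  have comm: "f (\<pi> v) = \<pi> (f v)"
    if f: "Vector_Spaces.linear scale scale f" "f ` A \<subseteq> A" "f ` B \<subseteq> B" for f v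
    using f \<pi>[of v] lin_diff[OF f(1), of v "\<pi> v"] by (intro uniq[symmetric]) auto
  show ?thesis
    by (rule that[OF lin id \<pi>(1) comm])
qed

lemma operator_algebra_End_over:
  assumes R: "operator_algebra R"
  shows "operator_algebra (End_over scale R)"
proof -
  have comm: "f (u x) = u (f x)" if "f \<in> End_over scale R" "u \<in> R" for f u x
    using that by (auto simp: End_over_def fun_eq_iff)
  have lin: "Vector_Spaces.linear scale scale f" if "f \<in> End_over scale R" for f
    using that by (auto simp: End_over_def)
  have I: "f \<in> End_over scale R" if "Vector_Spaces.linear scale scale f" "\<And>u x. u \<in> R \<Longrightarrow> f (u x) = u (f x)" for f
    using that by (auto simp: End_over_def fun_eq_iff)
  show ?thesis
    unfolding operator_algebra_def
  proof (intro conjI ballI allI)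
    show "id \<in> End_over scale R"
      by (intro I linearI) auto
    fix f assume f: "f \<in> End_over scale R"
    show "Vector_Spaces.linear scale scale f"
      by (rule lin[OF f])
    show "(\<lambda>x. scale c (f x)) \<in> End_over scale R" for c
      by (intro I linearI)
        (simp_all add: comm[OF f] lin_add[OF lin[OF f]] lin_scale[OF lin[OF f]] scale_right_distrib mult.commute
          lin_scale[OF operator_algebraD(1)[OF R]])
    fix g assume g: "g \<in> End_over scale R"
    show "(\<lambda>x. f x + g x) \<in> End_over scale R"
      by (intro I linearI)
        (simp_all add: comm[OF f] comm[OF g] lin_add[OF lin[OF f]] lin_scale[OF lin[OF f]] lin_add[OF lin[OF g]]
          lin_scale[OF lin[OF g]] scale_right_distrib lin_add[OF operator_algebraD(1)[OF R]])
    show "f \<circ> g \<in> End_over scale R"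
      by (intro I linearI)
        (simp_all add: comm[OF f] comm[OF g] lin_add[OF lin[OF f]] lin_scale[OF lin[OF f]] lin_add[OF lin[OF g]]
          lin_scale[OF lin[OF g]])
  qed
qed

definition center :: "('b \<Rightarrow> 'b) set \<Rightarrow> ('b \<Rightarrow> 'b) set" where
  "center R = {z \<in> R. \<forall>u\<in>R. z \<circ> u = u \<circ> z}"

lemma center_eq: "operator_algebra R \<Longrightarrow> center R = R \<inter> End_over scale R"
  using operator_algebraD(1) by (auto simp: center_def End_over_def)

lemma operator_algebra_center:
  assumes R: "operator_algebra R"
  shows "operator_algebra (center R)"
  unfolding center_eq[OF R] operator_algebra_def
  using operator_algebraD[OF R] operator_algebraD[OF operator_algebra_End_over[OF R]] by simp

lemma function_vector_space: "vector_space (\<lambda>(c::'a) (f::'b \<Rightarrow> 'b) x. scale c (f x))"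
  by unfold_locales (auto simp: fun_eq_iff scale_right_distrib scale_left_distrib)

lemma sum_operators_apply: "(sum F A :: 'b \<Rightarrow> 'b) x = (\<Sum>i\<in>A. F i x)"
  by (induction A rule: infinite_finite_induct) auto

text \<open>All of \<open>R\<close> lies in the span of finitely many elementary operators, so a
  maximal independent subset of \<open>R\<close> is finite, and it spans \<open>R\<close>.\<close>

lemma finite_spanning_operators:
  assumes R: "operator_algebra R"
  shows "\<exists>B. finite B \<and> B \<subseteq> R \<and> (\<forall>f\<in>R. \<exists>c. f = (\<lambda>x. \<Sum>b\<in>B. scale (c b) (b x)))"
proof -
  interpret fv: vector_space "\<lambda>(c::'a) (f::'b \<Rightarrow> 'b) x. scale c (f x)"
    by (rule function_vector_space)
  \<comment> \<open>The operator that multiplies \<open>b'\<close> by the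
    \<open>b\<close>-coordinate of the argument.\<close>
  define E where "E = (\<lambda>(b, b') v. scale (representation Basis v b) b')"
  have "f \<in> fv.span (E ` (Basis \<times> Basis))" if f: "f \<in> R" for f
  proof -
    note lin = operator_algebraD(1)[OF R f]
    have rep: "(\<Sum>b\<in>Basis. scale (representation Basis v b) b) = v" for v
      using sum_representation_eq[OF independent_Basis _ finite_Basis order_refl, of v] span_Basis by simp
    have "f v = (\<Sum>p\<in>Basis \<times> Basis. scale (representation Basis (f (fst p)) (snd p)) (E p v))" for v
    proof -
      have "f v = (\<Sum>b\<in>Basis. scale (representation Basis v b) (f b))"
        by (subst rep[symmetric, of v]) (simp add: lin_sum[OF lin] lin_scale[OF lin])
      also have "\<dots> = (\<Sum>b\<in>Basis. scale (representation Basis v b) (\<Sum>b'\<in>Basis. scale (representation Basis (f b) b') b'))"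
        by (simp add: rep)
      also have "\<dots> = (\<Sum>p\<in>Basis \<times> Basis. scale (representation Basis (f (fst p)) (snd p)) (E p v))"
        by (simp add: sum.cartesian_product scale_sum_right E_def case_prod_beta mult.commute)
      finally show ?thesis .
    qed
    then have "f = (\<Sum>p\<in>Basis \<times> Basis. (\<lambda>x. scale (representation Basis (f (fst p)) (snd p)) (E p x)))"
      unfolding fun_eq_iff sum_operators_apply by blast
    also have "\<dots> \<in> fv.span (E ` (Basis \<times> Basis))"
      by (intro fv.span_sum fv.span_scale fv.span_base) auto
    finally show ?thesis .
  qed
  then have sub: "R \<subseteq> fv.span (E ` (Basis \<times> Basis))" by auto
  obtain B where B: "B \<subseteq> R" "fv.independent B" "R \<subseteq> fv.span B"
    using fv.maximal_independent_subset[of R] by blast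
  have fin: "finite B"
    using fv.independent_span_bound[OF _ B(2), of "E ` (Basis \<times> Basis)"] sub B(1) finite_Basis by auto
  have "\<exists>c. f = (\<lambda>x. \<Sum>b\<in>B. scale (c b) (b x))" if "f \<in> R" for f
  proof -
    have "f \<in> fv.span B"
      using B that by auto
    then obtain c where "f = (\<Sum>b\<in>B. (\<lambda>x. scale (c b) (b x)))"
      unfolding fv.span_finite[OF fin] by auto
    then show ?thesis
      by (intro exI[of _ c]) (simp add: fun_eq_iff sum_operators_apply)
  qed
  then show ?thesis
    using fin B(1) by blast
qed

lemma op_alg_ring:
  assumes R: "operator_algebra R"
  shows "ring (op_alg scale R)"
  using ring.subring_is_ring[OF End_ring] R
  by (simp flip: unital_subalgebra_iff_operator_algebra add: unital_subalgebra_def)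

lemma op_alg_F_algebra:
  assumes R: "operator_algebra R"
  shows "F_algebra (op_alg scale R)"
proof -
  interpret r: ring "op_alg scale R" by (rule op_alg_ring[OF R])
  have "Module.module class_ring (op_alg scale R)"
  proof (rule module.intro)
    show "cring (class_ring :: 'a ring)"
      by (rule class_cring.cring_axioms)
    show "abelian_group (op_alg scale R)" ..
    show "module_axioms class_ring (op_alg scale R)"
      by unfold_locales (auto simp: class_ring_simps operator_algebraD[OF R] scale_right_distrib scale_left_distrib)
  qed
  then show ?thesis
    using r.ring_axioms operator_algebraD(1)[OF R] by (auto simp: F_algebra_def fun_eq_iff lin_scale)
qed

lemma finsum_op_alg:
  assumes R: "operator_algebra R" and "finite B" "\<And>b. b \<in> B \<Longrightarrow> F b \<in> R"
  shows "(\<Oplus>\<^bsub>op_alg scale R\<^esub>b\<in>B. F b) = (\<lambda>x. \<Sum>b\<in>B. F b x)"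
proof -
  interpret r: ring "op_alg scale R" by (rule op_alg_ring[OF R])
  show ?thesis
    using assms(2,3)
    by (induction B) (auto simp: r.finsum_insert Pi_def)
qed

lemma op_alg_finite_dim:
  assumes R: "operator_algebra R"
  shows "finite_dim_algebra (op_alg scale R)"
proof -
  obtain B where B: "finite B" "B \<subseteq> R" "\<forall>f\<in>R. \<exists>c. f = (\<lambda>x. \<Sum>b\<in>B. scale (c b) (b x))"
    using finite_spanning_operators[OF R] by blast
  have "\<exists>c. f = (\<Oplus>\<^bsub>op_alg scale R\<^esub>b\<in>B. c b \<odot>\<^bsub>op_alg scale R\<^esub> b)" if f: "f \<in> R" for f
  proof -
    obtain c where "f = (\<lambda>x. \<Sum>b\<in>B. scale (c b) (b x))"
      using B(3) f by blast
    moreover have "(\<Oplus>\<^bsub>op_alg scale R\<^esub>b\<in>B. c b \<odot>\<^bsub>op_alg scale R\<^esub> b) = (\<lambda>x. \<Sum>b\<in>B. scale (c b) (b x))"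
      using B operator_algebraD(5)[OF R] by (subst finsum_op_alg[OF R]) auto
    ultimately show ?thesis by (intro exI[of _ c]) (simp only:)
  qed
  then show ?thesis
    using B by (auto simp: finite_dim_algebra_def)
qed

end

context linear_representation begin

lemma conj_comp: "g \<in> carrier K \<Longrightarrow> conj g (u \<circ> v) = conj g u \<circ> conj g v"
  by (auto simp: conj_def)

lemma conj_linear:
  "g \<in> carrier K \<Longrightarrow> Vector_Spaces.linear scale scale u \<Longrightarrow> Vector_Spaces.linear scale scale (conj g u)"
  by (rule linearI) (auto simp: conj_def lin_add lin_scale rep_linear)

text \<open>\<open>conj g f\<close> commutes with \<open>u\<close> exactly when \<open>f\<close>
  commutes with \<open>conj (inv g) u\<close>, and the latter stays in \<open>R\<close>.\<close>

lemma stable_End_over: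
  assumes R: "stable_algebra R"
  shows "stable_algebra (End_over scale R)"
  unfolding stable_algebra_def
proof (intro conjI ballI)
  show "operator_algebra (End_over scale R)"
    using R operator_algebra_End_over by (auto simp: stable_algebra_def)
  fix g f assume g: "g \<in> carrier K" and f: "f \<in> End_over scale R"
  have "conj g f \<circ> u = u \<circ> conj g f" if u: "u \<in> R" for u
  proof -
    have "conj (inv g) u \<in> R"
      using R g u by (auto simp: stable_algebra_def)
    then have "f \<circ> conj (inv g) u = conj (inv g) u \<circ> f"
      using f by (auto simp: End_over_def)
    then have "conj g (f \<circ> conj (inv g) u) = conj g (conj (inv g) u \<circ> f)"
      by simp
    then show ?thesis
      using g by (simp add: conj_comp conj_inv)
  qed
  then show "conj g f \<in> End_over scale R"
    using f conj_linear[OF g] by (auto simp: End_over_def)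
qed

end

section \<open>Clifford's argument and simplicity of stable algebras\<close>

context irreducible_operators begin

text \<open>Clifford's argument: stability of \<open>R\<close> makes \<open>\<rho> g\<close> carry
  \<open>R\<close>-submodules to \<open>R\<close>-submodules, so the translates of a simple one are
  simple, and by irreducibility they span \<open>V\<close>.\<close>

lemma stable_semisimple:
  assumes R: "stable_algebra R"
  shows "semisimple_mod scale R"
proof -
  have alg: "operator_algebra R" and st: "\<And>g u. g \<in> carrier K \<Longrightarrow> u \<in> R \<Longrightarrow> conj g u \<in> R"
    using R by (auto simp: stable_algebra_def)
  obtain W where W: "simple_submod scale R W"
    using simple_submod_exists[of R UNIV] nonzero_space by (auto simp: submod_def subspace_UNIV)
  then have sW: "submod scale R W" "W \<noteq> {0}"
    by (auto simp: simple_submod_def)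
  have sub: "submod scale R (\<rho> g ` U)" if g: "g \<in> carrier K" and U: "submod scale R U" for g U
  proof (rule submodI)
    show "subspace (\<rho> g ` U)"
      using rep_image_subspace[OF g] submodD(1)[OF U] .
    fix u w assume u: "u \<in> R" and "w \<in> \<rho> g ` U"
    then obtain x where x: "x \<in> U" "w = \<rho> g x" by auto
    have "u w = \<rho> g (conj (inv g) u x)"
      using g x by (simp add: conj_def)
    then show "u w \<in> \<rho> g ` U"
      using submodD(2)[OF U st[of "inv g" u]] g u x by auto
  qed
  have simple: "simple_submod scale R (\<rho> g ` W)" if g: "g \<in> carrier K" for g
    unfolding simple_submod_def
  proof (intro conjI allI impI)
    show "submod scale R (\<rho> g ` W)"
      by (rule sub[OF g sW(1)])
    have img0: "\<rho> g ` {0} = {0}"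
      using lin_zero[OF rep_linear[OF g]] by simp
    then show "\<rho> g ` W \<noteq> {0}"
      using sW inj_image_eq_iff[OF bij_is_inj[OF rep_bij[OF g]], of W "{0}"] by simp
    fix U assume U: "submod scale R U \<and> U \<subseteq> \<rho> g ` W"
    have img: "\<rho> g ` \<rho> (inv g) ` U = U"
      using g by (simp add: image_image)
    have "\<rho> (inv g) ` U \<subseteq> W"
      using U g by auto
    then have "\<rho> (inv g) ` U = {0} \<or> \<rho> (inv g) ` U = W"
      using W U sub[of "inv g" U] g by (auto simp: simple_submod_def)
    then show "U = {0} \<or> U = \<rho> g ` W"
      using img img0 by metis
  qed
  obtain w where w: "w \<in> W" "w \<noteq> 0"
    using sW subspace_0[OF submodD(1)[OF sW(1)]] by auto
  have "(\<Union>g\<in>carrier K. \<rho> g ` W) \<subseteq> \<Union>{W. simple_submod scale R W}"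
    using simple by auto
  then show ?thesis
    unfolding semisimple_mod_def using span_mono span_orbit[OF w] by (metis top.extremum_uniqueI)
qed

lemma stable_center_scalar:
  assumes R: "stable_algebra R" and z: "z \<in> center R"
  shows "\<exists>c. z = scale c"
proof (rule stable_commutative_scalar[of "center R"])
  show "stable_algebra (center R)"
    unfolding stable_algebra_def
  proof (intro conjI ballI)
    show "operator_algebra (center R)"
      using R operator_algebra_center by (auto simp: stable_algebra_def)
    fix g f assume g: "g \<in> carrier K" and f: "f \<in> center R"
    have "conj g f \<circ> u = u \<circ> conj g f" if u: "u \<in> R" for u
    proof -
      have "conj (inv g) u \<in> R"
        using R g u by (auto simp: stable_algebra_def)
      then have "f \<circ> conj (inv g) u = conj (inv g) u \<circ> f"
        using f by (auto simp: center_def)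
      then have "conj g (f \<circ> conj (inv g) u) = conj g (conj (inv g) u \<circ> f)"
        by simp
      then show ?thesis
        using g by (simp add: conj_comp conj_inv)
    qed
    then show "conj g f \<in> center R"
      using f g R by (auto simp: center_def stable_algebra_def)
  qed
  show "u \<circ> v = v \<circ> u" if "u \<in> center R" "v \<in> center R" for u v
    using that unfolding center_def by blast
qed (rule z)

text \<open>\<open>I\<close> is a nonzero two-sided ideal. It annihilates no nonzero vector, because
  the projection onto its annihilator is scalar; then every vector is fixed by some element of
  \<open>I\<close>, and these local units combine into the identity.\<close>

theorem stable_simple:
  assumes R: "stable_algebra R" and IR: "I \<subseteq> R"
    and add: "\<And>x y. x \<in> I \<Longrightarrow> y \<in> I \<Longrightarrow> (\<lambda>v. x v + y v) \<in> I"
    and left: "\<And>r x. r \<in> R \<Longrightarrow> x \<in> I \<Longrightarrow> r \<circ> x \<in> I"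
    and right: "\<And>r x. r \<in> R \<Longrightarrow> x \<in> I \<Longrightarrow> x \<circ> r \<in> I"
    and x0: "x0 \<in> I" "x0 \<noteq> (\<lambda>_. 0)"
  shows "id \<in> I"
proof -
  have alg: "operator_algebra R"
    using R by (auto simp: stable_algebra_def)
  note lin = operator_algebraD(1)[OF alg]
  have linI: "x \<in> I \<Longrightarrow> Vector_Spaces.linear scale scale x" for x
    using IR lin by auto
  have sc: "(\<lambda>v. scale c (x v)) \<in> I" if "x \<in> I" for c x
    using left[OF operator_algebraD(9)[OF alg, of c] that] by (simp add: comp_def)
  have zeroI: "(\<lambda>_. 0) \<in> I"
    using sc[OF x0(1), of 0] by simp
  have diff: "(\<lambda>v. x v - y v) \<in> I" if "x \<in> I" "y \<in> I" for x y
    using add[OF that(1) sc[OF that(2), of "-1"]] by (simp add: scale_minus_left)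
  have comp: "\<exists>C. submod scale R C \<and> U \<inter> C = {0} \<and> (\<forall>v. \<exists>u\<in>U. \<exists>c\<in>C. v = u + c)"
    if "submod scale R U" for U
    by (rule semisimple_complement[OF _ stable_semisimple[OF R] that]) (rule lin)
  define A where "A = {v. \<forall>x\<in>I. x v = 0}"
  define T where "T = span {x v |x v. x \<in> I}"
  have A: "submod scale R A"
  proof (rule submodI)
    show "subspace A"
      by (rule subspaceI) (auto simp: A_def linI lin_zero lin_add lin_scale)
    show "u w \<in> A" if "u \<in> R" "w \<in> A" for u w
      using right[OF that(1)] that(2) by (fastforce simp: A_def)
  qed
  have T: "submod scale R T"
    unfolding T_def
  proof (rule submod_span[OF lin])
    fix u w assume u: "u \<in> R" and "w \<in> {x v |x v. x \<in> I}"
    then obtain x v where "w = x v" "x \<in> I" by auto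
    then have "u w = (u \<circ> x) v" "u \<circ> x \<in> I"
      using left u by auto
    then show "u w \<in> span {x v |x v. x \<in> I}"
      by (intro span_base) blast
  qed
  have inT: "x v \<in> T" if "x \<in> I" for x v
    unfolding T_def using that by (intro span_base) auto
  \<comment> \<open>For an \<open>R\<close>-complement \<open>C\<close> of \<open>T = I V\<close>,
    the ideal maps \<open>C\<close> into \<open>T \<inter> C = {0}\<close>, so \<open>C\<close> is
    annihilated.\<close>
  have AT: "\<exists>a\<in>A. \<exists>t\<in>T. v = a + t" for v
  proof -
    obtain C where C: "submod scale R C" "T \<inter> C = {0}" "\<forall>v. \<exists>t\<in>T. \<exists>c\<in>C. v = t + c"
      using comp[OF T] by auto
    have "c \<in> A" if "c \<in> C" for c
    proof -
      have "x c \<in> T \<inter> C" if "x \<in> I" for x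
        using that \<open>c \<in> C\<close> inT submodD(2)[OF C(1)] IR by auto
      then show ?thesis
        using C(2) by (auto simp: A_def)
    qed
    then show ?thesis
      using C(3) by (metis add.commute)
  qed
  \<comment> \<open>For an \<open>R\<close>-complement \<open>C\<close> of \<open>A\<close>,
    applying the ideal to \<open>V\<close> is the same as applying it to \<open>C\<close>, so
    \<open>T\<close> lies in \<open>C\<close>.\<close>
  have AT0: "A \<inter> T = {0}"
  proof -
    obtain C where C: "submod scale R C" "A \<inter> C = {0}" "\<forall>v. \<exists>t\<in>A. \<exists>c\<in>C. v = t + c"
      using comp[OF A] by auto
    have "x v \<in> C" if x: "x \<in> I" for x v
    proof -
      obtain a c where "a \<in> A" "c \<in> C" "v = a + c"
        using C(3) by blast
      then show ?thesis
        using x IR submodD(2)[OF C(1), of x c] by (auto simp: A_def lin_add[OF linI[OF x]] subset_iff)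
    qed
    then have "T \<subseteq> C"
      unfolding T_def by (intro span_minimal submodD(1)[OF C(1)]) auto
    moreover have "0 \<in> A" "0 \<in> T"
      using A T by (auto simp: submod_def subspace_0)
    ultimately show ?thesis
      using C(2) by auto
  qed
  have A0: "A = {0}"
  proof (rule ccontr)
    assume "A \<noteq> {0}"
    then obtain a where a: "a \<in> A" "a \<noteq> 0"
      using subspace_0[OF submodD(1)[OF A]] by auto
    obtain \<pi> where \<pi>: "Vector_Spaces.linear scale scale \<pi>" "\<And>v. v \<in> A \<Longrightarrow> \<pi> v = v" "\<And>v. \<pi> v \<in> A"
      "\<And>f v. Vector_Spaces.linear scale scale f \<Longrightarrow> f ` A \<subseteq> A \<Longrightarrow> f ` T \<subseteq> T \<Longrightarrow> f (\<pi> v) = \<pi> (f v)"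
      using projection_exists[OF submodD(1)[OF A] submodD(1)[OF T] AT0 AT] by blast
    \<comment> \<open>\<open>A\<close> and \<open>T\<close> are stable under \<open>R\<close> and
      also under \<open>End_R(V)\<close>, whose elements commute with \<open>I\<close>. So the
      projection lies in the commutant and commutes with all of it.\<close>
    have "\<pi> \<in> center (End_over scale R)"
    proof -
      have "\<pi> \<in> End_over scale R"
        using \<pi>(1) \<pi>(4)[OF lin] submodD(2)[OF A] submodD(2)[OF T]
        by (auto simp: End_over_def fun_eq_iff image_subset_iff)
      moreover have "f (\<pi> v) = \<pi> (f v)" if f: "f \<in> End_over scale R" for f v
      proof (rule \<pi>(4))
        show lf: "Vector_Spaces.linear scale scale f"
          using f by (auto simp: End_over_def)
        have fx: "f (x v) = x (f v)" if "x \<in> I" for x v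
          using f that IR by (auto simp: End_over_def fun_eq_iff)
        show "f ` A \<subseteq> A"
          using lin_zero[OF lf] by (auto simp: A_def simp flip: fx)
        have "T \<subseteq> {t. f t \<in> T}"
          unfolding T_def
        proof (rule span_minimal)
          show "subspace {t. f t \<in> span {x v |x v. x \<in> I}}"
            by (rule subspaceI) (auto simp: lin_zero lin_add lin_scale lf span_zero span_add span_scale)
          show "{x v |x v. x \<in> I} \<subseteq> {t. f t \<in> span {x v |x v. x \<in> I}}"
            using fx by (auto intro!: span_base)
        qed
        then show "f ` T \<subseteq> T" by auto
      qed
      ultimately show ?thesis
        by (auto simp: center_def fun_eq_iff)
    qed
    then obtain c where c: "\<pi> = scale c"
      using stable_center_scalar[OF stable_End_over[OF R]] by blast
    then have "scale c a = scale 1 a"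
      using \<pi>(2)[OF a(1)] by simp
    then have "c = 1"
      using a(2) by (simp only: scale_cancel_right) simp
    then have "v \<in> A" for v
      using \<pi>(3)[of v] c by simp
    then show False
      using x0 by (auto simp: A_def fun_eq_iff)
  qed
  \<comment> \<open>Split \<open>v = x v + c\<close> along \<open>I v\<close> and a complement
    \<open>C\<close>. Every \<open>y\<close> in \<open>I\<close> sends \<open>c\<close> to
    \<open>y v - y (x v)\<close>, an element of \<open>I v \<inter> C = {0}\<close>, so
    \<open>c\<close> is annihilated and vanishes.\<close>
  have local_unit: "\<exists>x\<in>I. x v = v" for v
  proof -
    have "submod scale R {x v |x. x \<in> I}"
    proof (rule submodI)
      show "subspace {x v |x. x \<in> I}"
      proof (rule subspaceI)
        show "0 \<in> {x v |x. x \<in> I}"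
          using zeroI by force
        show "y + y' \<in> {x v |x. x \<in> I}" if "y \<in> {x v |x. x \<in> I}" "y' \<in> {x v |x. x \<in> I}" for y y'
          using that add by force
        show "scale c y \<in> {x v |x. x \<in> I}" if "y \<in> {x v |x. x \<in> I}" for c y
          using that sc by force
      qed
      fix u w assume u: "u \<in> R" and "w \<in> {x v |x. x \<in> I}"
      then obtain x where x: "w = x v" "x \<in> I" by blast
      have "u w = (u \<circ> x) v" "u \<circ> x \<in> I"
        using left[OF u x(2)] x(1) by auto
      then show "u w \<in> {x v |x. x \<in> I}"
        by blast
    qed
    from comp[OF this] obtain C where C: "submod scale R C" "{x v |x. x \<in> I} \<inter> C = {0}"
      "\<forall>w. \<exists>y\<in>{x v |x. x \<in> I}. \<exists>c\<in>C. w = y + c"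
      by blast
    then obtain x c where x: "x \<in> I" "c \<in> C" "v = x v + c"
      by blast
    have "y c = 0" if y: "y \<in> I" for y
    proof -
      have "y c = y v - y (x v)"
        using x(3) linI[OF y] by (metis add_diff_cancel_left' lin_diff)
      moreover have "(\<lambda>v. y v - (y \<circ> x) v) \<in> I"
        using diff[OF y left[of y x]] y IR x by auto
      ultimately have "y c \<in> {x v |x. x \<in> I}"
        by force
      moreover have "y c \<in> C"
        using submodD(2)[OF C(1)] y IR x by auto
      ultimately show ?thesis
        using C(2) by blast
    qed
    then have "c = 0"
      using A0 by (auto simp: A_def)
    then have "x v = v"
      using x(3) by (metis add_0_right)
    then show ?thesis
      using x(1) by blast
  qed
  define fix_space where "fix_space x = {v. x v = (v::'b)}" for x
  have subfix: "subspace (fix_space x)" if "x \<in> I" for x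
    using linI[OF that] by (auto simp: fix_space_def lin_zero lin_add lin_scale intro!: subspaceI)
  obtain x where x: "x \<in> I" and max: "\<And>y. y \<in> I \<Longrightarrow> dim (fix_space y) \<le> dim (fix_space x)"
    using ex_has_greatest_nat[of "\<lambda>x. x \<in> I" x0 "\<lambda>x. dim (fix_space x)" "Suc (dim UNIV)"] x0(1)
      dim_subset[OF subset_UNIV] le_imp_less_Suc by (metis (no_types, lifting))
  have "x v = v" for v
  proof (rule ccontr)
    assume v: "x v \<noteq> v"
    obtain y where y: "y \<in> I" "y (v - x v) = v - x v"
      using local_unit by blast
    \<comment> \<open>Chosen so that \<open>1 - x' = (1 - y)(1 - x)\<close>: \<open>x'\<close> fixes
      all that \<open>x\<close> fixes, and also \<open>v\<close>, because \<open>y\<close> fixes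
      \<open>v - x v\<close>. This contradicts maximality of the space fixed by
      \<open>x\<close>.\<close>
    define x' where "x' = (\<lambda>w. x w + (y w - (y \<circ> x) w))"
    have x': "x' \<in> I"
      unfolding x'_def by (rule add[OF x diff[OF y(1) left[OF subsetD[OF IR y(1)] x]]])
    have eq: "fix_space x = fix_space x'"
      using max[OF x'] subfix[OF x] subfix[OF x']
      by (intro subspace_dim_equal) (auto simp: fix_space_def x'_def)
    have "v \<in> fix_space x'"
      using y(2) by (simp add: fix_space_def x'_def lin_diff[OF linI[OF y(1)]])
    then show False
      using eq v by (auto simp: fix_space_def)
  qed
  then have "x = id"
    by auto
  then show ?thesis
    using x by simp
qed

theorem stable_central_simple:
  assumes R: "stable_algebra R"
  shows "central_simple_algebra (op_alg scale R)"
proof -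
  have alg: "operator_algebra R"
    using R by (auto simp: stable_algebra_def)
  interpret r: ring "op_alg scale R" by (rule op_alg_ring[OF alg])
  have "simple_algebra (op_alg scale R)"
    unfolding simple_algebra_def
  proof (intro conjI allI impI)
    have "id \<noteq> (\<lambda>_. 0 :: 'b)"
      using nonzero_space by (auto simp: fun_eq_iff)
    then show "carrier (op_alg scale R) \<noteq> {\<zero>\<^bsub>op_alg scale R\<^esub>}"
      using operator_algebraD(2)[OF alg] by auto
    fix I assume "ideal I (op_alg scale R)"
    then interpret I: ideal I "op_alg scale R" .
    have sub: "I \<subseteq> R"
      using I.a_subset by simp
    show "I = {\<zero>\<^bsub>op_alg scale R\<^esub>} \<or> I = carrier (op_alg scale R)"
    proof (cases "\<exists>x\<in>I. x \<noteq> (\<lambda>_. 0)")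
      case True
      then obtain x where x: "x \<in> I" "x \<noteq> (\<lambda>_. 0)" by auto
      have "id \<in> I"
        using I.a_closed I.I_l_closed I.I_r_closed by (intro stable_simple[OF R sub _ _ _ x]) auto
      then show ?thesis
        using I.one_imp_carrier by simp
    next
      case False
      then have "I \<subseteq> {\<lambda>_. 0}" by blast
      moreover have "(\<lambda>_. 0) \<in> I"
        using I.zero_closed by simp
      ultimately have "I = {\<lambda>_. 0}" by blast
      then show ?thesis by simp
    qed
  qed
  moreover have "algebra_center (op_alg scale R) = center R"
    by (simp add: algebra_center_def center_def)
  moreover have "center R = {scale c |c. True}"
  proof (intro equalityI subsetI)
    fix z assume "z \<in> {scale c |c. True}"
    then obtain c where c: "z = scale c" by auto
    show "z \<in> center R"
      unfolding center_def c
      by (auto simp: operator_algebraD(9)[OF alg] lin_scale[OF operator_algebraD(1)[OF alg]])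
  qed (use stable_center_scalar[OF R] in auto)
  moreover have "{c \<odot>\<^bsub>op_alg scale R\<^esub> \<one>\<^bsub>op_alg scale R\<^esub> |c. True} = {scale c |c. True}"
    by simp
  ultimately show ?thesis
    using op_alg_F_algebra[OF alg] op_alg_finite_dim[OF alg] by (simp add: central_simple_algebra_def)
qed

end

section \<open>Brauer-trivial algebras\<close>

lemma alg_isoD:
  assumes "\<phi> \<in> alg_iso A B"
  shows "\<phi> \<in> ring_iso A B" "\<phi> \<in> Ring.ring_hom A B" "bij_betw \<phi> (carrier A) (carrier B)" "inj_on \<phi> (carrier A)"
    "x \<in> carrier A \<Longrightarrow> \<phi> x \<in> carrier B"
    "x \<in> carrier A \<Longrightarrow> y \<in> carrier A \<Longrightarrow> \<phi> (x \<otimes>\<^bsub>A\<^esub> y) = \<phi> x \<otimes>\<^bsub>B\<^esub> \<phi> y"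
    "x \<in> carrier A \<Longrightarrow> y \<in> carrier A \<Longrightarrow> \<phi> (x \<oplus>\<^bsub>A\<^esub> y) = \<phi> x \<oplus>\<^bsub>B\<^esub> \<phi> y"
    "\<phi> \<one>\<^bsub>A\<^esub> = \<one>\<^bsub>B\<^esub>"
    "x \<in> carrier A \<Longrightarrow> \<phi> (c \<odot>\<^bsub>A\<^esub> x) = c \<odot>\<^bsub>B\<^esub> \<phi> x"
proof -
  show r: "\<phi> \<in> ring_iso A B"
    using assms by (simp add: alg_iso_def)
  show b: "bij_betw \<phi> (carrier A) (carrier B)"
    using r by (simp add: ring_iso_def)
  then show "inj_on \<phi> (carrier A)"
    by (simp add: bij_betw_def)
  show h: "\<phi> \<in> Ring.ring_hom A B"
    using r by (simp add: ring_iso_def)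
  show "x \<in> carrier A \<Longrightarrow> \<phi> x \<in> carrier B"
    "x \<in> carrier A \<Longrightarrow> y \<in> carrier A \<Longrightarrow> \<phi> (x \<otimes>\<^bsub>A\<^esub> y) = \<phi> x \<otimes>\<^bsub>B\<^esub> \<phi> y"
    "x \<in> carrier A \<Longrightarrow> y \<in> carrier A \<Longrightarrow> \<phi> (x \<oplus>\<^bsub>A\<^esub> y) = \<phi> x \<oplus>\<^bsub>B\<^esub> \<phi> y"
    "\<phi> \<one>\<^bsub>A\<^esub> = \<one>\<^bsub>B\<^esub>"
    using ring_hom_memE[OF h] by auto
  show "x \<in> carrier A \<Longrightarrow> \<phi> (c \<odot>\<^bsub>A\<^esub> x) = c \<odot>\<^bsub>B\<^esub> \<phi> x"
    using assms by (simp add: alg_iso_def)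
qed

lemma F_algebraD:
  assumes "F_algebra A"
  shows "ring A" "Module.module class_ring A" "x \<in> carrier A \<Longrightarrow> c \<odot>\<^bsub>A\<^esub> x \<in> carrier A"
    "x \<in> carrier A \<Longrightarrow> y \<in> carrier A \<Longrightarrow> (c \<odot>\<^bsub>A\<^esub> x) \<otimes>\<^bsub>A\<^esub> y = c \<odot>\<^bsub>A\<^esub> (x \<otimes>\<^bsub>A\<^esub> y)"
    "x \<in> carrier A \<Longrightarrow> y \<in> carrier A \<Longrightarrow> x \<otimes>\<^bsub>A\<^esub> (c \<odot>\<^bsub>A\<^esub> y) = c \<odot>\<^bsub>A\<^esub> (x \<otimes>\<^bsub>A\<^esub> y)"
    "c \<odot>\<^bsub>A\<^esub> \<zero>\<^bsub>A\<^esub> = \<zero>\<^bsub>A\<^esub>"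
proof -
  show m: "Module.module class_ring A"
    using assms by (simp add: F_algebra_def)
  then interpret Module.module class_ring A .
  show "ring A"
    "x \<in> carrier A \<Longrightarrow> y \<in> carrier A \<Longrightarrow> (c \<odot>\<^bsub>A\<^esub> x) \<otimes>\<^bsub>A\<^esub> y = c \<odot>\<^bsub>A\<^esub> (x \<otimes>\<^bsub>A\<^esub> y)"
    "x \<in> carrier A \<Longrightarrow> y \<in> carrier A \<Longrightarrow> x \<otimes>\<^bsub>A\<^esub> (c \<odot>\<^bsub>A\<^esub> y) = c \<odot>\<^bsub>A\<^esub> (x \<otimes>\<^bsub>A\<^esub> y)"
    using assms by (auto simp: F_algebra_def)
  show "x \<in> carrier A \<Longrightarrow> c \<odot>\<^bsub>A\<^esub> x \<in> carrier A"
    using smult_closed[of c x] by (simp add: class_ring_simps)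
  show "c \<odot>\<^bsub>A\<^esub> \<zero>\<^bsub>A\<^esub> = \<zero>\<^bsub>A\<^esub>"
    using smult_r_null[of c] by (simp add: class_ring_simps)
qed

text \<open>\<open>brauer_trivial\<close> quantifies over algebras on
  \<open>nat \<Rightarrow> 'f\<close>; this copies an algebra of operators onto that type.\<close>

definition transport_algebra :: "('a \<Rightarrow> 'c) \<Rightarrow> ('f::field, 'a) module \<Rightarrow> ('f, 'c) module" where
  "transport_algebra k A = (let j = inv_into (carrier A) k in
     \<lparr>carrier = k ` carrier A, mult = (\<lambda>x y. k (j x \<otimes>\<^bsub>A\<^esub> j y)), one = k \<one>\<^bsub>A\<^esub>, zero = k \<zero>\<^bsub>A\<^esub>,
      add = (\<lambda>x y. k (j x \<oplus>\<^bsub>A\<^esub> j y)), smult = (\<lambda>c x. k (c \<odot>\<^bsub>A\<^esub> j x))\<rparr>)"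

lemma transport_algebra_iso:
  assumes "inj_on k (carrier A)" "F_algebra A"
  shows "k \<in> alg_iso A (transport_algebra k A)" "k \<zero>\<^bsub>A\<^esub> = \<zero>\<^bsub>transport_algebra k A\<^esub>"
  using assms(1) F_algebraD[OF assms(2)]
  by (auto simp: alg_iso_def ring_iso_def Ring.ring_hom_def transport_algebra_def Let_def bij_betw_def)

text \<open>The zero is matched by a separate assumption: \<open>ring_iso\<close> does not mention
  it, and it cannot be deduced before \<open>B\<close> is known to be a ring.\<close>

lemma alg_iso_central_simple:
  fixes A :: "('f::field, 'a) module" and B :: "('f, 'b) module"
  assumes A: "central_simple_algebra A" and k: "k \<in> alg_iso A B" "k \<zero>\<^bsub>A\<^esub> = \<zero>\<^bsub>B\<^esub>"
  shows "central_simple_algebra B"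
proof -
  note kD = alg_isoD[OF k(1)]
  have FA: "F_algebra A" and fin: "finite_dim_algebra A" and simple: "simple_algebra A"
    and center: "algebra_center A = {c \<odot>\<^bsub>A\<^esub> \<one>\<^bsub>A\<^esub> | c. True}"
    using A by (auto simp: central_simple_algebra_def)
  interpret A: ring A by (rule F_algebraD[OF FA])
  interpret mA: Module.module class_ring A by (rule F_algebraD[OF FA])
  have "ring B"
    using A.ring_iso_imp_img_ring[OF kD(1)] k(2) by simp
  then interpret B: ring B .
  interpret k: ring_hom_ring A B k
    by unfold_locales (rule kD(2))
  have surj: "carrier B = k ` carrier A"
    using kD(3) by (simp add: bij_betw_def)
  have "Module.module class_ring B"
  proof (rule module.intro)
    show "cring (class_ring :: 'f ring)"
      by (rule class_cring.cring_axioms)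
    show "abelian_group B" ..
    show "module_axioms class_ring B"
      using mA.smult_closed mA.smult_l_distr mA.smult_r_distr mA.smult_assoc1 mA.smult_one
      by unfold_locales
        (auto simp: surj class_ring_simps simp flip: kD(7,9))
  qed
  then have FB: "F_algebra B"
    using B.ring_axioms F_algebraD(3,4,5)[OF FA] by (auto simp: F_algebra_def surj simp flip: kD(6,9))
  have "finite_dim_algebra B"
  proof -
    obtain S where S: "finite S" "S \<subseteq> carrier A"
      "\<forall>x\<in>carrier A. \<exists>c :: 'a \<Rightarrow> 'f. x = (\<Oplus>\<^bsub>A\<^esub>b\<in>S. c b \<odot>\<^bsub>A\<^esub> b)"
      using fin by (auto simp: finite_dim_algebra_def)
    have inj: "inj_on k S"
      using kD(4) S(2) by (rule inj_on_subset)
    have "\<exists>c. y = (\<Oplus>\<^bsub>B\<^esub>b\<in>k ` S. c b \<odot>\<^bsub>B\<^esub> b)" if y: "y \<in> carrier B" for y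
    proof -
      obtain x where x: "x \<in> carrier A" "y = k x"
        using y surj by auto
      obtain c where c: "x = (\<Oplus>\<^bsub>A\<^esub>b\<in>S. c b \<odot>\<^bsub>A\<^esub> b)"
        using S(3) x(1) by blast
      have "y = (\<Oplus>\<^bsub>B\<^esub>b\<in>S. (k \<circ> (\<lambda>b. c b \<odot>\<^bsub>A\<^esub> b)) b)"
        unfolding x(2) c using S(2) F_algebraD(3)[OF FA] by (subst k.hom_finsum) auto
      also have "\<dots> = (\<Oplus>\<^bsub>B\<^esub>b\<in>S. c (inv_into S k (k b)) \<odot>\<^bsub>B\<^esub> k b)"
        using S(2) inj kD(5,9) F_algebraD(3)[OF FB] by (intro B.finsum_cong') (auto simp: subset_iff)
      also have "\<dots> = (\<Oplus>\<^bsub>B\<^esub>b\<in>k ` S. c (inv_into S k b) \<odot>\<^bsub>B\<^esub> b)"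
        using S(2) inj kD(5) F_algebraD(3)[OF FB]
        by (subst B.add.finprod_reindex) (auto simp: subset_iff)
      finally show ?thesis by (intro exI[of _ "\<lambda>b. c (inv_into S k b)"])
    qed
    then show ?thesis
      unfolding finite_dim_algebra_def using S(1,2) surj by (intro exI[of _ "k ` S"]) auto
  qed
  moreover have "simple_algebra B"
    unfolding simple_algebra_def
  proof (intro conjI allI impI)
    have "carrier A \<noteq> {\<zero>\<^bsub>A\<^esub>}"
      using simple by (simp add: simple_algebra_def)
    then obtain x where x: "x \<in> carrier A" "x \<noteq> \<zero>\<^bsub>A\<^esub>"
      using A.zero_closed by blast
    then have "k x \<in> carrier B" "k x \<noteq> \<zero>\<^bsub>B\<^esub>"
      using kD(5)[OF x(1)] inj_onD[OF kD(4) _ x(1) A.zero_closed] x(2) k(2) by (simp, metis)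
    then show "carrier B \<noteq> {\<zero>\<^bsub>B\<^esub>}"
      by auto
    fix I assume I: "ideal I B"
    interpret I: ideal I B by fact
    have "ideal {r \<in> carrier A. k r \<in> I} A"
      by (rule k.ideal_vimage[OF I])
    then consider "{r \<in> carrier A. k r \<in> I} = {\<zero>\<^bsub>A\<^esub>}" | "{r \<in> carrier A. k r \<in> I} = carrier A"
      using simple by (auto simp: simple_algebra_def)
    then show "I = {\<zero>\<^bsub>B\<^esub>} \<or> I = carrier B"
    proof cases
      case 1
      have "I \<subseteq> {\<zero>\<^bsub>B\<^esub>}"
      proof
        fix y assume "y \<in> I"
        then obtain x where "x \<in> carrier A" "y = k x"
          using I.a_subset surj by blast
        then have "x \<in> {r \<in> carrier A. k r \<in> I}"
          using \<open>y \<in> I\<close> by auto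
        then show "y \<in> {\<zero>\<^bsub>B\<^esub>}"
          using 1 k(2) \<open>y = k x\<close> by auto
      qed
      then show ?thesis
        using I.zero_closed by auto
    next
      case 2
      then have "carrier B \<subseteq> I"
        unfolding surj by auto
      then show ?thesis
        using I.a_subset by auto
    qed
  qed
  moreover have "algebra_center B = {c \<odot>\<^bsub>B\<^esub> \<one>\<^bsub>B\<^esub> | c. True}"
  proof -
    have "algebra_center B = k ` algebra_center A"
    proof (intro equalityI subsetI)
      fix y assume y: "y \<in> algebra_center B"
      then obtain x where x: "x \<in> carrier A" "y = k x"
        using surj by (auto simp: algebra_center_def)
      have "x \<otimes>\<^bsub>A\<^esub> z = z \<otimes>\<^bsub>A\<^esub> x" if z: "z \<in> carrier A" for z
      proof (rule inj_onD[OF kD(4)])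
        have "k x \<otimes>\<^bsub>B\<^esub> k z = k z \<otimes>\<^bsub>B\<^esub> k x"
          using y z x kD(5) by (auto simp: algebra_center_def)
        then show "k (x \<otimes>\<^bsub>A\<^esub> z) = k (z \<otimes>\<^bsub>A\<^esub> x)"
          using x z by (simp add: kD(6))
      qed (use x z in auto)
      then show "y \<in> k ` algebra_center A"
        using x by (auto simp: algebra_center_def)
    next
      fix y assume "y \<in> k ` algebra_center A"
      then obtain x where x: "x \<in> carrier A" "y = k x" "\<And>z. z \<in> carrier A \<Longrightarrow> x \<otimes>\<^bsub>A\<^esub> z = z \<otimes>\<^bsub>A\<^esub> x"
        by (auto simp: algebra_center_def)
      have "y \<otimes>\<^bsub>B\<^esub> w = w \<otimes>\<^bsub>B\<^esub> y" if w: "w \<in> carrier B" for w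
      proof -
        obtain z where "z \<in> carrier A" "w = k z"
          using w surj by auto
        then show ?thesis
          using x(1,2) x(3)[of z] kD(6)[of x z] kD(6)[of z x] by simp
      qed
      then show "y \<in> algebra_center B"
        using x(1,2) kD(5) by (auto simp: algebra_center_def)
    qed
    also have "\<dots> = {c \<odot>\<^bsub>B\<^esub> \<one>\<^bsub>B\<^esub> | c. True}"
      unfolding center using kD(8) kD(9)[OF A.one_closed] by (auto simp: image_iff) metis
    finally show ?thesis .
  qed
  ultimately show ?thesis
    using FB by (simp add: central_simple_algebra_def)
qed

section \<open>Matrix algebras over the field and rank-one idempotents\<close>

lemma matrix_algebra_simps:
  "carrier (matrix_algebra n A) = {..<n} \<times> {..<n} \<rightarrow>\<^sub>E carrier A"
  "mult (matrix_algebra n A) =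
    (\<lambda>X Y. restrict (\<lambda>(i, j). \<Oplus>\<^bsub>A\<^esub>k\<in>{..<n}. X (i, k) \<otimes>\<^bsub>A\<^esub> Y (k, j)) ({..<n} \<times> {..<n}))"
  "smult (matrix_algebra n A) = (\<lambda>c X. restrict (\<lambda>p. c \<odot>\<^bsub>A\<^esub> X p) ({..<n} \<times> {..<n}))"
  by (simp_all add: matrix_algebra_def Let_def)

lemma base_algebra_simps:
  "carrier base_algebra = UNIV" "mult base_algebra = (*)" "zero base_algebra = 0"
  "add base_algebra = (+)" "smult base_algebra = (*)"
  by (simp_all add: base_algebra_def)

lemma base_algebra_finsum:
  fixes f :: "'k \<Rightarrow> 'f::field"
  assumes "finite A"
  shows "(\<Oplus>\<^bsub>base_algebra\<^esub>k\<in>A. f k) = sum f A"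
proof -
  have "comm_monoid (add_monoid (base_algebra :: ('f, 'f) module))"
    by (auto intro!: comm_monoidI simp: base_algebra_simps algebra_simps)
  then interpret abelian_monoid "base_algebra :: ('f, 'f) module"
    by (simp add: abelian_monoid_def)
  show ?thesis
    using assms by (induction A rule: finite_induct) (auto simp: base_algebra_simps)
qed

lemma matrix_algebra_base_mult:
  "mat n n (X \<otimes>\<^bsub>matrix_algebra n base_algebra\<^esub> Y) = mat n n X * mat n n (Y :: nat \<times> nat \<Rightarrow> 'f::field)"
  by (rule eq_matI)
    (auto simp: matrix_algebra_simps base_algebra_finsum base_algebra_simps scalar_prod_def atLeast0LessThan)

lemma matrix_algebra_base_smult:
  "mat n n (c \<odot>\<^bsub>matrix_algebra n base_algebra\<^esub> X) = c \<cdot>\<^sub>m mat n n (X :: nat \<times> nat \<Rightarrow> 'f::field)"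
  by (rule eq_matI) (auto simp: matrix_algebra_simps base_algebra_simps)

lemma matrix_algebra_base_bij:
  "bij_betw (mat n n) (carrier (matrix_algebra n base_algebra)) (carrier_mat n n :: 'f::field mat set)"
proof (rule bij_betwI[where g = "\<lambda>M. restrict (\<lambda>p. M $$ p) ({..<n} \<times> {..<n})"])
  show "mat n n \<in> carrier (matrix_algebra n base_algebra) \<rightarrow> (carrier_mat n n :: 'f mat set)"
    by auto
  show "(\<lambda>M. restrict (\<lambda>p. M $$ p) ({..<n} \<times> {..<n})) \<in> (carrier_mat n n :: 'f mat set) \<rightarrow> carrier (matrix_algebra n base_algebra)"
    by (auto simp: matrix_algebra_simps base_algebra_simps)
  show "restrict (\<lambda>p. mat n n X $$ p) ({..<n} \<times> {..<n}) = X"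
    if "X \<in> carrier (matrix_algebra n (base_algebra :: ('f, 'f) module))" for X
  proof -
    have "restrict (\<lambda>p. mat n n X $$ p) ({..<n} \<times> {..<n}) = restrict X ({..<n} \<times> {..<n})"
      by (rule restrict_ext) auto
    also have "\<dots> = X"
      using that by (simp add: matrix_algebra_simps PiE_restrict)
    finally show ?thesis .
  qed
  show "mat n n (restrict (\<lambda>p. M $$ p) ({..<n} \<times> {..<n})) = M" if "M \<in> carrier_mat n n" for M :: "'f mat"
    using that by (intro eq_matI) auto
qed

lemma smult_smult_mat: "c \<cdot>\<^sub>m (d \<cdot>\<^sub>m M) = (c * d :: 'f::field) \<cdot>\<^sub>m M"
  by (rule eq_matI) auto

lemma one_smult_mat: "(1 :: 'f::field) \<cdot>\<^sub>m M = M"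
  by (rule eq_matI) auto

lemma zero_smult_mat: "M \<in> carrier_mat n n \<Longrightarrow> (0 :: 'f::field) \<cdot>\<^sub>m M = 0\<^sub>m n n"
  by (rule eq_matI) auto

text \<open>\<open>E\<close> is the matrix unit with its 1 in position \<open>(j, i)\<close>; the
  transposed position makes the product read off the entry \<open>(i, j)\<close>.\<close>

lemma unit_mat_sandwich:
  fixes s :: "'f::field mat"
  assumes s: "s \<in> carrier_mat n n" and ij: "i < n" "j < n"
  defines "E \<equiv> mat n n (\<lambda>(k, l). if k = j \<and> l = i then 1 else 0)"
  shows "E * s * E = s $$ (i, j) \<cdot>\<^sub>m E"
proof (rule eq_matI)
  have E: "E \<in> carrier_mat n n" by (simp add: E_def)
  have Es: "(E * s) $$ (k, l) = (if k = j then s $$ (i, l) else 0)" if "k < n" "l < n" for k l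
  proof -
    have "(E * s) $$ (k, l) = (\<Sum>q<n. (if k = j \<and> q = i then 1 else 0) * s $$ (q, l))"
      using that s by (simp add: E_def scalar_prod_def atLeast0LessThan)
    also have "\<dots> = (\<Sum>q<n. if q = i then (if k = j then s $$ (i, l) else 0) else 0)"
      by (intro sum.cong) auto
    finally show ?thesis
      using ij by simp
  qed
  fix k l assume "k < dim_row (s $$ (i, j) \<cdot>\<^sub>m E)" "l < dim_col (s $$ (i, j) \<cdot>\<^sub>m E)"
  then have kl: "k < n" "l < n"
    using E by auto
  have Eij: "E $$ (q, l) = (if q = j \<and> l = i then 1 else 0)" if "q < n" "l < n" for q l
    using that by (simp add: E_def)
  define M where "M = E * s"
  have M: "M \<in> carrier_mat n n"
    using E s by (simp add: M_def)
  have "(M * E) $$ (k, l) = (\<Sum>q<n. M $$ (k, q) * E $$ (q, l))"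
    using kl M E by (simp add: scalar_prod_def atLeast0LessThan)
  also have "\<dots> = (\<Sum>q<n. if q = j then (if k = j \<and> l = i then s $$ (i, j) else 0) else 0)"
    using kl by (intro sum.cong) (auto simp: M_def Es Eij)
  also have "\<dots> = (s $$ (i, j) \<cdot>\<^sub>m E) $$ (k, l)"
    using kl ij by (simp add: E_def)
  finally show "(E * s * E) $$ (k, l) = (s $$ (i, j) \<cdot>\<^sub>m E) $$ (k, l)"
    unfolding M_def .
qed (auto simp: E_def)

text \<open>The witness is \<open>x = f E\<^sub>j\<^sub>i f / f\<^sub>i\<^sub>j\<close>, where \<open>f\<^sub>i\<^sub>j \<noteq> 0\<close>.\<close>

lemma rank_one_idempotent_below:
  fixes f :: "'f::field mat"
  assumes f: "f \<in> carrier_mat n n" "f * f = f" "f \<noteq> 0\<^sub>m n n"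
  obtains x where "x \<in> carrier_mat n n" "x \<noteq> 0\<^sub>m n n" "x * x = x" "f * x * f = x"
    "\<And>s. s \<in> carrier_mat n n \<Longrightarrow> \<exists>c. x * s * x = c \<cdot>\<^sub>m x"
proof -
  obtain i j where ij: "i < n" "j < n" "f $$ (i, j) \<noteq> 0"
    using f(1,3) by (metis (no_types, lifting) carrier_matD eq_matI index_zero_mat zero_carrier_mat)
  define E :: "'f mat" where "E = mat n n (\<lambda>(k, l). if k = j \<and> l = i then 1 else 0)"
  have E: "E \<in> carrier_mat n n" by (simp add: E_def)
  define w where "w = f * E * f"
  have w: "w \<in> carrier_mat n n"
    using f E by (simp add: w_def)
  have fw: "f * w = w"
    unfolding w_def using f E
    by (metis (no_types, lifting) assoc_mult_mat mult_carrier_mat)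
  have wf: "w * f = w"
    unfolding w_def using f E
    by (metis (no_types, lifting) assoc_mult_mat mult_carrier_mat)
  \<comment> \<open>Regrouped as \<open>f (E (f s f) E) f\<close>, the inner sandwich is a scalar
    multiple of \<open>E\<close>.\<close>
  have wsw: "w * s * w = (f * s * f) $$ (i, j) \<cdot>\<^sub>m w" if s: "s \<in> carrier_mat n n" for s
  proof -
    have "w * s * w = f * (E * (f * s * f) * E) * f"
      unfolding w_def using f(1) E s by (simp add: assoc_mult_mat[of _ n n _ n _ n])
    also have "\<dots> = f * ((f * s * f) $$ (i, j) \<cdot>\<^sub>m E) * f"
      using unit_mat_sandwich[of "f * s * f" n i j] f s ij by (simp add: E_def)
    also have "\<dots> = (f * s * f) $$ (i, j) \<cdot>\<^sub>m w"
      unfolding w_def using f E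
      by (simp add: mult_smult_distrib[of _ n n _ n] mult_smult_assoc_mat[of _ n n _ n])
    finally show ?thesis .
  qed
  have ww: "w * w = f $$ (i, j) \<cdot>\<^sub>m w"
    using wsw[of "1\<^sub>m n"] f w by simp
  define x where "x = inverse (f $$ (i, j)) \<cdot>\<^sub>m w"
  have x: "x \<in> carrier_mat n n"
    using w by (simp add: x_def)
  show thesis
  proof (rule that[OF x])
    show "x * x = x"
      unfolding x_def using w ij ww
      by (simp add: mult_smult_distrib[of _ n n _ n] mult_smult_assoc_mat[of _ n n _ n] smult_smult_mat one_smult_mat)
    show "f * x * f = x"
      unfolding x_def using w f fw wf
      by (simp add: mult_smult_distrib[of _ n n _ n] mult_smult_assoc_mat[of _ n n _ n])
    show "\<exists>c. x * s * x = c \<cdot>\<^sub>m x" if s: "s \<in> carrier_mat n n" for s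
    proof
      show "x * s * x = (inverse (f $$ (i, j)) * (f * s * f) $$ (i, j)) \<cdot>\<^sub>m x"
        unfolding x_def using w s wsw[OF s]
        by (simp add: mult_smult_distrib[of _ n n _ n] mult_smult_assoc_mat[of _ n n _ n] smult_smult_mat mult_ac)
    qed
    \<comment> \<open>This shows that \<open>w\<close> is nonzero: the product is \<open>E\<close>
      times the square of the nonzero entry of \<open>f\<close>.\<close>
    have "E * w * E = (E * f * E) * (f * E)"
      unfolding w_def using f(1) E by (simp add: assoc_mult_mat[of _ n n _ n _ n])
    also have "\<dots> = f $$ (i, j) \<cdot>\<^sub>m (E * f * E)"
      using unit_mat_sandwich[OF f(1) ij(1,2)] f E
      by (simp add: E_def[symmetric] mult_smult_assoc_mat[of _ n n _ n] assoc_mult_mat[of _ n n _ n _ n])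
    also have "\<dots> = (f $$ (i, j) * f $$ (i, j)) \<cdot>\<^sub>m E"
      using unit_mat_sandwich[OF f(1) ij(1,2)] by (simp add: E_def[symmetric] smult_smult_mat)
    finally have EwE: "E * w * E = (f $$ (i, j) * f $$ (i, j)) \<cdot>\<^sub>m E" .
    have "w \<noteq> 0\<^sub>m n n"
    proof
      assume "w = 0\<^sub>m n n"
      then have "E * w * E = 0\<^sub>m n n"
        using E by simp
      then have "((f $$ (i, j) * f $$ (i, j)) \<cdot>\<^sub>m E) $$ (j, i) = 0"
        unfolding EwE using ij by simp
      then show False
        using ij by (simp add: E_def)
    qed
    moreover have "w = f $$ (i, j) \<cdot>\<^sub>m x"
      unfolding x_def using ij w by (simp add: smult_smult_mat one_smult_mat)
    ultimately show "x \<noteq> 0\<^sub>m n n"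
      by auto
  qed
qed

text \<open>A multiplicative embedding of \<open>A\<close> into its matrix algebra that sends the
  unit to an idempotent, and so identifies \<open>A\<close> with the corner cut out by that
  idempotent.\<close>

definition corner :: "nat \<Rightarrow> ('f::field, 'a) module \<Rightarrow> 'a \<Rightarrow> nat \<times> nat \<Rightarrow> 'a" where
  "corner m A r = restrict (\<lambda>(i, j). if i = 0 \<and> j = 0 then r else \<zero>\<^bsub>A\<^esub>) ({..<m} \<times> {..<m})"

lemma corner_mult_left:
  assumes "ring A" and r: "r \<in> carrier A" and X: "X \<in> carrier (matrix_algebra m A)"
  shows "corner m A r \<otimes>\<^bsub>matrix_algebra m A\<^esub> X =
    restrict (\<lambda>(i, j). if i = 0 then r \<otimes>\<^bsub>A\<^esub> X (0, j) else \<zero>\<^bsub>A\<^esub>) ({..<m} \<times> {..<m})"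
proof -
  interpret ring A by fact
  have XA: "X (i, j) \<in> carrier A" if "i < m" "j < m" for i j
    using X that by (auto simp: matrix_algebra_simps)
  have "(\<Oplus>\<^bsub>A\<^esub>k\<in>{..<m}. corner m A r (i, k) \<otimes>\<^bsub>A\<^esub> X (k, j)) =
      (if i = 0 then r \<otimes>\<^bsub>A\<^esub> X (0, j) else \<zero>\<^bsub>A\<^esub>)" if ij: "i < m" "j < m" for i j
  proof -
    have "(\<Oplus>\<^bsub>A\<^esub>k\<in>{..<m}. corner m A r (i, k) \<otimes>\<^bsub>A\<^esub> X (k, j)) =
      (\<Oplus>\<^bsub>A\<^esub>k\<in>{..<m}. if 0 = k then (if i = 0 then r \<otimes>\<^bsub>A\<^esub> X (k, j) else \<zero>\<^bsub>A\<^esub>) else \<zero>\<^bsub>A\<^esub>)"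
      using ij XA r by (intro finsum_cong') (auto simp: corner_def)
    also have "\<dots> = (if i = 0 then r \<otimes>\<^bsub>A\<^esub> X (0, j) else \<zero>\<^bsub>A\<^esub>)"
      using ij XA r by (subst finsum_singleton) auto
    finally show ?thesis .
  qed
  then show ?thesis
    by (auto simp: matrix_algebra_simps intro!: restrict_ext)
qed

lemma corner_mult_right:
  assumes "ring A" and r: "r \<in> carrier A" and X: "X \<in> carrier (matrix_algebra m A)"
  shows "X \<otimes>\<^bsub>matrix_algebra m A\<^esub> corner m A r =
    restrict (\<lambda>(i, j). if j = 0 then X (i, 0) \<otimes>\<^bsub>A\<^esub> r else \<zero>\<^bsub>A\<^esub>) ({..<m} \<times> {..<m})"
proof -
  interpret ring A by fact
  have XA: "X (i, j) \<in> carrier A" if "i < m" "j < m" for i j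
    using X that by (auto simp: matrix_algebra_simps)
  have "(\<Oplus>\<^bsub>A\<^esub>k\<in>{..<m}. X (i, k) \<otimes>\<^bsub>A\<^esub> corner m A r (k, j)) =
      (if j = 0 then X (i, 0) \<otimes>\<^bsub>A\<^esub> r else \<zero>\<^bsub>A\<^esub>)" if ij: "i < m" "j < m" for i j
  proof -
    have "(\<Oplus>\<^bsub>A\<^esub>k\<in>{..<m}. X (i, k) \<otimes>\<^bsub>A\<^esub> corner m A r (k, j)) =
      (\<Oplus>\<^bsub>A\<^esub>k\<in>{..<m}. if 0 = k then (if j = 0 then X (i, k) \<otimes>\<^bsub>A\<^esub> r else \<zero>\<^bsub>A\<^esub>) else \<zero>\<^bsub>A\<^esub>)"
      using ij XA r by (intro finsum_cong') (auto simp: corner_def)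
    also have "\<dots> = (if j = 0 then X (i, 0) \<otimes>\<^bsub>A\<^esub> r else \<zero>\<^bsub>A\<^esub>)"
      using ij XA r by (subst finsum_singleton) auto
    finally show ?thesis .
  qed
  then show ?thesis
    by (auto simp: matrix_algebra_simps intro!: restrict_ext)
qed

lemma corner_closed: "ring A \<Longrightarrow> r \<in> carrier A \<Longrightarrow> corner m A r \<in> carrier (matrix_algebra m A)"
  using ring.ring_simprules(2)[of A] by (auto simp: corner_def matrix_algebra_simps)

lemma corner_mult:
  assumes A: "ring A" and rs: "r \<in> carrier A" "s \<in> carrier A"
  shows "corner m A r \<otimes>\<^bsub>matrix_algebra m A\<^esub> corner m A s = corner m A (r \<otimes>\<^bsub>A\<^esub> s)"
  unfolding corner_mult_left[OF A rs(1) corner_closed[OF A rs(2)]]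
  using rs ring.ring_simprules[OF A] by (auto simp: corner_def intro!: restrict_ext)

text \<open>If \<open>A\<close> is Brauer trivial, then \<open>A\<close> is a corner of a matrix algebra over the field.\<close>

lemma brauer_trivial_rank_one_idempotent:
  fixes A :: "('f::field, 'a) module"
  assumes A: "F_algebra A" and br: "brauer_equivalent A (base_algebra :: ('f, 'f) module)"
    and nontriv: "\<one>\<^bsub>A\<^esub> \<noteq> \<zero>\<^bsub>A\<^esub>"
  obtains e where "e \<in> carrier A" "e \<noteq> \<zero>\<^bsub>A\<^esub>" "e \<otimes>\<^bsub>A\<^esub> e = e"
    "\<And>x. x \<in> carrier A \<Longrightarrow> \<exists>c. e \<otimes>\<^bsub>A\<^esub> x \<otimes>\<^bsub>A\<^esub> e = c \<odot>\<^bsub>A\<^esub> e"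
proof -
  interpret ring A by (rule F_algebraD[OF A])
  obtain m n \<psi> where mn: "m > 0" "n > 0"
    and \<psi>: "\<psi> \<in> alg_iso (matrix_algebra m A) (matrix_algebra n (base_algebra :: ('f, 'f) module))"
    using br by (auto simp: brauer_equivalent_def)
  let ?M = "matrix_algebra m A"
  define \<theta> where "\<theta> X = mat n n (\<psi> X)" for X
  have bij: "bij_betw \<theta> (carrier ?M) (carrier_mat n n)"
    using bij_betw_trans[OF alg_isoD(3)[OF \<psi>] matrix_algebra_base_bij] by (simp add: \<theta>_def[abs_def] comp_def)
  have \<theta>_mult: "\<theta> (X \<otimes>\<^bsub>?M\<^esub> Y) = \<theta> X * \<theta> Y" if "X \<in> carrier ?M" "Y \<in> carrier ?M" for X Y
    using that by (simp add: \<theta>_def alg_isoD(6)[OF \<psi>] matrix_algebra_base_mult)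
  have \<theta>_smult: "\<theta> (c \<odot>\<^bsub>?M\<^esub> X) = c \<cdot>\<^sub>m \<theta> X" if "X \<in> carrier ?M" for c X
    using that by (simp add: \<theta>_def alg_isoD(9)[OF \<psi>] matrix_algebra_base_smult)
  have \<theta>_inj: "X = Y" if "\<theta> X = \<theta> Y" "X \<in> carrier ?M" "Y \<in> carrier ?M" for X Y
    using bij that by (auto simp: bij_betw_def inj_on_def)
  have \<theta>_closed: "\<theta> X \<in> carrier_mat n n" for X
    by (simp add: \<theta>_def)
  let ?\<iota> = "corner m A"
  note \<iota> = corner_closed[OF ring_axioms]
  have \<iota>_inj: "r = s" if "?\<iota> r = ?\<iota> s" for r s
    using fun_cong[OF that, of "(0, 0)"] mn by (simp add: corner_def)
  have \<iota>_mult: "?\<iota> r \<otimes>\<^bsub>?M\<^esub> ?\<iota> s = ?\<iota> (r \<otimes>\<^bsub>A\<^esub> s)" if "r \<in> carrier A" "s \<in> carrier A" for r s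
    by (rule corner_mult[OF ring_axioms that])
  have \<iota>_smult: "c \<odot>\<^bsub>?M\<^esub> ?\<iota> r = ?\<iota> (c \<odot>\<^bsub>A\<^esub> r)" for c r
    using F_algebraD(6)[OF A, of c] by (auto simp: corner_def matrix_algebra_simps intro!: restrict_ext)
  have smult0: "0 \<odot>\<^bsub>A\<^esub> r = \<zero>\<^bsub>A\<^esub>" if "r \<in> carrier A" for r
    using module.smult_l_null[OF F_algebraD(2)[OF A] that] by (simp add: class_ring_simps)
  \<comment> \<open>Zero is reached as a multiple by the scalar 0, since the isomorphism is only
    known to respect sums, products, units and scalars.\<close>
  have \<theta>0: "\<theta> (?\<iota> \<zero>\<^bsub>A\<^esub>) = 0\<^sub>m n n"
  proof -
    have "\<theta> (0 \<odot>\<^bsub>?M\<^esub> ?\<iota> \<zero>\<^bsub>A\<^esub>) = 0 \<cdot>\<^sub>m \<theta> (?\<iota> \<zero>\<^bsub>A\<^esub>)"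
      by (rule \<theta>_smult[OF \<iota>]) simp
    then show ?thesis
      using \<theta>_closed[of "?\<iota> \<zero>\<^bsub>A\<^esub>"] by (simp add: \<iota>_smult smult0 zero_smult_mat)
  qed
  have \<theta>\<iota>_inj: "r = s" if "\<theta> (?\<iota> r) = \<theta> (?\<iota> s)" "r \<in> carrier A" "s \<in> carrier A" for r s
    using \<theta>_inj[OF that(1) \<iota> \<iota>] that \<iota>_inj by blast
  define f where "f = \<theta> (?\<iota> \<one>\<^bsub>A\<^esub>)"
  have "f * f = f"
    unfolding f_def using \<theta>_mult[OF \<iota> \<iota>, of "\<one>\<^bsub>A\<^esub>" "\<one>\<^bsub>A\<^esub>"] \<iota>_mult[of "\<one>\<^bsub>A\<^esub>" "\<one>\<^bsub>A\<^esub>"] by simp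
  moreover have "f \<noteq> 0\<^sub>m n n"
    using \<theta>\<iota>_inj[of "\<one>\<^bsub>A\<^esub>" "\<zero>\<^bsub>A\<^esub>"] nontriv \<theta>0 by (auto simp: f_def)
  ultimately obtain x where x: "x \<in> carrier_mat n n" "x \<noteq> 0\<^sub>m n n" "x * x = x" "f * x * f = x"
    and xsx: "\<And>s. s \<in> carrier_mat n n \<Longrightarrow> \<exists>c. x * s * x = c \<cdot>\<^sub>m x"
    using rank_one_idempotent_below[of f n] \<theta>_closed f_def by metis
  have "x \<in> \<theta> ` carrier ?M"
    using x(1) bij_betw_imp_surj_on[OF bij] by simp
  then obtain X where X: "X \<in> carrier ?M" "\<theta> X = x"
    by (elim imageE) (rule that, auto)
  define e where "e = X (0, 0)"
  have XA: "X (i, j) \<in> carrier A" if "i < m" "j < m" for i j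
    using X(1) that by (auto simp: matrix_algebra_simps)
  then have e: "e \<in> carrier A"
    using mn by (simp add: e_def)
  have 1: "?\<iota> \<one>\<^bsub>A\<^esub> \<otimes>\<^bsub>?M\<^esub> X \<in> carrier ?M"
    unfolding corner_mult_left[OF ring_axioms one_closed X(1)] using XA mn by (auto simp: matrix_algebra_simps)
  \<comment> \<open>As \<open>x = f x f\<close>, the preimage of \<open>x\<close> is concentrated in
    its \<open>(0, 0)\<close> entry. That entry is the idempotent of \<open>A\<close>.\<close>
  have corner: "?\<iota> \<one>\<^bsub>A\<^esub> \<otimes>\<^bsub>?M\<^esub> X \<otimes>\<^bsub>?M\<^esub> ?\<iota> \<one>\<^bsub>A\<^esub> = ?\<iota> e"
    unfolding corner_mult_right[OF ring_axioms one_closed 1] unfolding corner_mult_left[OF ring_axioms one_closed X(1)]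
    using e mn by (auto simp: corner_def e_def intro!: restrict_ext)
  have "\<theta> (?\<iota> \<one>\<^bsub>A\<^esub> \<otimes>\<^bsub>?M\<^esub> X \<otimes>\<^bsub>?M\<^esub> ?\<iota> \<one>\<^bsub>A\<^esub>) = x"
    using X 1 x(4) \<iota> by (simp add: \<theta>_mult f_def)
  then have \<theta>e: "\<theta> (?\<iota> e) = x"
    by (simp add: corner)
  show thesis
  proof (rule that[OF e])
    show "e \<noteq> \<zero>\<^bsub>A\<^esub>"
      using \<theta>e \<theta>0 x(2) by auto
    have "\<theta> (?\<iota> (e \<otimes>\<^bsub>A\<^esub> e)) = \<theta> (?\<iota> e)"
      using e x(3) \<iota> by (simp add: \<theta>_mult \<theta>e flip: \<iota>_mult)
    then show "e \<otimes>\<^bsub>A\<^esub> e = e"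
      using e by (intro \<theta>\<iota>_inj) auto
    fix r assume r: "r \<in> carrier A"
    obtain c where c: "x * \<theta> (?\<iota> r) * x = c \<cdot>\<^sub>m x"
      using xsx[OF \<theta>_closed] by blast
    have "\<theta> (?\<iota> (e \<otimes>\<^bsub>A\<^esub> r \<otimes>\<^bsub>A\<^esub> e)) = \<theta> (?\<iota> e) * \<theta> (?\<iota> r) * \<theta> (?\<iota> e)"
      using \<theta>_mult[OF \<iota> \<iota>, of "e \<otimes>\<^bsub>A\<^esub> r" e] \<theta>_mult[OF \<iota> \<iota>, of e r]
        \<iota>_mult[of "e \<otimes>\<^bsub>A\<^esub> r" e] \<iota>_mult[of e r] e r by simp
    also have "\<dots> = \<theta> (?\<iota> (c \<odot>\<^bsub>A\<^esub> e))"
      using c e \<iota> by (simp add: \<theta>e \<theta>_smult flip: \<iota>_smult)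
    finally show "\<exists>c. e \<otimes>\<^bsub>A\<^esub> r \<otimes>\<^bsub>A\<^esub> e = c \<odot>\<^bsub>A\<^esub> e"
      using e r F_algebraD(3)[OF A] by (intro exI[of _ c] \<theta>\<iota>_inj) auto
  qed
qed

section \<open>Matrix units\<close>

context operator_space begin

lemma sum_Basis_representation: "(\<Sum>b\<in>Basis. scale (representation Basis v b) b) = v"
  using sum_representation_eq[OF independent_Basis _ finite_Basis order_refl, of v] span_Basis by simp

lemma linear_eqI:
  assumes f: "Vector_Spaces.linear scale scale f" and g: "Vector_Spaces.linear scale scale g"
    and eq: "\<And>b. b \<in> Basis \<Longrightarrow> f b = g b"
  shows "f = g"
proof
  fix v
  have "f (\<Sum>b\<in>Basis. scale (representation Basis v b) b) = g (\<Sum>b\<in>Basis. scale (representation Basis v b) b)"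
    by (simp add: lin_sum[OF f] lin_sum[OF g] lin_scale[OF f] lin_scale[OF g] eq)
  then show "f v = g v"
    by (simp add: sum_Basis_representation)
qed

text \<open>A linear operator is determined by its matrix in the given basis; the pairing of natural
  numbers lists the entries as one sequence.\<close>

lemma operators_inject:
  "\<exists>k :: ('b \<Rightarrow> 'b) \<Rightarrow> nat \<Rightarrow> 'a. inj_on k {f. Vector_Spaces.linear scale scale f}"
proof -
  obtain \<beta> where \<beta>: "bij_betw \<beta> {0..<card Basis} Basis"
    using ex_bij_betw_nat_finite[OF finite_Basis] by blast
  define k where "k f n = representation Basis (f (\<beta> (fst (prod_decode n)))) (\<beta> (snd (prod_decode n)))"
    for f :: "'b \<Rightarrow> 'b" and n
  have "inj_on k {f. Vector_Spaces.linear scale scale f}"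
  proof (rule inj_onI)
    fix f g assume "f \<in> {f. Vector_Spaces.linear scale scale f}" "g \<in> {f. Vector_Spaces.linear scale scale f}"
      and eq: "k f = k g"
    then have lin: "Vector_Spaces.linear scale scale f" "Vector_Spaces.linear scale scale g"
      by auto
    show "f = g"
    proof (rule linear_eqI[OF lin])
      fix b assume "b \<in> Basis"
      then obtain i where i: "b = \<beta> i"
        using \<beta> by (auto simp: bij_betw_def)
      have "representation Basis (f b) b' = representation Basis (g b) b'" if b': "b' \<in> Basis" for b'
      proof -
        obtain j where "b' = \<beta> j"
          using \<beta> b' by (auto simp: bij_betw_def)
        then show ?thesis
          using fun_cong[OF eq, of "prod_encode (i, j)"] i by (simp add: k_def)
      qed
      then show "f b = g b"
        by (metis (no_types, lifting) sum.cong sum_Basis_representation)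
    qed
  qed
  then show ?thesis by blast
qed

lemma brauer_trivial_op_alg_idempotent:
  assumes br: "brauer_trivial TYPE('a)" and R: "operator_algebra R"
    and csa: "central_simple_algebra (op_alg scale R)"
  shows "\<exists>e\<in>R. e \<noteq> (\<lambda>_. 0) \<and> e \<circ> e = e \<and> (\<forall>x\<in>R. \<exists>c. e \<circ> x \<circ> e = (\<lambda>v. scale c (e v)))"
proof -
  let ?A = "op_alg scale R"
  obtain k :: "('b \<Rightarrow> 'b) \<Rightarrow> nat \<Rightarrow> 'a" where "inj_on k {f. Vector_Spaces.linear scale scale f}"
    using operators_inject by blast
  then have inj: "inj_on k R"
    using operator_algebraD(1)[OF R] by (rule_tac inj_on_subset) auto
  let ?T = "transport_algebra k ?A"
  have FA: "F_algebra ?A"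
    by (rule op_alg_F_algebra[OF R])
  have k: "k \<in> alg_iso ?A ?T" "k (\<lambda>_. 0) = \<zero>\<^bsub>?T\<^esub>"
    using transport_algebra_iso[of k ?A] inj FA by auto
  note kD = alg_isoD[OF k(1)]
  have csaT: "central_simple_algebra ?T"
    using alg_iso_central_simple[OF csa k(1)] k(2) by simp
  have brT: "brauer_equivalent ?T (base_algebra :: ('a, 'a) module)"
    using br csaT by (simp add: brauer_trivial_def)
  have idR: "id \<in> R" and zR: "(\<lambda>_. 0) \<in> R"
    using operator_algebraD[OF R] by auto
  have "\<one>\<^bsub>?T\<^esub> \<noteq> \<zero>\<^bsub>?T\<^esub>"
  proof
    assume "\<one>\<^bsub>?T\<^esub> = \<zero>\<^bsub>?T\<^esub>"
    then have "k id = k (\<lambda>_. 0)"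
      using kD(8) k(2) by simp
    then have "id = (\<lambda>_. 0 :: 'b)"
      using inj idR zR by (auto dest: inj_onD)
    then have "v = 0" for v :: 'b
      by (metis id_apply)
    then have "R = {\<lambda>_. 0}"
      using zR by (auto simp: fun_eq_iff)
    then show False
      using csa by (simp add: central_simple_algebra_def simple_algebra_def)
  qed
  then obtain e' where e': "e' \<in> carrier ?T" "e' \<noteq> \<zero>\<^bsub>?T\<^esub>" "e' \<otimes>\<^bsub>?T\<^esub> e' = e'"
    and e'x: "\<And>x. x \<in> carrier ?T \<Longrightarrow> \<exists>c. e' \<otimes>\<^bsub>?T\<^esub> x \<otimes>\<^bsub>?T\<^esub> e' = c \<odot>\<^bsub>?T\<^esub> e'"
    using brauer_trivial_rank_one_idempotent[of ?T] csaT brT by (auto simp: central_simple_algebra_def)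
  have "e' \<in> k ` R"
    using e'(1) kD(3) by (simp add: bij_betw_def)
  then obtain e where e: "e \<in> R" "e' = k e" by auto
  show ?thesis
  proof (intro bexI[OF _ e(1)] conjI ballI)
    show "e \<noteq> (\<lambda>_. 0)"
      using e'(2) e k(2) by auto
    have "k (e \<circ> e) = k e"
      using kD(6)[of e e] e e'(3) by simp
    then show "e \<circ> e = e"
      using inj e operator_algebraD(4)[OF R] by (auto dest: inj_onD)
    fix x assume x: "x \<in> R"
    obtain c where c: "k e \<otimes>\<^bsub>?T\<^esub> k x \<otimes>\<^bsub>?T\<^esub> k e = c \<odot>\<^bsub>?T\<^esub> k e"
      using e'x[of "k x"] kD(5)[of x] x e by auto
    have ex: "e \<circ> x \<in> R" "e \<circ> x \<circ> e \<in> R" "(\<lambda>v. scale c (e v)) \<in> R"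
      using e x operator_algebraD(4,5)[OF R] by blast+
    have "k (e \<circ> x \<circ> e) = k e \<otimes>\<^bsub>?T\<^esub> k x \<otimes>\<^bsub>?T\<^esub> k e"
      using kD(6)[of "e \<circ> x" e] kD(6)[of e x] e x ex by simp
    also have "\<dots> = k (\<lambda>v. scale c (e v))"
      unfolding c using kD(9)[of e c] e by simp
    finally show "\<exists>c. e \<circ> x \<circ> e = (\<lambda>v. scale c (e v))"
      using inj ex by (intro exI[of _ c]) (auto dest: inj_onD)
  qed
qed

end

text \<open>The coefficients in \<open>E_span\<close> are determined, because multiplication by
  units on both sides isolates each of them; this is how independence of the \<open>E i j\<close> is
  used later.\<close>

locale matrix_units = operator_space scale Basis
  for scale :: "'a::field \<Rightarrow> 'b::ab_group_add \<Rightarrow> 'b" and Basis +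
  fixes R :: "('b \<Rightarrow> 'b) set" and n :: nat and E :: "nat \<Rightarrow> nat \<Rightarrow> 'b \<Rightarrow> 'b"
  assumes alg: "operator_algebra R" and pos: "n > 0"
    and E_in: "\<And>i j. i < n \<Longrightarrow> j < n \<Longrightarrow> E i j \<in> R"
    and E_mult: "\<And>i j k l v. i < n \<Longrightarrow> j < n \<Longrightarrow> k < n \<Longrightarrow> l < n \<Longrightarrow>
          E i j (E k l v) = (if j = k then E i l v else 0)"
    and E_sum: "\<And>v. (\<Sum>i<n. E i i v) = v"
    and E_span: "\<And>x. x \<in> R \<Longrightarrow> \<exists>M. \<forall>v. x v = (\<Sum>i<n. \<Sum>j<n. scale (M i j) (E i j v))"
    and nonzero: "(UNIV :: 'b set) \<noteq> {0}"

context operator_space begin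

text \<open>The rank-one idempotent \<open>e\<close> makes \<open>Re\<close> and \<open>eR\<close> dual vector spaces; dual bases \<open>r\<^sub>i\<close>, \<open>s\<^sub>j\<close> give
  the matrix units \<open>r\<^sub>i s\<^sub>j\<close>.\<close>

lemma matrix_units_exist:
  assumes R: "operator_algebra R" and nz: "(UNIV :: 'b set) \<noteq> {0}"
    and e: "e \<in> R" "e \<noteq> (\<lambda>_. 0)" "e \<circ> e = e"
    and rank_one: "\<And>x. x \<in> R \<Longrightarrow> \<exists>c. e \<circ> x \<circ> e = (\<lambda>v. scale c (e v))"
    and prime: "\<And>g. g \<in> R \<Longrightarrow> g \<noteq> (\<lambda>_. 0) \<Longrightarrow> \<exists>x\<in>R. \<exists>y\<in>R. e \<circ> x \<circ> g \<circ> y \<circ> e \<noteq> (\<lambda>_. 0)"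
  shows "\<exists>n E. matrix_units scale Basis R n E"
proof -
  note lin = operator_algebraD(1)[OF R]
  have ee: "e (e v) = e v" for v
    using fun_cong[OF e(3), of v] by simp
  \<comment> \<open>There are \<open>k\<close> dual pairs, \<open>r i\<close> in \<open>Re\<close>
    and \<open>s i\<close> in \<open>eR\<close>, for the pairing that sends \<open>(s, r)\<close> to
    \<open>s r\<close> in \<open>eRe = Fe\<close>. A pair system of maximal size replaces a choice
    of dual bases.\<close>
  define P where "P k \<longleftrightarrow> (\<exists>r s. (\<forall>i<k. r i \<in> R \<and> s i \<in> R \<and> (\<forall>v. r i (e v) = r i v) \<and> (\<forall>v. e (s i v) = s i v)) \<and>
     (\<forall>i<k. \<forall>j<k. \<forall>v. s i (r j v) = (if i = j then e v else 0)))" for k :: nat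
  have "P 0" by (simp add: P_def)
  \<comment> \<open>The bound that makes a maximum exist: for \<open>e v \<noteq> 0\<close> the
    vectors \<open>r i v\<close> are independent, as \<open>s j\<close> extracts the coefficient
    with index \<open>j\<close>.\<close>
  moreover have "k \<le> dim UNIV" if Pk: "P k" for k
  proof -
    obtain r s where r: "\<forall>i<k. r i \<in> R \<and> s i \<in> R \<and> (\<forall>v. r i (e v) = r i v) \<and> (\<forall>v. e (s i v) = s i v)"
      and rs: "\<forall>i<k. \<forall>j<k. \<forall>v. s i (r j v) = (if i = j then e v else 0)"
      using Pk unfolding P_def by blast
    obtain v where v: "e v \<noteq> 0"
      using e(2) by auto
    have "\<forall>i\<in>{..<k}. c i = 0" if c: "(\<Sum>i\<in>{..<k}. scale (c i) (r i v)) = 0" for c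
    proof
      fix j assume j: "j \<in> {..<k}"
      have lj: "Vector_Spaces.linear scale scale (s j)"
        using r lin j by auto
      have "s j (\<Sum>i\<in>{..<k}. scale (c i) (r i v)) = (\<Sum>i\<in>{..<k}. if i = j then scale (c j) (e v) else 0)"
        unfolding lin_sum[OF lj] lin_scale[OF lj] using rs j by (intro sum.cong) auto
      then have "scale (c j) (e v) = 0"
        using j unfolding c lin_zero[OF lj] by simp
      then show "c j = 0"
        using v by simp
    qed
    then have "dim (span ((\<lambda>i. r i v) ` {..<k})) = k"
      using dim_span_family(3)[of "{..<k}" "\<lambda>i. r i v"] by simp
    then show ?thesis
      using dim_subset[OF subset_UNIV] by metis
  qed
  ultimately obtain n where Pn: "P n" and max: "\<And>k. P k \<Longrightarrow> k \<le> n"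
    using ex_has_greatest_nat[of P 0 "\<lambda>k. k" "Suc (dim UNIV)"] le_imp_less_Suc by (metis (no_types, lifting))
  obtain r s where r: "\<And>i. i < n \<Longrightarrow> r i \<in> R" "\<And>i v. i < n \<Longrightarrow> r i (e v) = r i v"
    and s: "\<And>i. i < n \<Longrightarrow> s i \<in> R" "\<And>i v. i < n \<Longrightarrow> e (s i v) = s i v"
    and sr: "\<And>i j v. i < n \<Longrightarrow> j < n \<Longrightarrow> s i (r j v) = (if i = j then e v else 0)"
    using Pn unfolding P_def by blast
  have linr: "Vector_Spaces.linear scale scale (r i)" if "i < n" for i
    using r(1)[OF that] lin by auto
  have lins: "Vector_Spaces.linear scale scale (s i)" if "i < n" for i
    using s(1)[OF that] lin by auto
  \<comment> \<open>The complementary idempotent, annihilated by every \<open>s i\<close> on the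
    left and every \<open>r i\<close> on the right. Completeness of the system is
    \<open>g = 0\<close>.\<close>
  define g where "g v = v - (\<Sum>i<n. r i (s i v))" for v
  have gR: "g \<in> R"
  proof -
    have "r i \<circ> s i \<in> R" if "i \<in> {..<n}" for i
      using that r(1) s(1) operator_algebraD(4)[OF R] by simp
    from operator_algebra_sum[OF R finite_lessThan this]
    have "(\<lambda>v. \<Sum>i<n. r i (s i v)) \<in> R"
      by simp
    from operator_algebraD(8)[OF R operator_algebraD(2)[OF R] this]
    show ?thesis
      unfolding g_def[abs_def] by simp
  qed
  have sg: "s i (g v) = 0" if i: "i < n" for i v
  proof -
    have "s i (\<Sum>j<n. r j (s j v)) = (\<Sum>j<n. if j = i then s i v else 0)"
      unfolding lin_sum[OF lins[OF i]] using sr i s by (intro sum.cong) auto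
    then show ?thesis
      using i by (simp add: g_def lin_diff[OF lins[OF i]])
  qed
  have gr: "g (r i v) = 0" if i: "i < n" for i v
  proof -
    have "(\<Sum>j<n. r j (s j (r i v))) = (\<Sum>j<n. if j = i then r i v else 0)"
      using sr i r lin_zero[OF linr] by (intro sum.cong) auto
    then show ?thesis
      using i by (simp add: g_def)
  qed
  have gg: "g (g v) = g v" for v
    unfolding g_def[of "g v"] using sg lin_zero[OF linr] by simp
  have g0: "g = (\<lambda>_. 0)"
  proof (rule ccontr)
    assume "g \<noteq> (\<lambda>_. 0)"
    then obtain x y where xy: "x \<in> R" "y \<in> R" and ne: "e \<circ> x \<circ> g \<circ> y \<circ> e \<noteq> (\<lambda>_. 0)"
      using prime[OF gR] by blast
    have "x \<circ> g \<circ> y \<in> R"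
      using xy gR operator_algebraD(4)[OF R] by blast
    then obtain c where c: "e \<circ> (x \<circ> g \<circ> y) \<circ> e = (\<lambda>v. scale c (e v))"
      using rank_one by blast
    have cv: "e (x (g (y (e v)))) = scale c (e v)" for v
      using fun_cong[OF c, of v] by simp
    have "c \<noteq> 0"
      using ne cv by (auto simp: fun_eq_iff)
    \<comment> \<open>The product of \<open>e x g\<close> and \<open>g y e\<close> is
      \<open>c e\<close> with \<open>c \<noteq> 0\<close>. After division by \<open>c\<close> it is
      a further dual pair, orthogonal to the old ones through \<open>g\<close>, against
      maximality.\<close>
    define r' where "r' = r(n := g \<circ> y \<circ> e)"
    define s' where "s' = s(n := (\<lambda>v. scale (inverse c) ((e \<circ> x \<circ> g) v)))"
    have "P (Suc n)"
      unfolding P_def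
    proof (rule exI[of _ r'], rule exI[of _ s'], intro conjI allI impI)
      fix i assume i: "i < Suc n"
      have gye: "g \<circ> y \<circ> e \<in> R" "e \<circ> x \<circ> g \<in> R"
        using xy gR e operator_algebraD(4)[OF R] by blast+
      show "r' i \<in> R" "s' i \<in> R"
        using i r(1)[of i] s(1)[of i] gye(1) operator_algebraD(5)[OF R gye(2), of "inverse c"] by (auto simp: r'_def s'_def less_Suc_eq)
      show "r' i (e v) = r' i v" for v
        using i r(2)[of i v] ee by (auto simp: r'_def less_Suc_eq)
      show "e (s' i v) = s' i v" for v
        using i s(2)[of i v] ee lin_scale[OF lin[OF e(1)]] by (auto simp: s'_def less_Suc_eq)
      fix j v assume j: "j < Suc n"
      show "s' i (r' j v) = (if i = j then e v else 0)"
      proof (cases "i = n"; cases "j = n")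
        assume "i = n" "j = n"
        then show ?thesis
          using cv[of v] gg \<open>c \<noteq> 0\<close> by (simp add: s'_def r'_def)
      next
        assume "i = n" "j \<noteq> n"
        then show ?thesis
          using gr[of j v] j lin_zero[OF lin[OF xy(1)]] lin_zero[OF lin[OF e(1)]] by (simp add: s'_def r'_def)
      next
        assume "i \<noteq> n" "j = n"
        then show ?thesis
          using sg[of i] i by (simp add: s'_def r'_def)
      next
        assume "i \<noteq> n" "j \<noteq> n"
        then show ?thesis
          using sr[of i j v] i j by (simp add: s'_def r'_def)
      qed
    qed
    then show False
      using max[of "Suc n"] by simp
  qed
  have sum1: "(\<Sum>i<n. r i (s i v)) = v" for v
    using fun_cong[OF g0, of v] by (simp add: g_def)
  define E where "E i j = r i \<circ> s j" for i j
  have "matrix_units scale Basis R n E"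
  proof unfold_locales
    show "operator_algebra R" by fact
    show "n > 0"
    proof (rule ccontr)
      assume "\<not> n > 0"
      then have "v = 0" for v :: 'b
        using sum1[of v] by simp
      then show False
        using nz by auto
    qed
    show "E i j \<in> R" if "i < n" "j < n" for i j
      unfolding E_def using that r s operator_algebraD(4)[OF R] by blast
    show "E i j (E k l v) = (if j = k then E i l v else 0)" if "i < n" "j < n" "k < n" "l < n" for i j k l v
      using that sr r(2) s(2) lin_zero[OF linr] by (simp add: E_def)
    show "(\<Sum>i<n. E i i v) = v" for v
      by (simp add: E_def sum1)
    show "(UNIV :: 'b set) \<noteq> {0}" by fact
    fix x assume x: "x \<in> R"
    \<comment> \<open>The matrix entries of \<open>x\<close>: inserting the sum of the
      \<open>r i s i\<close> on both sides of \<open>x\<close> leaves middle factors in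
      \<open>eRe\<close>, which are scalar multiples of \<open>e\<close>.\<close>
    have "\<exists>c. \<forall>v. s i (x (r j v)) = scale c (e v)" if ij: "i < n" "j < n" for i j
    proof -
      have "s i \<circ> x \<circ> r j \<in> R"
        by (intro operator_algebraD(4)[OF R] s(1) r(1) ij x)
      then obtain c where c: "e \<circ> (s i \<circ> x \<circ> r j) \<circ> e = (\<lambda>v. scale c (e v))"
        using rank_one by blast
      show ?thesis
        using fun_cong[OF c] r(2) s(2) ij by (intro exI[of _ c]) simp
    qed
    then obtain M where M: "\<And>i j v. i < n \<Longrightarrow> j < n \<Longrightarrow> s i (x (r j v)) = scale (M i j) (e v)"
      by metis
    have "x v = (\<Sum>i<n. \<Sum>j<n. scale (M i j) (E i j v))" for v
    proof -
      have "x v = (\<Sum>i<n. r i (s i (x (\<Sum>j<n. r j (s j v)))))"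
        by (simp add: sum1)
      also have "\<dots> = (\<Sum>i<n. \<Sum>j<n. r i (s i (x (r j (s j v)))))"
        by (intro sum.cong) (simp_all add: lin_sum[OF lin[OF x]] lin_sum[OF lins] lin_sum[OF linr])
      also have "\<dots> = (\<Sum>i<n. \<Sum>j<n. scale (M i j) (E i j v))"
        by (intro sum.cong) (simp_all add: M lin_scale[OF linr] E_def s)
      finally show ?thesis .
    qed
    then show "\<exists>M. \<forall>v. x v = (\<Sum>i<n. \<Sum>j<n. scale (M i j) (E i j v))"
      by blast
  qed
  then show ?thesis by blast
qed

end

section \<open>Modules over an algebra with matrix units\<close>

context matrix_units begin

lemmas lin = operator_algebraD(1)[OF alg]

lemma E_lin: "i < n \<Longrightarrow> j < n \<Longrightarrow> Vector_Spaces.linear scale scale (E i j)"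
  using lin E_in by auto

lemma decompose: "(\<Sum>i<n. E i 0 (E 0 i v)) = v"
  using pos E_sum[of v] by (simp add: E_mult)

lemma nonzero_component:
  assumes "v \<noteq> 0"
  shows "\<exists>i<n. E 0 i v \<noteq> 0"
proof (rule ccontr)
  assume "\<not> ?thesis"
  then have "(\<Sum>i<n. E i 0 (E 0 i v)) = 0"
    using pos by (intro sum.neutral) (auto simp: lin_zero[OF E_lin])
  then show False
    using assms decompose by simp
qed

lemma corner_coefficient:
  assumes M: "\<And>v. x v = (\<Sum>k<n. \<Sum>l<n. scale (M k l) (E k l v))"
    and ij: "i < n" "j < n" "p < n" "q < n"
  shows "E p i (x (E j q v)) = scale (M i j) (E p q v)"
proof -
  have "E p i (x (E j q v)) = (\<Sum>k<n. \<Sum>l<n. scale (M k l) (E p i (E k l (E j q v))))"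
    using M ij by (simp add: lin_sum[OF E_lin] lin_scale[OF E_lin])
  also have "\<dots> = (\<Sum>k<n. \<Sum>l<n. if k = i \<and> l = j then scale (M i j) (E p q v) else 0)"
    using ij by (intro sum.cong refl) (auto simp: E_mult lin_zero[OF E_lin])
  also have "\<dots> = (\<Sum>k<n. if k = i then scale (M i j) (E p q v) else 0)"
  proof (intro sum.cong refl)
    fix k
    show "(\<Sum>l<n. if k = i \<and> l = j then scale (M i j) (E p q v) else 0) = (if k = i then scale (M i j) (E p q v) else 0)"
      using ij by (cases "k = i") auto
  qed
  also have "\<dots> = scale (M i j) (E p q v)"
    using ij by simp
  finally show ?thesis .
qed

lemma corner_scalar:
  assumes x: "x \<in> R" and ij: "i < n" "j < n" "p < n" "q < n"
  shows "\<exists>c. \<forall>v. E p i (x (E j q v)) = scale c (E p q v)"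
proof -
  obtain M where M: "\<forall>v. x v = (\<Sum>k<n. \<Sum>l<n. scale (M k l) (E k l v))"
    using E_span[OF x] by blast
  show ?thesis
    using corner_coefficient[of x M, OF _ ij] M by blast
qed

lemma commute_with_units:
  assumes f: "Vector_Spaces.linear scale scale f"
    and comm: "\<And>i j v. i < n \<Longrightarrow> j < n \<Longrightarrow> f (E i j v) = E i j (f v)"
  shows "f \<in> End_over scale R"
proof -
  have "f (x v) = x (f v)" if x: "x \<in> R" for x v
  proof -
    obtain M where M: "\<forall>v. x v = (\<Sum>k<n. \<Sum>l<n. scale (M k l) (E k l v))"
      using E_span[OF x] by blast
    then show ?thesis
      by (simp add: lin_sum[OF f] lin_scale[OF f] comm)
  qed
  then show ?thesis
    using f by (auto simp: End_over_def fun_eq_iff)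
qed

lemma center_scalar:
  assumes x: "x \<in> R" and comm: "\<And>i j v. i < n \<Longrightarrow> j < n \<Longrightarrow> x (E i j v) = E i j (x v)"
  shows "\<exists>c. x = scale c"
proof -
  obtain c where c: "\<And>v. E 0 0 (x (E 0 0 v)) = scale c (E 0 0 v)"
    using corner_scalar[OF x pos pos pos pos] by blast
  have "x v = scale c v" for v
  proof -
    have xE: "x (E 0 i v) = scale c (E 0 i v)" if "i < n" for i
      using c[of "E 0 i v"] comm[OF pos pos, of "E 0 i v"] that pos by (simp add: E_mult)
    have "x v = x (\<Sum>i<n. E i 0 (E 0 i v))"
      by (simp only: decompose)
    also have "\<dots> = (\<Sum>i<n. scale c (E i 0 (E 0 i v)))"
      using pos xE by (simp add: lin_sum[OF lin[OF x]] comm lin_scale[OF E_lin] del: E_mult)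
    also have "\<dots> = scale c v"
      by (simp only: scale_sum_right[symmetric] decompose)
    finally show ?thesis .
  qed
  then show ?thesis by auto
qed

text \<open>Applying \<open>E 0 i\<close> to a relation keeps only the block with index
  \<open>i\<close> and returns it to the image of \<open>E 0 0\<close>, where independence is
  assumed.\<close>

lemma units_family_independent:
  assumes u: "\<And>k. k \<in> J \<Longrightarrow> E 0 0 (u k) = u k" and J: "finite J"
    and ind: "\<And>c. (\<Sum>k\<in>J. scale (c k) (u k)) = 0 \<Longrightarrow> \<forall>k\<in>J. c k = 0"
    and c: "(\<Sum>p\<in>{..<n} \<times> J. scale (c p) (E (fst p) 0 (u (snd p)))) = 0"
  shows "\<forall>p\<in>{..<n} \<times> J. c p = 0"
proof -
  have "\<forall>k\<in>J. c (i, k) = 0" if i: "i < n" for i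
  proof (rule ind)
    have "0 = E 0 i (\<Sum>p\<in>{..<n} \<times> J. scale (c p) (E (fst p) 0 (u (snd p))))"
      unfolding c using lin_zero[OF E_lin[OF pos i]] by simp
    also have "\<dots> = (\<Sum>j<n. \<Sum>k\<in>J. scale (c (j, k)) (E 0 i (E j 0 (u k))))"
      using pos i by (simp add: lin_sum[OF E_lin] lin_scale[OF E_lin] sum.cartesian_product case_prod_beta)
    also have "\<dots> = (\<Sum>j<n. if j = i then (\<Sum>k\<in>J. scale (c (i, k)) (u k)) else 0)"
    proof (intro sum.cong refl)
      fix j assume "j \<in> {..<n}"
      then show "(\<Sum>k\<in>J. scale (c (j, k)) (E 0 i (E j 0 (u k)))) = (if j = i then (\<Sum>k\<in>J. scale (c (i, k)) (u k)) else 0)"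
        using pos i u by (cases "j = i") (auto intro!: sum.cong sum.neutral simp: E_mult)
    qed
    finally show "(\<Sum>k\<in>J. scale (c (i, k)) (u k)) = 0"
      using i by simp
  qed
  then show ?thesis by auto
qed

text \<open>From a nonzero \<open>y = x u\<close>, some \<open>E 0 i\<close> gives a nonzero
  multiple of \<open>u\<close>, so \<open>y\<close> generates everything; the vectors
  \<open>E i 0 u\<close> form a basis, whence the dimension \<open>n\<close>.\<close>

lemma cyclic_simple:
  assumes u: "u \<noteq> 0" "E 0 0 u = u"
  shows "simple_submod scale R {x u |x. x \<in> R}" "dim {x u |x. x \<in> R} = n"
proof -
  let ?W = "{x u |x. x \<in> R}"
  have sub: "submod scale R ?W"
  proof (rule submodI)
    show "subspace ?W"
    proof (rule subspaceI)
      show "0 \<in> ?W"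
        using operator_algebraD(6)[OF alg] by force
      show "y + y' \<in> ?W" if "y \<in> ?W" "y' \<in> ?W" for y y'
        using that operator_algebraD(3)[OF alg] by force
      show "scale c y \<in> ?W" if "y \<in> ?W" for c y
        using that operator_algebraD(5)[OF alg] by force
    qed
    fix x w assume x: "x \<in> R" and "w \<in> ?W"
    then obtain y where y: "w = y u" "y \<in> R" by blast
    have "x w = (x \<circ> y) u" "x \<circ> y \<in> R"
      using y operator_algebraD(4)[OF alg x y(2)] by auto
    then show "x w \<in> ?W" by blast
  qed
  have uW: "u \<in> ?W"
  proof -
    have "id u \<in> ?W"
      using operator_algebraD(2)[OF alg] by blast
    then show ?thesis by simp
  qed
  show "simple_submod scale R ?W"
    unfolding simple_submod_def
  proof (intro conjI allI impI)
    show "submod scale R ?W" by (rule sub)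
    show "?W \<noteq> {0}"
      using uW u(1) by blast
    fix U assume U: "submod scale R U \<and> U \<subseteq> ?W"
    show "U = {0} \<or> U = ?W"
    proof (cases "U = {0}")
      case False
      then obtain y where y: "y \<in> U" "y \<noteq> 0"
        using U subspace_0[of U] by (auto simp: submod_def)
      then obtain x where x: "x \<in> R" "y = x u"
        using U by blast
      obtain i where i: "i < n" "E 0 i y \<noteq> 0"
        using nonzero_component[OF y(2)] by blast
      obtain c where c: "\<And>v. E 0 i (x (E 0 0 v)) = scale c (E 0 0 v)"
        using corner_scalar[OF x(1) i(1) pos pos pos] by blast
      have Ey: "E 0 i y = scale c u"
        using c[of u] u(2) x(2) by simp
      have "c \<noteq> 0"
        using i(2) Ey by auto
      moreover have "E 0 i y \<in> U"
        using U y E_in[OF pos i(1)] by (auto simp: submod_def)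
      moreover have "scale (inverse c) (scale c u) = u"
        using \<open>c \<noteq> 0\<close> by simp
      ultimately have "u \<in> U"
        using U subspace_scale[of U "scale c u" "inverse c"] unfolding Ey submod_def by metis
      then have "?W \<subseteq> U"
        using U by (auto simp: submod_def)
      then show ?thesis
        using U by blast
    qed simp
  qed
  let ?w = "\<lambda>i. E i 0 u"
  have ind: "\<forall>i\<in>{..<n}. c i = 0" if c: "(\<Sum>i\<in>{..<n}. scale (c i) (?w i)) = 0" for c
  proof -
    have "(\<Sum>p\<in>{..<n} \<times> {0::nat}. scale (c (fst p)) (E (fst p) 0 u)) = 0"
      using c by (simp flip: sum.cartesian_product add: case_prod_beta sum.cartesian_product')
    then have "\<forall>p\<in>{..<n} \<times> {0::nat}. c (fst p) = 0"
      using u by (intro units_family_independent[of "{0::nat}" "\<lambda>_. u" "\<lambda>p. c (fst p)"]) auto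
    then show ?thesis by auto
  qed
  have "?W = span (?w ` {..<n})"
  proof (intro equalityI subsetI)
    fix y assume "y \<in> ?W"
    then obtain x where x: "x \<in> R" "y = x u" by blast
    obtain M where M: "\<forall>v. x v = (\<Sum>k<n. \<Sum>l<n. scale (M k l) (E k l v))"
      using E_span[OF x(1)] by blast
    have "E k l u = (if l = 0 then ?w k else 0)" if "k < n" "l < n" for k l
      using E_mult[OF that pos pos, of u] u(2) by simp
    then have "y = (\<Sum>k<n. \<Sum>l<n. scale (M k l) (if l = 0 then ?w k else 0))"
      using M x(2) by simp
    also have "\<dots> \<in> span (?w ` {..<n})"
      by (intro span_sum span_scale) (auto intro: span_base span_zero)
    finally show "y \<in> span (?w ` {..<n})" .
  next
    fix y assume "y \<in> span (?w ` {..<n})"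
    moreover have "span (?w ` {..<n}) \<subseteq> ?W"
      using submodD(1)[OF sub] E_in pos by (intro span_minimal) auto
    ultimately show "y \<in> ?W" by blast
  qed
  then show "dim ?W = n"
    using dim_span_family(3)[of "{..<n}" ?w, OF finite_lessThan ind] by simp
qed

lemma simple_submod_cyclic:
  assumes W: "simple_submod scale R W"
  shows "\<exists>u. u \<noteq> 0 \<and> E 0 0 u = u \<and> W = {x u |x. x \<in> R}"
proof -
  have sW: "submod scale R W" "W \<noteq> {0}"
    using W by (auto simp: simple_submod_def)
  then obtain y where y: "y \<in> W" "y \<noteq> 0"
    using subspace_0[of W] by (auto simp: submod_def)
  obtain i where i: "i < n" "E 0 i y \<noteq> 0"
    using nonzero_component[OF y(2)] by blast
  define u where "u = E 0 i y"
  have u: "u \<noteq> 0" "E 0 0 u = u" "u \<in> W"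
    using i pos y E_in submodD(2)[OF sW(1)] by (auto simp: u_def E_mult)
  have "{x u |x. x \<in> R} \<subseteq> W"
    using u(3) submodD(2)[OF sW(1)] by blast
  then have "{x u |x. x \<in> R} = W"
    using W cyclic_simple(1)[OF u(1,2)] unfolding simple_submod_def by blast
  then show ?thesis
    using u by blast
qed

lemma semisimple: "semisimple_mod scale R"
proof -
  have "v \<in> span (\<Union>{W. simple_submod scale R W})" for v
  proof -
    have "E i 0 (E 0 i v) \<in> span (\<Union>{W. simple_submod scale R W})" if i: "i < n" for i
    proof (cases "E 0 i v = 0")
      case True
      then show ?thesis
        using i pos by (simp add: lin_zero[OF E_lin] span_zero)
    next
      case False
      have "E 0 0 (E 0 i v) = E 0 i v"
        using i pos by (simp add: E_mult)
      from cyclic_simple(1)[OF False this] show ?thesis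
        using E_in[OF i pos] by (intro span_base) blast
    qed
    then have "(\<Sum>i<n. E i 0 (E 0 i v)) \<in> span (\<Union>{W. simple_submod scale R W})"
      by (intro span_sum) auto
    then show ?thesis
      by (simp only: decompose)
  qed
  then show ?thesis
    by (auto simp: semisimple_mod_def)
qed

text \<open>An \<open>R\<close>-endomorphism is determined by a linear map on the image of
  \<open>E 0 0\<close>, and each such map is realised. Here a linear \<open>g\<close> with
  \<open>g u = w\<close> is compressed to that image and copied along the blocks.\<close>

lemma intertwiner_exists:
  assumes u: "u \<noteq> 0" "E 0 0 u = u" and w: "E 0 0 w = w"
  shows "\<exists>f\<in>End_over scale R. f u = w"
proof -
  interpret p: vector_space_pair scale scale ..
  obtain g where g: "Vector_Spaces.linear scale scale g" "g u = w"
    using p.linear_independent_extend[of "{u}" "\<lambda>_. w"] u(1) by auto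
  define f where "f v = (\<Sum>i<n. E i 0 (E 0 0 (g (E 0 i v))))" for v
  have f: "Vector_Spaces.linear scale scale f"
    using pos by (intro linearI)
      (simp_all add: f_def lin_add[OF E_lin] lin_scale[OF E_lin] lin_add[OF g(1)] lin_scale[OF g(1)] sum.distrib scale_sum_right)
  have "f (E i j v) = E i j (f v)" if ij: "i < n" "j < n" for i j v
  proof -
    have "f (E i j v) = (\<Sum>k<n. if k = i then E i 0 (E 0 0 (g (E 0 j v))) else 0)"
      unfolding f_def using pos ij by (intro sum.cong) (auto simp: E_mult lin_zero[OF E_lin] lin_zero[OF g(1)])
    also have "\<dots> = (\<Sum>k<n. E i j (E k 0 (E 0 0 (g (E 0 k v)))))"
      using pos ij by (simp add: E_mult if_distrib cong: if_cong)
    also have "\<dots> = E i j (f v)"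
      using ij by (simp add: f_def lin_sum[OF E_lin])
    finally show ?thesis .
  qed
  then have "f \<in> End_over scale R"
    using commute_with_units[OF f] by blast
  moreover have "f u = w"
  proof -
    have Eu: "E 0 i u = (if i = 0 then u else 0)" if "i < n" for i
      using E_mult[OF pos that pos pos, of u] u(2) by simp
    have "f u = (\<Sum>i<n. if i = 0 then w else 0)"
      unfolding f_def using pos w g(2) by (intro sum.cong) (auto simp: Eu lin_zero[OF E_lin] lin_zero[OF g(1)])
    then show ?thesis
      using pos by simp
  qed
  ultimately show ?thesis by blast
qed

lemma isotypic: "isotypic_mod scale R"
  unfolding isotypic_mod_def
proof (intro conjI allI impI semisimple)
  fix W W' assume "simple_submod scale R W \<and> simple_submod scale R W'"
  then obtain u u' where u: "u \<noteq> 0" "E 0 0 u = u" "W = {x u |x. x \<in> R}"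
    and u': "u' \<noteq> 0" "E 0 0 u' = u'" "W' = {x u' |x. x \<in> R}"
    using simple_submod_cyclic[of W] simple_submod_cyclic[of W'] by auto
  obtain f where f: "f \<in> End_over scale R" "f u = u'"
    using intertwiner_exists[OF u(1,2) u'(2)] by blast
  obtain h where h: "h \<in> End_over scale R" "h u' = u"
    using intertwiner_exists[OF u'(1,2) u(2)] by blast
  have fx: "f (x v) = x (f v)" if "x \<in> R" for x v
    using f(1) that by (simp add: End_over_def fun_eq_iff)
  have hx: "h (x v) = x (h v)" if "x \<in> R" for x v
    using h(1) that by (simp add: End_over_def fun_eq_iff)
  have lf: "Vector_Spaces.linear scale scale f"
    using f(1) by (simp add: End_over_def)
  have "bij_betw f W W'"
  proof (rule bij_betwI[where g = h])
    show "f \<in> W \<rightarrow> W'"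
      using u(3) u'(3) fx f(2) by auto
    show "h \<in> W' \<rightarrow> W"
      using u(3) u'(3) hx h(2) by auto
    show "h (f v) = v" if "v \<in> W" for v
      using that u(3) fx hx f(2) h(2) by auto
    show "f (h v) = v" if "v \<in> W'" for v
      using that u'(3) fx hx f(2) h(2) by auto
  qed
  then show "submod_iso scale R W W'"
    unfolding submod_iso_def using lf fx by (intro exI[of _ f]) (auto simp: lin_add lin_scale)
qed

text \<open>\<open>V\<close> is the tensor product of an \<open>n\<close>-dimensional space with the
  image of \<open>E 0 0\<close>, and the commutant acts on the second factor; a basis of that image
  supplies its matrix units. The vector \<open>u\<close> is kept in the conclusion to identify the
  image of \<open>F 0 0\<close> as a simple \<open>R\<close>-module.\<close>

theorem commutant_matrix_units:
  "\<exists>b F u. dim UNIV = n * b \<and> matrix_units scale Basis (End_over scale R) b F \<and>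
     u \<noteq> 0 \<and> E 0 0 u = u \<and> range (F 0 0) = {x u |x. x \<in> R}"
proof -
  define U where "U = {v. E 0 0 v = v}"
  have sU: "subspace U"
    using E_lin[OF pos pos] by (auto simp: U_def lin_zero lin_add lin_scale intro!: subspaceI)
  have EU: "E 0 i v \<in> U" if "i < n" for i v
    using that pos by (simp add: U_def E_mult)
  obtain B where B: "B \<subseteq> U" "independent B" "U \<subseteq> span B" "card B = dim U"
    using basis_exists[of U] by blast
  have finB: "finite B"
    using B(2) by (rule finiteI_independent)
  have spB: "span B = U"
    using B(1,3) sU by (metis span_minimal subset_antisym)
  define b where "b = card B"
  obtain u where u: "bij_betw u {..<b} B"
    using ex_bij_betw_nat_finite[OF finB] by (auto simp: b_def atLeast0LessThan)
  have uB: "u k \<in> B" if "k < b" for k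
    using u that by (auto simp: bij_betw_def)
  have uU: "u k \<in> U" if "k < b" for k
    using uB[OF that] B(1) by auto
  have u_inj: "u k = u l \<longleftrightarrow> k = l" if "k < b" "l < b" for k l
    using u that by (auto simp: bij_betw_def inj_on_def)
  define co where "co l v = representation B v (u l)" for l v
  have co_add: "co l (v + w) = co l v + co l w" if "v \<in> U" "w \<in> U" for l v w
    using that by (simp add: co_def representation_add[OF B(2)] spB)
  have co_scale: "co l (scale c v) = c * co l v" if "v \<in> U" for l c v
    using that by (simp add: co_def representation_scale[OF B(2)] spB)
  have co_u: "co l (u k) = (if k = l then 1 else 0)" if "k < b" "l < b" for k l
    using representation_basis[OF B(2) uB[OF that(1)]] u_inj[OF that(2,1)] by (auto simp: co_def)
  have co_zero: "co l 0 = 0" for l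
    by (simp add: co_def representation_zero)
  have expand: "(\<Sum>k<b. scale (co k v) (u k)) = v" if "v \<in> U" for v
  proof -
    have "(\<Sum>k<b. scale (co k v) (u k)) = (\<Sum>w\<in>B. scale (representation B v w) w)"
      unfolding co_def by (rule sum.reindex_bij_betw[OF u])
    also have "\<dots> = v"
      using sum_representation_eq[OF B(2) _ finB order_refl, of v] that spB by simp
    finally show ?thesis .
  qed
  have indu: "\<forall>k\<in>{..<b}. c k = 0" if c: "(\<Sum>k\<in>{..<b}. scale (c k) (u k)) = 0" for c
  proof
    fix l assume l: "l \<in> {..<b}"
    have co_sum: "co l (\<Sum>k\<in>A. scale (c k) (u k)) = (\<Sum>k\<in>A. c k * co l (u k))" if "finite A" "A \<subseteq> {..<b}" for A
      using that
    proof (induction A)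
      case (insert k A)
      have "(\<Sum>k\<in>A. scale (c k) (u k)) \<in> U"
        using insert uU by (intro subspace_sum[OF sU] subspace_scale[OF sU]) auto
      moreover have "scale (c k) (u k) \<in> U" "u k \<in> U"
        using insert uU by (auto intro: subspace_scale[OF sU])
      ultimately show ?case
        using insert by (simp add: co_add co_scale)
    qed (simp add: co_zero)
    have "0 = (\<Sum>k<b. c k * co l (u k))"
      using co_sum[of "{..<b}"] c co_zero by simp
    also have "\<dots> = (\<Sum>k<b. if k = l then c l else 0)"
      using l by (intro sum.cong) (auto simp: co_u)
    finally show "c l = 0"
      using l by simp
  qed
  have u0: "E 0 0 (u k) = u k" if "k < b" for k
    using uU[OF that] by (simp add: U_def)
  have Eu: "E 0 i (u k) = (if i = 0 then u k else 0)" if "i < n" "k < b" for i k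
    using E_mult[OF pos that(1) pos pos, of "u k"] u0[OF that(2)] by simp
  \<comment> \<open>In each block \<open>i\<close>, pull back to the image of \<open>E 0 0\<close>,
    replace \<open>u l\<close> by \<open>u k\<close> and kill the other basis vectors, then push
    forward.\<close>
  define F where "F k l v = (\<Sum>i<n. E i 0 (scale (co l (E 0 i v)) (u k)))" for k l v
  have bpos: "b > 0"
  proof (rule ccontr)
    assume "\<not> b > 0"
    then have "U = {0}"
      using spB finB by (simp add: b_def)
    then have E0: "E 0 i v = 0" if "i < n" for i v
      using EU[OF that] by auto
    have "v = 0" for v :: 'b
      using nonzero_component[of v] E0 by blast
    then show False
      using nonzero by auto
  qed
  have dimV: "dim UNIV = n * b"
  proof -
    let ?w = "\<lambda>p. E (fst p) 0 (u (snd p))"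
    let ?I = "{..<n} \<times> {..<b}"
    have "\<forall>p\<in>?I. c p = 0" if "(\<Sum>p\<in>?I. scale (c p) (?w p)) = 0" for c
      using units_family_independent[of "{..<b}" u c] u0 indu that by auto
    from dim_span_family(3)[of ?I ?w, OF _ this]
    have "dim (span (?w ` ?I)) = n * b" by simp
    moreover have "v \<in> span (?w ` ?I)" for v
    proof -
      have "v = (\<Sum>i<n. E i 0 (\<Sum>k<b. scale (co k (E 0 i v)) (u k)))"
        by (simp add: expand EU decompose)
      also have "\<dots> = (\<Sum>i<n. \<Sum>k<b. scale (co k (E 0 i v)) (?w (i, k)))"
        using pos by (simp add: lin_sum[OF E_lin] lin_scale[OF E_lin])
      also have "\<dots> \<in> span (?w ` ?I)"
        by (intro span_sum span_scale span_base imageI) auto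
      finally show ?thesis .
    qed
    ultimately show ?thesis
      by (metis UNIV_eq_I)
  qed
  have linF: "Vector_Spaces.linear scale scale (F k l)" for k l
    using pos by (intro linearI)
      (simp_all add: F_def lin_add[OF E_lin] lin_scale[OF E_lin] co_add co_scale EU scale_left_distrib
        sum.distrib scale_sum_right mult.commute)
  have EF: "E 0 i (F k l v) = scale (co l (E 0 i v)) (u k)" if "i < n" "k < b" for i k l v
  proof -
    have "E 0 i (F k l v) = (\<Sum>j<n. if j = i then scale (co l (E 0 i v)) (u k) else 0)"
      unfolding F_def lin_sum[OF E_lin[OF pos that(1)]] using pos that u0
      by (intro sum.cong) (auto simp: E_mult lin_scale[OF E_lin])
    then show ?thesis
      using that by simp
  qed
  have "F k l (E i j v) = E i j (F k l v)" if k: "k < b" and ij: "i < n" "j < n" for k l i j v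
  proof -
    have "F k l (E i j v) = (\<Sum>p<n. if p = i then E i 0 (scale (co l (E 0 j v)) (u k)) else 0)"
      unfolding F_def using pos ij by (intro sum.cong) (auto simp: E_mult co_zero lin_zero[OF E_lin])
    also have "\<dots> = E i 0 (E 0 j (F k l v))"
      using ij k by (simp add: EF)
    also have "\<dots> = E i j (F k l v)"
      using pos ij by (simp add: E_mult)
    finally show ?thesis .
  qed
  then have F_in: "F k l \<in> End_over scale R" if "k < b" for k l
    using commute_with_units[OF linF] that by blast
  have F_mult: "F k l (F k' l' v) = (if l = k' then F k l' v else 0)"
    if "k < b" "l < b" "k' < b" "l' < b" for k l k' l' v
  proof -
    have "F k l (F k' l' v) = (\<Sum>i<n. E i 0 (scale (co l (E 0 i (F k' l' v))) (u k)))"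
      by (rule F_def)
    also have "\<dots> = (\<Sum>i<n. E i 0 (scale (if l = k' then co l' (E 0 i v) else 0) (u k)))"
      using that uU by (intro sum.cong) (auto simp: EF co_scale co_u)
    also have "\<dots> = (if l = k' then F k l' v else 0)"
      using pos by (simp add: F_def lin_zero[OF E_lin])
    finally show ?thesis .
  qed
  have F_sum: "(\<Sum>k<b. F k k v) = v" for v
  proof -
    have "(\<Sum>k<b. F k k v) = (\<Sum>i<n. E i 0 (\<Sum>k<b. scale (co k (E 0 i v)) (u k)))"
      unfolding F_def using pos by (subst sum.swap) (simp add: lin_sum[OF E_lin])
    also have "\<dots> = v"
      by (simp add: expand EU decompose)
    finally show ?thesis .
  qed
  have "matrix_units scale Basis (End_over scale R) b F"
  proof unfold_locales
    show "operator_algebra (End_over scale R)"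
      by (rule operator_algebra_End_over[OF alg])
    show "b > 0" by (rule bpos)
    show "F i j \<in> End_over scale R" if "i < b" "j < b" for i j
      using F_in that by blast
    show "F i j (F k l v) = (if j = k then F i l v else 0)" if "i < b" "j < b" "k < b" "l < b" for i j k l v
      using F_mult that by blast
    show "(\<Sum>i<b. F i i v) = v" for v
      by (rule F_sum)
    show "(UNIV :: 'b set) \<noteq> {0}" by (rule nonzero)
    fix f assume f: "f \<in> End_over scale R"
    have lf: "Vector_Spaces.linear scale scale f"
      using f by (simp add: End_over_def)
    have fE: "f (E i j v) = E i j (f v)" if "i < n" "j < n" for i j v
      using f E_in[OF that] by (simp add: End_over_def fun_eq_iff)
    have fU: "f v \<in> U" if "v \<in> U" for v
      using that fE[OF pos pos, of v] by (simp add: U_def)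
    define M where "M k l = co k (f (u l))" for k l
    \<comment> \<open>\<open>f\<close> commutes with the units of \<open>R\<close>, so it preserves
      the image of \<open>E 0 0\<close> and acts on every block by the same matrix
      \<open>M\<close>.\<close>
    have "f v = (\<Sum>k<b. \<Sum>l<b. scale (M k l) (F k l v))" for v
    proof -
      have "f v = f (\<Sum>i<n. E i 0 (\<Sum>l<b. scale (co l (E 0 i v)) (u l)))"
        by (simp add: expand EU decompose)
      also have "\<dots> = (\<Sum>i<n. E i 0 (\<Sum>l<b. scale (co l (E 0 i v)) (f (u l))))"
        using pos by (simp add: lin_sum[OF lf] lin_scale[OF lf] fE)
      also have "\<dots> = (\<Sum>i<n. E i 0 (\<Sum>l<b. scale (co l (E 0 i v)) (\<Sum>k<b. scale (M k l) (u k))))"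
        using uU fU by (simp add: M_def expand)
      also have "\<dots> = (\<Sum>i<n. \<Sum>k<b. \<Sum>l<b. scale (M k l) (E i 0 (scale (co l (E 0 i v)) (u k))))"
        using pos
        by (intro sum.cong refl, subst sum.swap)
          (simp add: lin_sum[OF E_lin] lin_scale[OF E_lin] scale_sum_right mult.commute)
      also have "\<dots> = (\<Sum>k<b. \<Sum>l<b. \<Sum>i<n. scale (M k l) (E i 0 (scale (co l (E 0 i v)) (u k))))"
        by (rule trans[OF sum.swap], rule sum.cong[OF refl], rule sum.swap)
      also have "\<dots> = (\<Sum>k<b. \<Sum>l<b. scale (M k l) (F k l v))"
        by (simp add: F_def scale_sum_right)
      finally show ?thesis .
    qed
    then show "\<exists>M. \<forall>v. f v = (\<Sum>k<b. \<Sum>l<b. scale (M k l) (F k l v))"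
      by blast
  qed
  moreover have "u 0 \<noteq> 0"
    using uB[OF bpos] B(2) dependent_zero by metis
  moreover have "range (F 0 0) = {x (u 0) |x. x \<in> R}"
  proof (intro equalityI subsetI)
    fix y assume "y \<in> range (F 0 0)"
    then obtain v where "y = F 0 0 v" by blast
    then have y: "y = (\<Sum>i<n. scale (co 0 (E 0 i v)) (E i 0 (u 0)))"
      using pos by (simp add: F_def lin_scale[OF E_lin])
    have "(\<lambda>w. \<Sum>i<n. scale (co 0 (E 0 i v)) (E i 0 w)) \<in> R"
      using pos E_in operator_algebraD(5)[OF alg] by (intro operator_algebra_sum[OF alg]) auto
    then show "y \<in> {x (u 0) |x. x \<in> R}"
      unfolding mem_Collect_eq using y
      by (intro exI[of _ "\<lambda>w. \<Sum>i<n. scale (co 0 (E 0 i v)) (E i 0 w)"] conjI)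
  next
    fix y assume "y \<in> {x (u 0) |x. x \<in> R}"
    then obtain x where x: "x \<in> R" "y = x (u 0)" by blast
    have "F 0 0 (u 0) = (\<Sum>i<n. if i = 0 then u 0 else 0)"
      unfolding F_def using pos bpos u0 by (intro sum.cong) (auto simp: Eu co_u co_zero lin_zero[OF E_lin])
    then have "F 0 0 (u 0) = u 0"
      using pos by simp
    moreover have "F 0 0 (x (u 0)) = x (F 0 0 (u 0))"
      using F_in[OF bpos] x(1) by (simp add: End_over_def fun_eq_iff)
    ultimately show "y \<in> range (F 0 0)"
      using x(2) by (metis rangeI)
  qed
  ultimately show ?thesis
    using dimV u0[OF bpos] by blast
qed

text \<open>The idempotents \<open>F k k\<close> split \<open>V\<close>, and \<open>F 0 k\<close>
  identifies each summand with the image of \<open>F 0 0\<close>. These maps are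
  \<open>R\<close>-linear because the \<open>F i j\<close> commute with \<open>R\<close>.\<close>

lemma iso_copies_commutant:
  assumes "matrix_units scale Basis (End_over scale R) b F"
  shows "iso_copies scale R b (range (F 0 0))"
proof -
  interpret F: matrix_units scale Basis "End_over scale R" b F by fact
  have comm: "F i j (x v) = x (F i j v)" if "i < b" "j < b" "x \<in> R" for i j x v
    using F.E_in[OF that(1,2)] that(3) by (simp add: End_over_def fun_eq_iff)
  define f where "f v = restrict (\<lambda>k. F 0 k v) {..<b}" for v
  have "bij_betw f UNIV ({..<b} \<rightarrow>\<^sub>E range (F 0 0))"
  proof (rule bij_betwI[where g = "\<lambda>w. \<Sum>k<b. F k 0 (w k)"])
    show "f \<in> UNIV \<rightarrow> ({..<b} \<rightarrow>\<^sub>E range (F 0 0))"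
    proof
      fix v
      have "F 0 k v \<in> range (F 0 0)" if "k < b" for k
        using F.E_mult[OF F.pos F.pos F.pos that, of v] by (metis rangeI)
      then show "f v \<in> {..<b} \<rightarrow>\<^sub>E range (F 0 0)"
        by (auto simp: f_def)
    qed
    show "(\<Sum>k<b. F k 0 (f v k)) = v" for v
      using F.decompose[of v] by (simp add: f_def)
    show "f (\<Sum>k<b. F k 0 (w k)) = w" if w: "w \<in> {..<b} \<rightarrow>\<^sub>E range (F 0 0)" for w
    proof (rule extensionalityI[of _ "{..<b}"])
      show "f (\<Sum>k<b. F k 0 (w k)) \<in> extensional {..<b}"
        by (simp add: f_def)
      show "w \<in> extensional {..<b}"
        using w by (simp add: PiE_def)
      fix l assume l: "l \<in> {..<b}"
      have Fw: "F 0 0 (w l) = w l"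
      proof -
        obtain v where "w l = F 0 0 v"
          using w l by (auto simp: PiE_iff)
        then show ?thesis
          using F.pos by (simp add: F.E_mult)
      qed
      have "F 0 l (\<Sum>k<b. F k 0 (w k)) = (\<Sum>k<b. if k = l then F 0 0 (w l) else 0)"
        using l F.pos by (auto simp: lin_sum[OF F.E_lin] F.E_mult intro!: sum.cong)
      then show "f (\<Sum>k<b. F k 0 (w k)) l = w l"
        using l Fw by (simp add: f_def)
    qed
  qed auto
  then show ?thesis
    unfolding iso_copies_def using F.E_lin[OF F.pos] comm[OF F.pos]
    by (intro exI[of _ f]) (auto simp: f_def lin_add lin_scale)
qed

end

section \<open>Isomorphism with matrices and the Skolem-Noether theorem\<close>

lemma Mat_ring: "ring (Mat n :: ('f::field, 'f mat) module)"
proof (rule ringI)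
  show "abelian_group (Mat n :: ('f, 'f mat) module)"
    by (rule abelian_group_mat)
  show "monoid (Mat n :: ('f, 'f mat) module)"
    by (rule monoidI) (auto simp: module_mat_simps)
qed (auto simp: module_mat_simps add_mult_distrib_mat mult_add_distrib_mat)

lemma Mat_F_algebra: "F_algebra (Mat n :: ('f::field, 'f mat) module)"
proof -
  have "Module.module class_ring (Mat n :: ('f, 'f mat) module)"
  proof (rule module.intro)
    show "cring (class_ring :: 'f ring)"
      by (rule class_cring.cring_axioms)
    show "abelian_group (Mat n :: ('f, 'f mat) module)"
      by (rule abelian_group_mat)
    show "module_axioms class_ring (Mat n :: ('f, 'f mat) module)"
      by unfold_locales
        (auto simp: module_mat_simps class_ring_simps add_smult_distrib_right_mat add_smult_distrib_left_mat
          smult_smult_mat one_smult_mat)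
  qed
  then show ?thesis
    using Mat_ring by (auto simp: F_algebra_def module_mat_simps)
qed

lemma alg_iso_inv_into:
  assumes A: "F_algebra A" and f: "f \<in> alg_iso A B"
  shows "inv_into (carrier A) f \<in> alg_iso B A"
proof -
  note fD = alg_isoD[OF f]
  have surj: "f ` carrier A = carrier B"
    using fD(3) by (simp add: bij_betw_def)
  have "inv_into (carrier A) f (c \<odot>\<^bsub>B\<^esub> y) = c \<odot>\<^bsub>A\<^esub> inv_into (carrier A) f y" if y: "y \<in> carrier B" for c y
  proof -
    obtain x where x: "x \<in> carrier A" "y = f x"
      using y surj by auto
    have "c \<odot>\<^bsub>B\<^esub> y = f (c \<odot>\<^bsub>A\<^esub> x)"
      using fD(9) x by simp
    then show ?thesis
      using x F_algebraD(3)[OF A x(1)] fD(4) by simp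
  qed
  then show ?thesis
    using ring_iso_set_sym[OF F_algebraD(1)[OF A] fD(1)] by (simp add: alg_iso_def)
qed

context operator_space begin

lemma op_alg_iso_sum:
  assumes R: "operator_algebra R" and S: "operator_algebra S" and f: "f \<in> alg_iso (op_alg scale R) (op_alg scale S)"
    and "finite A" "\<And>i. i \<in> A \<Longrightarrow> h i \<in> R"
  shows "f (\<lambda>v. \<Sum>i\<in>A. h i v) = (\<lambda>v. \<Sum>i\<in>A. f (h i) v)"
  using assms(4,5)
proof (induction A)
  case empty
  have "f (\<lambda>v. scale 0 (id v)) = (\<lambda>v. scale 0 (f id v))"
    using alg_isoD(9)[OF f, of id 0] operator_algebraD(2)[OF R] by simp
  then show ?case by simp
next
  case (insert i A)
  have "(\<lambda>v. \<Sum>i\<in>A. h i v) \<in> R"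
    using insert by (intro operator_algebra_sum[OF R]) auto
  then show ?case
    using insert alg_isoD(7)[OF f, of "h i" "\<lambda>v. \<Sum>i\<in>A. h i v"] by simp
qed

end

context matrix_units begin

lemma E_nonzero: "\<exists>v. E 0 0 v \<noteq> 0"
proof -
  obtain w :: 'b where "w \<noteq> 0"
    using nonzero by auto
  then obtain i where "i < n" "E 0 i w \<noteq> 0"
    using nonzero_component by blast
  then show ?thesis
    using pos by (intro exI[of _ "E 0 i w"]) (simp add: E_mult)
qed

text \<open>Every entry is read after transport to position \<open>(0, 0)\<close>, so all are
  compared with the one nonzero operator \<open>E 0 0\<close>; this makes the chosen scalar
  unique.\<close>

definition coeff :: "('b \<Rightarrow> 'b) \<Rightarrow> nat \<Rightarrow> nat \<Rightarrow> 'a" where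
  "coeff x i j = (SOME c. \<forall>v. E 0 i (x (E j 0 v)) = scale c (E 0 0 v))"

lemma coeff: "x \<in> R \<Longrightarrow> i < n \<Longrightarrow> j < n \<Longrightarrow> E 0 i (x (E j 0 v)) = scale (coeff x i j) (E 0 0 v)"
  unfolding coeff_def using someI_ex[OF corner_scalar[of x i j 0 0]] pos by blast

lemma coeff_eqI:
  assumes "\<And>v. E 0 i (x (E j 0 v)) = scale c (E 0 0 v)"
  shows "coeff x i j = c"
proof -
  obtain w where w: "E 0 0 w \<noteq> 0"
    using E_nonzero by blast
  have "\<forall>v. E 0 i (x (E j 0 v)) = scale (coeff x i j) (E 0 0 v)"
    unfolding coeff_def by (rule someI[of _ c]) (use assms in blast)
  then have "scale (coeff x i j) (E 0 0 w) = scale c (E 0 0 w)"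
    using assms by metis
  then show ?thesis
    using w by simp
qed

lemma coeff_expand:
  assumes x: "x \<in> R"
  shows "x v = (\<Sum>i<n. \<Sum>j<n. scale (coeff x i j) (E i j v))"
proof -
  obtain M where M: "\<forall>v. x v = (\<Sum>k<n. \<Sum>l<n. scale (M k l) (E k l v))"
    using E_span[OF x] by blast
  have "coeff x i j = M i j" if "i < n" "j < n" for i j
    using that pos corner_coefficient[of x M i j 0 0] M by (intro coeff_eqI) auto
  then show ?thesis
    using M by simp
qed

theorem iso_Mat: "(\<lambda>x. mat n n (\<lambda>(i, j). coeff x i j)) \<in> alg_iso (op_alg scale R) (Mat n)"
proof -
  let ?\<phi> = "\<lambda>x. mat n n (\<lambda>(i, j). coeff x i j)"
  have "bij_betw ?\<phi> R (carrier_mat n n)"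
  proof (rule bij_betwI[where g = "\<lambda>M v. \<Sum>i<n. \<Sum>j<n. scale (M $$ (i, j)) (E i j v)"])
    have row: "(\<lambda>v. \<Sum>j<n. scale (M $$ (i, j)) (E i j v)) \<in> R" if "i < n" for M i
      using that E_in operator_algebraD(5)[OF alg] by (intro operator_algebra_sum[OF alg]) auto
    show "(\<lambda>M v. \<Sum>i<n. \<Sum>j<n. scale (M $$ (i, j)) (E i j v)) \<in> carrier_mat n n \<rightarrow> R"
    proof
      fix M :: "'a mat"
      show "(\<lambda>v. \<Sum>i<n. \<Sum>j<n. scale (M $$ (i, j)) (E i j v)) \<in> R"
        by (rule operator_algebra_sum[OF alg finite_lessThan row]) simp
    qed
    show "(\<lambda>v. \<Sum>i<n. \<Sum>j<n. scale (?\<phi> x $$ (i, j)) (E i j v)) = x" if "x \<in> R" for x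
      using coeff_expand[OF that] by (auto simp: fun_eq_iff)
    show "?\<phi> (\<lambda>v. \<Sum>i<n. \<Sum>j<n. scale (M $$ (i, j)) (E i j v)) = M" if "M \<in> carrier_mat n n" for M
      using that pos by (intro eq_matI) (auto intro!: coeff_eqI corner_coefficient)
  qed auto
  moreover have "?\<phi> (x \<circ> y) = ?\<phi> x * ?\<phi> y" if x: "x \<in> R" and y: "y \<in> R" for x y
  proof (rule eq_matI)
    fix i j assume "i < dim_row (?\<phi> x * ?\<phi> y)" "j < dim_col (?\<phi> x * ?\<phi> y)"
    then have ij: "i < n" "j < n" by auto
    have "coeff (x \<circ> y) i j = (\<Sum>k<n. coeff x i k * coeff y k j)"
    proof (rule coeff_eqI)
      fix v
      \<comment> \<open>Inserting the resolution of the identity between \<open>x\<close> and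
        \<open>y\<close> produces the sum over \<open>k\<close> of the matrix product.\<close>
      have "E 0 i (x (y (E j 0 v))) = E 0 i (x (\<Sum>k<n. E k 0 (E 0 k (y (E j 0 v)))))"
        by (simp only: decompose)
      also have "\<dots> = (\<Sum>k<n. E 0 i (x (E k 0 (E 0 k (y (E j 0 v))))))"
        using pos ij by (simp add: lin_sum[OF lin[OF x]] lin_sum[OF E_lin])
      also have "\<dots> = (\<Sum>k<n. scale (coeff x i k) (scale (coeff y k j) (E 0 0 v)))"
        using pos ij x y by (intro sum.cong) (auto simp: coeff lin_scale[OF E_lin] lin_scale[OF lin[OF x]] E_mult)
      also have "\<dots> = scale (\<Sum>k<n. coeff x i k * coeff y k j) (E 0 0 v)"
        by (simp add: scale_sum_left)
      finally show "E 0 i ((x \<circ> y) (E j 0 v)) = scale (\<Sum>k<n. coeff x i k * coeff y k j) (E 0 0 v)"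
        by simp
    qed
    then show "?\<phi> (x \<circ> y) $$ (i, j) = (?\<phi> x * ?\<phi> y) $$ (i, j)"
      using ij by (simp add: scalar_prod_def atLeast0LessThan)
  qed auto
  moreover have "?\<phi> (\<lambda>v. x v + y v) = ?\<phi> x + ?\<phi> y" if "x \<in> R" "y \<in> R" for x y
    using that pos
    by (intro eq_matI) (auto intro!: coeff_eqI simp: coeff lin_add[OF E_lin] scale_left_distrib)
  moreover have "?\<phi> (\<lambda>v. scale c (x v)) = c \<cdot>\<^sub>m ?\<phi> x" if "x \<in> R" for x c
    using that pos
    by (intro eq_matI) (auto intro!: coeff_eqI simp: coeff lin_scale[OF E_lin])
  moreover have "?\<phi> id = 1\<^sub>m n"
    using pos by (intro eq_matI) (auto intro!: coeff_eqI simp: E_mult)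
  ultimately show ?thesis
    by (auto simp: alg_iso_def ring_iso_def Ring.ring_hom_def module_mat_simps bij_betw_def)
qed

text \<open>An automorphism carries the matrix units \<open>E\<close> to a second system
  \<open>E'\<close>; a unit intertwining the two systems implements it by conjugation. The
  intertwiner and its inverse are written down explicitly.\<close>

theorem skolem_noether:
  assumes f: "f \<in> alg_iso (op_alg scale R) (op_alg scale R)"
  shows "\<exists>u\<in>R. \<exists>t\<in>R. u \<circ> t = id \<and> t \<circ> u = id \<and> (\<forall>x\<in>R. f x = u \<circ> x \<circ> t)"
proof -
  note fD = alg_isoD[OF f]
  define E' where "E' i j = f (E i j)" for i j
  have E'_in: "E' i j \<in> R" if "i < n" "j < n" for i j
    using fD(5)[of "E i j"] E_in[OF that] by (simp add: E'_def)
  have E'_lin: "Vector_Spaces.linear scale scale (E' i j)" if "i < n" "j < n" for i j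
    using lin[OF E'_in[OF that]] .
  have f0: "f (\<lambda>_. 0) = (\<lambda>_. 0)"
    using op_alg_iso_sum[OF alg alg f, of "{}" "\<lambda>_. id"] by simp
  have E'_mult: "E' i j (E' k l v) = (if j = k then E' i l v else 0)"
    if "i < n" "j < n" "k < n" "l < n" for i j k l v
  proof -
    have "E i j \<circ> E k l = (if j = k then E i l else (\<lambda>_. 0))"
      using E_mult[OF that] by (auto simp: fun_eq_iff)
    then have "E' i j \<circ> E' k l = f (if j = k then E i l else (\<lambda>_. 0))"
      using fD(6)[of "E i j" "E k l"] E_in that by (simp add: E'_def)
    then show ?thesis
      using f0 by (auto simp: fun_eq_iff E'_def)
  qed
  have E'0: "E' 0 0 \<noteq> (\<lambda>_. 0)"
  proof
    assume "E' 0 0 = (\<lambda>_. 0)"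
    then have "f (E 0 0) = f (\<lambda>_. 0)"
      using f0 by (simp add: E'_def)
    then have "E 0 0 = (\<lambda>_. 0)"
      using inj_onD[OF fD(4)] E_in[OF pos pos] operator_algebraD(6)[OF alg] by simp
    then show False
      using E_nonzero by simp
  qed
  \<comment> \<open>A nonzero entry of \<open>E' 0 0\<close> fixes the indices in \<open>u\<close>
    and \<open>w\<close>, and is the scalar by which \<open>w u\<close> acts.\<close>
  obtain i j where ij: "i < n" "j < n" and c: "coeff (E' 0 0) i j \<noteq> 0"
  proof (rule ccontr)
    assume "\<not> thesis"
    then have "\<And>i j. i < n \<Longrightarrow> j < n \<Longrightarrow> coeff (E' 0 0) i j = 0"
      using that by blast
    then have "E' 0 0 v = 0" for v
      using coeff_expand[OF E'_in[OF pos pos], of v] by simp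
    then show False
      using E'0 by auto
  qed
  define c where "c = coeff (E' 0 0) i j"
  \<comment> \<open>Matrix unit rules give \<open>u (E p q) = (E' p q) u\<close> for every
    \<open>j\<close>; the choice of \<open>j\<close> serves to make \<open>u\<close>
    invertible.\<close>
  define u where "u v = (\<Sum>k<n. E' k 0 (E j k v))" for v
  define w where "w v = (\<Sum>k<n. E k i (E' 0 k v))" for v
  have comp: "x \<circ> y \<in> R" if "x \<in> R" "y \<in> R" for x y
    using operator_algebraD(4)[OF alg that] .
  have uR: "u \<in> R"
    unfolding u_def[abs_def]
    using operator_algebra_sum[OF alg finite_lessThan, of n "\<lambda>k. E' k 0 \<circ> E j k"] comp E'_in E_in pos ij by simp
  have wR: "w \<in> R"
    unfolding w_def[abs_def]
    using operator_algebra_sum[OF alg finite_lessThan, of n "\<lambda>k. E k i \<circ> E' 0 k"] comp E'_in E_in pos ij by simp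
  have wu: "w (u v) = scale c v" for v
  proof -
    have "E' 0 k (u v) = E' 0 0 (E j k v)" if k: "k < n" for k
    proof -
      have "E' 0 k (u v) = (\<Sum>l<n. if l = k then E' 0 0 (E j k v) else 0)"
        unfolding u_def lin_sum[OF E'_lin[OF pos k]] using pos k by (intro sum.cong) (auto simp: E'_mult)
      then show ?thesis
        using k by simp
    qed
    then have "w (u v) = (\<Sum>k<n. E k 0 (E 0 i (E' 0 0 (E j k v))))"
      unfolding w_def using pos ij by (intro sum.cong) (auto simp: E_mult)
    also have "\<dots> = (\<Sum>k<n. scale c (E k 0 (E 0 k v)))"
    proof (intro sum.cong refl)
      fix k assume "k \<in> {..<n}"
      then have k: "k < n" by simp
      have "E 0 i (E' 0 0 (E j k v)) = scale c (E 0 k v)"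
        using coeff[OF E'_in[OF pos pos] ij, of "E 0 k v"] pos ij k by (simp add: E_mult c_def)
      then show "E k 0 (E 0 i (E' 0 0 (E j k v))) = scale c (E k 0 (E 0 k v))"
        using lin_scale[OF E_lin[OF k pos]] by simp
    qed
    also have "\<dots> = scale c v"
      by (simp only: scale_sum_right[symmetric] decompose)
    finally show ?thesis .
  qed
  have uE: "u (E p q v) = E' p q (u v)" if pq: "p < n" "q < n" for p q v
  proof -
    have "u (E p q v) = (\<Sum>k<n. if k = p then E' p 0 (E j q v) else 0)"
      unfolding u_def using pos ij pq by (intro sum.cong) (auto simp: E_mult lin_zero[OF E'_lin])
    moreover have "E' p q (u v) = (\<Sum>k<n. if k = q then E' p 0 (E j q v) else 0)"
      unfolding u_def lin_sum[OF E'_lin[OF pq]] using pos pq by (intro sum.cong) (auto simp: E'_mult)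
    ultimately show ?thesis
      using pq by simp
  qed
  define t where "t v = scale (inverse c) (w v)" for v
  have tR: "t \<in> R"
    unfolding t_def[abs_def] by (rule operator_algebraD(5)[OF alg wR])
  have cn: "c \<noteq> 0"
    using c by (simp add: c_def)
  have tu: "t (u v) = v" for v
    using cn by (simp add: t_def wu)
  have "inj u"
    by (metis injI tu)
  \<comment> \<open>Finite dimension turns the left inverse \<open>t\<close> into a two-sided
    one.\<close>
  then have "surj u"
    by (rule linear_inj_imp_surj[OF lin[OF uR]])
  then have ut: "u (t v) = v" for v
    by (metis surjD tu)
  have "f x = u \<circ> x \<circ> t" if x: "x \<in> R" for x
  proof -
    have x_eq: "x = (\<lambda>v. \<Sum>p<n. \<Sum>q<n. scale (coeff x p q) (E p q v))"
      using coeff_expand[OF x] by auto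
    have q: "(\<lambda>v. scale (coeff x p q) (E p q v)) \<in> R" if "p < n" "q < n" for p q
      using E_in[OF that] operator_algebraD(5)[OF alg] by auto
    have p: "(\<lambda>v. \<Sum>q<n. scale (coeff x p q) (E p q v)) \<in> R" if "p < n" for p
      using q that by (intro operator_algebra_sum[OF alg]) auto
    have "f x = (\<lambda>v. \<Sum>p<n. f (\<lambda>v. \<Sum>q<n. scale (coeff x p q) (E p q v)) v)"
      by (subst x_eq, rule op_alg_iso_sum[OF alg alg f]) (use p in auto)
    also have "\<dots> = (\<lambda>v. \<Sum>p<n. \<Sum>q<n. scale (coeff x p q) (E' p q v))"
    proof (intro ext sum.cong refl)
      fix v p assume "p \<in> {..<n}"
      then have pn: "p < n" by simp
      have "f (\<lambda>v. \<Sum>q<n. scale (coeff x p q) (E p q v)) = (\<lambda>v. \<Sum>q<n. f (\<lambda>v. scale (coeff x p q) (E p q v)) v)"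
        by (rule op_alg_iso_sum[OF alg alg f]) (use q pn in auto)
      also have "\<dots> = (\<lambda>v. \<Sum>q<n. scale (coeff x p q) (E' p q v))"
        using fD(9) E_in pn by (intro ext sum.cong refl) (simp add: E'_def)
      finally show "f (\<lambda>v. \<Sum>q<n. scale (coeff x p q) (E p q v)) v = (\<Sum>q<n. scale (coeff x p q) (E' p q v))"
        by simp
    qed
    finally have fx: "f x = (\<lambda>v. \<Sum>p<n. \<Sum>q<n. scale (coeff x p q) (E' p q v))" .
    have fxu: "f x (u v) = u (x v)" for v
    proof -
      have "f x (u v) = (\<Sum>p<n. \<Sum>q<n. scale (coeff x p q) (E' p q (u v)))"
        by (rule fun_cong[OF fx])
      also have "\<dots> = (\<Sum>p<n. \<Sum>q<n. scale (coeff x p q) (u (E p q v)))"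
        by (intro sum.cong refl) (simp add: uE)
      also have "\<dots> = u (\<Sum>p<n. \<Sum>q<n. scale (coeff x p q) (E p q v))"
        by (simp only: lin_sum[OF lin[OF uR]] lin_scale[OF lin[OF uR]])
      also have "\<dots> = u (x v)"
        by (rule arg_cong[where f = u, OF coeff_expand[OF x, symmetric]])
      finally show ?thesis .
    qed
    have "f x v = u (x (t v))" for v
      using fxu[of "t v"] ut by simp
    then show ?thesis
      by auto
  qed
  then show ?thesis
    using uR tR ut tu by (intro bexI[of _ u] bexI[of _ t]) (auto simp: fun_eq_iff)
qed

end

section \<open>Projective unit groups\<close>

text \<open>The coset of \<open>u\<close> in the projective unit group, freed from
  \<open>units_of\<close> and \<open>r_coset\<close>.\<close>

definition line :: "('f::field, 'a) module \<Rightarrow> 'a \<Rightarrow> 'a set" where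
  "line A u = {c \<odot>\<^bsub>A\<^esub> u |c. c \<noteq> 0}"

locale F_alg = ring A for A :: "('f::field, 'a) module" (structure) +
  assumes F_algebra: "F_algebra A"
begin

sublocale mod: Module.module class_ring A
  by (rule F_algebraD[OF F_algebra])

lemma smult_closed: "x \<in> carrier A \<Longrightarrow> c \<odot> x \<in> carrier A"
  by (rule F_algebraD[OF F_algebra])

lemma smult_mult_left: "x \<in> carrier A \<Longrightarrow> y \<in> carrier A \<Longrightarrow> (c \<odot> x) \<otimes> y = c \<odot> (x \<otimes> y)"
  by (rule F_algebraD[OF F_algebra])

lemma smult_mult_right: "x \<in> carrier A \<Longrightarrow> y \<in> carrier A \<Longrightarrow> x \<otimes> (c \<odot> y) = c \<odot> (x \<otimes> y)"
  by (rule F_algebraD[OF F_algebra])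

lemma smult_smult: "x \<in> carrier A \<Longrightarrow> c \<odot> (d \<odot> x) = (c * d) \<odot> x"
  using mod.smult_assoc1[of c d x] by (simp add: class_ring_simps)

lemma smult_1: "x \<in> carrier A \<Longrightarrow> 1 \<odot> x = x"
  using mod.smult_one[of x] by (simp add: class_ring_simps)

lemma smult_Units:
  assumes u: "u \<in> Units A" and c: "c \<noteq> 0"
  shows "c \<odot> u \<in> Units A" "inv (c \<odot> u) = inverse c \<odot> inv u"
proof -
  have uc: "u \<in> carrier A" "inv u \<in> carrier A"
    using u by auto
  have 1: "(c \<odot> u) \<otimes> (inverse c \<odot> inv u) = \<one>" "(inverse c \<odot> inv u) \<otimes> (c \<odot> u) = \<one>"
    using u uc c by (auto simp: smult_mult_left smult_mult_right smult_closed smult_smult smult_1)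
  then show "c \<odot> u \<in> Units A"
    unfolding Units_def using uc smult_closed by blast
  show "inv (c \<odot> u) = inverse c \<odot> inv u"
    using 1 uc smult_closed by (intro inv_char) auto
qed

lemma line_self: "u \<in> carrier A \<Longrightarrow> u \<in> line A u"
  unfolding line_def using smult_1[of u] by (metis (mono_tags, lifting) mem_Collect_eq zero_neq_one)

lemma rcoset_line: "u \<in> carrier A \<Longrightarrow> scalar_units A #>\<^bsub>units_of A\<^esub> u = line A u"
  by (auto simp: r_coset_def scalar_units_def line_def units_of_def smult_mult_left)

lemma line_subset_Units: "u \<in> Units A \<Longrightarrow> line A u \<subseteq> Units A"
  using smult_Units by (auto simp: line_def)

lemma scalar_units_normal: "scalar_units A \<lhd> units_of A"
proof -
  interpret U: group "units_of A" by (rule units_group)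
  have su: "scalar_units A = line A \<one>"
    by (simp add: scalar_units_def line_def)
  have sub: "subgroup (scalar_units A) (units_of A)"
  proof (rule U.subgroupI)
    show "scalar_units A \<subseteq> carrier (units_of A)"
      unfolding su units_of_def using line_subset_Units[of \<one>] by simp
    show "scalar_units A \<noteq> {}"
      unfolding su using line_self[of \<one>] by auto
    fix a assume "a \<in> scalar_units A"
    then obtain c where c: "a = c \<odot> \<one>" "c \<noteq> 0"
      by (auto simp: scalar_units_def)
    have "inv\<^bsub>units_of A\<^esub> a = inverse c \<odot> \<one>"
      using c smult_Units[of \<one> c] by (simp add: units_of_inv)
    then show "inv\<^bsub>units_of A\<^esub> a \<in> scalar_units A"
      using c(2) unfolding scalar_units_def by (intro CollectI exI[of _ "inverse c"]) simp
    fix b assume "b \<in> scalar_units A"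
    then obtain d where d: "b = d \<odot> \<one>" "d \<noteq> 0"
      by (auto simp: scalar_units_def)
    have "a \<otimes>\<^bsub>units_of A\<^esub> b = (c * d) \<odot> \<one>"
      using c d by (simp add: units_of_def smult_mult_left smult_closed smult_smult)
    then show "a \<otimes>\<^bsub>units_of A\<^esub> b \<in> scalar_units A"
      using c(2) d(2) unfolding scalar_units_def by (intro CollectI exI[of _ "c * d"]) simp
  qed
  show ?thesis
  proof (rule U.normal_invI[OF sub])
    fix x h assume x: "x \<in> carrier (units_of A)" and "h \<in> scalar_units A"
    then obtain c where c: "h = c \<odot> \<one>" "c \<noteq> 0"
      by (auto simp: scalar_units_def)
    have xU: "x \<in> Units A"
      using x by (simp add: units_of_def)
    have "x \<otimes>\<^bsub>units_of A\<^esub> h \<otimes>\<^bsub>units_of A\<^esub> inv\<^bsub>units_of A\<^esub> x = h"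
    proof -
      have i: "inv\<^bsub>units_of A\<^esub> x = inv x"
        by (rule units_of_inv[OF xU])
      have m: "a \<otimes>\<^bsub>units_of A\<^esub> b = a \<otimes> b" for a b
        by (simp add: units_of_def)
      show ?thesis
        unfolding i m c using xU Units_closed[OF xU] Units_inv_closed[OF xU]
        by (simp add: smult_mult_left smult_mult_right)
    qed
    then show "x \<otimes>\<^bsub>units_of A\<^esub> h \<otimes>\<^bsub>units_of A\<^esub> inv\<^bsub>units_of A\<^esub> x \<in> scalar_units A"
      using \<open>h \<in> scalar_units A\<close> by simp
  qed
qed

lemma proj_units_group: "group (proj_units A)"
  unfolding proj_units_def by (rule normal.factorgroup_is_group[OF scalar_units_normal])

lemma proj_units_carrier: "carrier (proj_units A) = line A ` Units A"
proof -
  have "carrier (proj_units A) = (\<lambda>u. scalar_units A #>\<^bsub>units_of A\<^esub> u) ` Units A"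
    by (auto simp: proj_units_def FactGroup_def RCOSETS_def units_of_def)
  also have "\<dots> = line A ` Units A"
    using rcoset_line by (intro image_cong) auto
  finally show ?thesis .
qed

lemma proj_units_mult:
  assumes "u \<in> Units A" "w \<in> Units A"
  shows "line A u \<otimes>\<^bsub>proj_units A\<^esub> line A w = line A (u \<otimes> w)"
proof -
  have c: "u \<in> carrier (units_of A)" "w \<in> carrier (units_of A)"
    using assms by (simp_all add: units_of_def)
  have m: "u \<otimes>\<^bsub>units_of A\<^esub> w = u \<otimes> w"
    by (simp add: units_of_def)
  have l: "u \<in> carrier A" "w \<in> carrier A" "u \<otimes> w \<in> carrier A"
    using assms by auto
  show ?thesis
    using normal.rcos_sum[OF scalar_units_normal c]
    unfolding m proj_units_def mult_FactGroup l[THEN rcoset_line] .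
qed

lemma proj_units_one: "\<one>\<^bsub>proj_units A\<^esub> = line A \<one>"
  by (simp add: proj_units_def FactGroup_def scalar_units_def line_def)

lemma proj_units_inv:
  assumes u: "u \<in> Units A"
  shows "inv\<^bsub>proj_units A\<^esub> (line A u) = line A (inv u)"
proof (rule group.inv_equality[OF proj_units_group])
  show "line A (inv u) \<otimes>\<^bsub>proj_units A\<^esub> line A u = \<one>\<^bsub>proj_units A\<^esub>"
    using u by (simp add: proj_units_mult proj_units_one)
qed (use u in \<open>auto simp: proj_units_carrier\<close>)

text \<open>If \<open>u\<close> and \<open>w\<close> induce the same conjugation,
  \<open>inv u \<otimes> w\<close> is central, hence a scalar, and a nonzero one because
  \<open>w\<close> is a unit in a nontrivial ring.\<close>

lemma inner_class_line:
  assumes center: "\<And>z. z \<in> carrier A \<Longrightarrow> (\<And>x. x \<in> carrier A \<Longrightarrow> z \<otimes> x = x \<otimes> z) \<Longrightarrow> \<exists>c. z = c \<odot> \<one>"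
    and nontriv: "\<one> \<noteq> \<zero>"
    and u: "u \<in> Units A" and \<alpha>: "\<And>x. x \<in> carrier A \<Longrightarrow> \<alpha> x = u \<otimes> x \<otimes> inv u"
  shows "inner_class A \<alpha> = line A u"
proof (intro equalityI subsetI)
  have uc: "u \<in> carrier A" "inv u \<in> carrier A"
    using u by auto
  {
    fix w assume "w \<in> inner_class A \<alpha>"
    then have w: "w \<in> Units A" "\<And>x. x \<in> carrier A \<Longrightarrow> \<alpha> x = w \<otimes> x \<otimes> inv w"
      by (auto simp: inner_class_def)
    have wc: "w \<in> carrier A" "inv w \<in> carrier A"
      using w(1) by auto
    have "inv u \<otimes> w \<otimes> x = x \<otimes> (inv u \<otimes> w)" if x: "x \<in> carrier A" for x
    proof -
      have "u \<otimes> x \<otimes> inv u \<otimes> w = w \<otimes> x \<otimes> inv w \<otimes> w"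
        using \<alpha>[OF x] w(2)[OF x] by simp
      then have "u \<otimes> x \<otimes> inv u \<otimes> w = w \<otimes> x"
        using w(1) wc x by (simp add: m_assoc)
      then have "inv u \<otimes> (w \<otimes> x) = inv u \<otimes> (u \<otimes> (x \<otimes> (inv u \<otimes> w)))"
        using uc wc x by (simp add: m_assoc)
      also have "\<dots> = x \<otimes> (inv u \<otimes> w)"
        using u uc wc x by (simp flip: m_assoc)
      finally show ?thesis
        using uc wc x by (simp add: m_assoc)
    qed
    then obtain c where c: "inv u \<otimes> w = c \<odot> \<one>"
      using center[of "inv u \<otimes> w"] uc wc by auto
    have "w = u \<otimes> (inv u \<otimes> w)"
      using u uc wc by (simp flip: m_assoc)
    then have w_eq: "w = c \<odot> u"
      unfolding c using uc by (simp add: smult_mult_right)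
    have "c \<noteq> 0"
    proof
      assume "c = 0"
      then have "w = \<zero>"
        using w_eq mod.smult_l_null[of u] uc by (simp add: class_ring_simps)
      then have "\<one> = \<zero>"
        using Units_r_inv[OF w(1)] l_null[OF wc(2)] by (metis)
      then show False
        using nontriv by simp
    qed
    then show "w \<in> line A u"
      using w_eq by (auto simp: line_def)
  next
    fix w assume "w \<in> line A u"
    then obtain c where c: "w = c \<odot> u" "c \<noteq> 0"
      by (auto simp: line_def)
    have "c \<odot> u \<otimes> x \<otimes> inv (c \<odot> u) = u \<otimes> x \<otimes> inv u" if "x \<in> carrier A" for x
      using smult_Units[OF u c(2)] uc that c(2)
      by (simp add: smult_mult_left smult_mult_right smult_closed smult_smult smult_1)
    then show "w \<in> inner_class A \<alpha>"
      using c smult_Units[OF u c(2)] \<alpha> by (auto simp: inner_class_def)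
  }
qed

lemma conjugation_automorphism:
  assumes u: "u \<in> Units A"
  shows "restrict (\<lambda>x. u \<otimes> x \<otimes> inv u) (carrier A) \<in> alg_iso A A \<inter> Bij (carrier A)"
proof -
  have uc: "u \<in> carrier A" "inv u \<in> carrier A"
    using u by auto
  let ?f = "restrict (\<lambda>x. u \<otimes> x \<otimes> inv u) (carrier A)"
  have cancel: "inv u \<otimes> (u \<otimes> x) = x" "u \<otimes> (inv u \<otimes> x) = x" if "x \<in> carrier A" for x
    using u uc that by (simp_all flip: m_assoc)
  have bij: "bij_betw ?f (carrier A) (carrier A)"
  proof (rule bij_betwI[where g = "\<lambda>x. inv u \<otimes> x \<otimes> u"])
    show "inv u \<otimes> ?f x \<otimes> u = x" if "x \<in> carrier A" for x
      using u uc that by (simp add: m_assoc cancel)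
    show "?f (inv u \<otimes> x \<otimes> u) = x" if "x \<in> carrier A" for x
      using u uc that by (simp add: m_assoc cancel)
  qed (use uc in auto)
  have "?f \<in> Ring.ring_hom A A"
    using u uc by (auto intro!: ring_hom_memI simp: m_assoc cancel l_distr r_distr)
  moreover have "?f (c \<odot> x) = c \<odot> ?f x" if "x \<in> carrier A" for c x
    using uc that by (simp add: smult_closed smult_mult_left smult_mult_right)
  ultimately show ?thesis
    using bij by (auto simp: alg_iso_def ring_iso_def Bij_def)
qed

text \<open>Scalar centre makes the class of an automorphism a single coset, and innerness of all
  automorphisms makes the class nonempty; conversely each unit gives its conjugation.\<close>

theorem inner_class_iso:
  assumes center: "\<And>z. z \<in> carrier A \<Longrightarrow> (\<And>x. x \<in> carrier A \<Longrightarrow> z \<otimes> x = x \<otimes> z) \<Longrightarrow> \<exists>c. z = c \<odot> \<one>"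
    and nontriv: "\<one> \<noteq> \<zero>"
    and inner: "\<And>\<alpha>. \<alpha> \<in> alg_iso A A \<Longrightarrow> \<exists>u\<in>Units A. \<forall>x\<in>carrier A. \<alpha> x = u \<otimes> x \<otimes> inv u"
  shows "inner_class A \<in> iso (alg_Aut A) (proj_units A)"
proof -
  note cl = inner_class_line[OF center nontriv]
  let ?Aut = "alg_iso A A \<inter> Bij (carrier A)"
  have car: "carrier (alg_Aut A) = ?Aut"
    by (simp add: alg_Aut_def)
  have hm: "inner_class A (\<alpha> \<otimes>\<^bsub>alg_Aut A\<^esub> \<beta>) = inner_class A \<alpha> \<otimes>\<^bsub>proj_units A\<^esub> inner_class A \<beta>"
    if \<alpha>: "\<alpha> \<in> ?Aut" and \<beta>: "\<beta> \<in> ?Aut" for \<alpha> \<beta>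
  proof -
    obtain u where u: "u \<in> Units A" "\<forall>x\<in>carrier A. \<alpha> x = u \<otimes> x \<otimes> inv u"
      using inner \<alpha> by blast
    obtain w where w: "w \<in> Units A" "\<forall>x\<in>carrier A. \<beta> x = w \<otimes> x \<otimes> inv w"
      using inner \<beta> by blast
    have c: "u \<in> carrier A" "inv u \<in> carrier A" "w \<in> carrier A" "inv w \<in> carrier A"
      using u w by auto
    have "inner_class A (\<alpha> \<otimes>\<^bsub>alg_Aut A\<^esub> \<beta>) = line A (u \<otimes> w)"
    proof (rule cl)
      show "u \<otimes> w \<in> Units A"
        using u w by simp
      fix x assume x: "x \<in> carrier A"
      have "(\<alpha> \<otimes>\<^bsub>alg_Aut A\<^esub> \<beta>) x = \<alpha> (\<beta> x)"
        using \<alpha> \<beta> x by (simp add: alg_Aut_def BijGroup_def compose_def)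
      also have "\<dots> = u \<otimes> (w \<otimes> x \<otimes> inv w) \<otimes> inv u"
        using u w x c by simp
      also have "\<dots> = u \<otimes> w \<otimes> x \<otimes> inv (u \<otimes> w)"
      proof -
        have "w \<otimes> (inv w \<otimes> inv u) = inv u" "inv u \<otimes> (u \<otimes> w) = w"
          using u(1) w(1) c by (simp_all flip: m_assoc)
        then have "inv (u \<otimes> w) = inv w \<otimes> inv u"
          using u(1) w(1) c by (intro inv_char) (simp_all add: m_assoc)
        then show ?thesis
          using c x by (simp add: m_assoc)
      qed
      finally show "(\<alpha> \<otimes>\<^bsub>alg_Aut A\<^esub> \<beta>) x = u \<otimes> w \<otimes> x \<otimes> inv (u \<otimes> w)" .
    qed
    moreover have "inner_class A \<alpha> = line A u"
      using u by (intro cl) auto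
    moreover have "inner_class A \<beta> = line A w"
      using w by (intro cl) auto
    ultimately show ?thesis
      using proj_units_mult[OF u(1) w(1)] by simp
  qed
  have bj: "bij_betw (inner_class A) ?Aut (line A ` Units A)"
  proof (rule bij_betw_imageI)
    show "inj_on (inner_class A) ?Aut"
    proof (rule inj_onI)
      fix \<alpha> \<beta> assume \<alpha>: "\<alpha> \<in> ?Aut" and \<beta>: "\<beta> \<in> ?Aut" and eq: "inner_class A \<alpha> = inner_class A \<beta>"
      obtain u where u: "u \<in> Units A" "\<forall>x\<in>carrier A. \<alpha> x = u \<otimes> x \<otimes> inv u"
        using inner \<alpha> by blast
      then have "u \<in> inner_class A \<alpha>"
        by (auto simp: inner_class_def)
      then have "u \<in> inner_class A \<beta>"
        by (simp add: eq)
      then have "\<forall>x\<in>carrier A. \<beta> x = u \<otimes> x \<otimes> inv u"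
        by (auto simp: inner_class_def)
      then show "\<alpha> = \<beta>"
        \<comment> \<open>Elements of \<open>Bij\<close> are extensional, so agreement on the
          carrier is equality of functions.\<close>
        using u(2) \<alpha> \<beta> by (intro extensionalityI[of _ "carrier A"]) (auto simp: Bij_def)
    qed
    show "inner_class A ` ?Aut = line A ` Units A"
    proof (intro equalityI subsetI)
      fix C assume "C \<in> inner_class A ` ?Aut"
      then obtain \<alpha> where \<alpha>: "\<alpha> \<in> ?Aut" "C = inner_class A \<alpha>" by blast
      obtain u where u: "u \<in> Units A" "\<forall>x\<in>carrier A. \<alpha> x = u \<otimes> x \<otimes> inv u"
        using inner \<alpha> by blast
      have "C = line A u"
        unfolding \<alpha>(2) using u by (intro cl) auto
      then show "C \<in> line A ` Units A"
        using u(1) by blast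
    next
      fix C assume "C \<in> line A ` Units A"
      then obtain u where u: "u \<in> Units A" "C = line A u" by blast
      have "inner_class A (restrict (\<lambda>x. u \<otimes> x \<otimes> inv u) (carrier A)) = C"
        unfolding u(2) using u(1) by (intro cl) auto
      then show "C \<in> inner_class A ` ?Aut"
        using conjugation_automorphism[OF u(1)] by blast
    qed
  qed
  show ?thesis
    unfolding iso_def hom_def car proj_units_carrier using hm bij_betw_imp_funcset[OF bj] bj by blast
qed

end

lemma F_algI: "F_algebra A \<Longrightarrow> F_alg A"
  using F_algebraD(1) by (simp add: F_alg_def F_alg_axioms_def)

lemma alg_iso_Units:
  assumes A: "F_algebra A" and B: "F_algebra B" and f: "f \<in> alg_iso A B" and u: "u \<in> Units A"
  shows "f u \<in> Units B"
proof -
  interpret A: ring A by (rule F_algebraD[OF A])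
  note fD = alg_isoD[OF f]
  have "f u \<otimes>\<^bsub>B\<^esub> f (inv\<^bsub>A\<^esub> u) = \<one>\<^bsub>B\<^esub>" "f (inv\<^bsub>A\<^esub> u) \<otimes>\<^bsub>B\<^esub> f u = \<one>\<^bsub>B\<^esub>"
    using u fD(6)[of u "inv\<^bsub>A\<^esub> u"] fD(6)[of "inv\<^bsub>A\<^esub> u" u] fD(8) by auto
  then show ?thesis
    unfolding Units_def using fD(5)[of u] fD(5)[of "inv\<^bsub>A\<^esub> u"] u by blast
qed

theorem alg_iso_proj_units:
  assumes A: "F_algebra A" and B: "F_algebra B" and f: "f \<in> alg_iso A B"
  shows "(\<lambda>C. f ` C) \<in> iso (proj_units A) (proj_units B)"
proof -
  interpret A: F_alg A by (rule F_algI[OF A])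
  interpret B: F_alg B by (rule F_algI[OF B])
  note fD = alg_isoD[OF f]
  note U = alg_iso_Units[OF A B f]
  have img: "f ` line A u = line B (f u)" if "u \<in> Units A" for u
  proof -
    have "f (c \<odot>\<^bsub>A\<^esub> u) = c \<odot>\<^bsub>B\<^esub> f u" for c
      using fD(9) that by auto
    then show ?thesis
      unfolding line_def by (auto simp: image_iff) metis
  qed
  have "bij_betw (\<lambda>C. f ` C) (line A ` Units A) (line B ` Units B)"
  proof (rule bij_betw_imageI)
    have "line A ` Units A \<subseteq> Pow (carrier A)"
    proof
      fix C assume "C \<in> line A ` Units A"
      then have "C \<subseteq> Units A"
        using A.line_subset_Units by blast
      then show "C \<in> Pow (carrier A)"
        using A.Units_closed by blast
    qed
    then show "inj_on (\<lambda>C. f ` C) (line A ` Units A)"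
      using inj_on_subset[OF inj_on_image_Pow[OF fD(4)]] by blast
    show "(\<lambda>C. f ` C) ` line A ` Units A = line B ` Units B"
    proof (intro equalityI subsetI)
      fix C assume "C \<in> (\<lambda>C. f ` C) ` line A ` Units A"
      then show "C \<in> line B ` Units B"
        using img U by auto
    next
      fix C assume "C \<in> line B ` Units B"
      then obtain w where w: "w \<in> Units B" "C = line B w" by blast
      define u where "u = inv_into (carrier A) f w"
      have u: "u \<in> Units A"
        unfolding u_def using alg_iso_Units[OF B A alg_iso_inv_into[OF A f]] w(1) by blast
      have "f u = w"
        unfolding u_def using fD(3) w(1) by (intro f_inv_into_f) (auto simp: bij_betw_def)
      then show "C \<in> (\<lambda>C. f ` C) ` line A ` Units A"
        using img[OF u] u w(2) by blast
    qed
  qed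
  moreover have "f ` (line A u \<otimes>\<^bsub>proj_units A\<^esub> line A w) = f ` line A u \<otimes>\<^bsub>proj_units B\<^esub> f ` line A w"
    if "u \<in> Units A" "w \<in> Units A" for u w
    using that U fD(6)[OF A.Units_closed A.Units_closed, of u w] by (simp add: A.proj_units_mult B.proj_units_mult img)
  ultimately show ?thesis
    unfolding iso_def hom_def A.proj_units_carrier B.proj_units_carrier using img U by (auto simp: bij_betw_def)
qed

text \<open>The part \<open>L\<close> of \<open>H\<close> that is mapped into \<open>PSL n\<close>
  contains all commutators, so it is normal in \<open>H\<close>, and it is nontrivial since
  \<open>H\<close> is not abelian. Simplicity of \<open>H\<close> gives
  \<open>L = H\<close>.\<close>

theorem simple_hom_into_PSL:
  fixes f :: "'g \<Rightarrow> 'f::field mat set"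
  assumes G: "group G" and H: "H \<lhd> G" and simple: "is_simple_group (G\<lparr>carrier := H\<rparr>)"
    and noncomm: "\<not> comm_group (G\<lparr>carrier := H\<rparr>)" and f: "f \<in> hom G (PGL n)"
  shows "f ` H \<subseteq> PSL n"
proof -
  let ?K = "G\<lparr>carrier := H\<rparr>"
  let ?A = "Mat n :: ('f, 'f mat) module"
  interpret A: F_alg ?A by (rule F_algI[OF Mat_F_algebra])
  interpret G: group G by fact
  have subH: "subgroup H G"
    using G.normal_invE(1)[OF H] .
  then interpret K: group ?K
    by (rule subgroup.subgroup_is_group) (rule G)
  interpret PGL: group "PGL n :: 'f mat set monoid"
    by (rule A.proj_units_group)
  interpret f: group_hom G "PGL n :: 'f mat set monoid" f
    by unfold_locales (rule f)
  have HG: "h \<in> carrier G" if "h \<in> H" for h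
    using subgroup.subset[OF subH] that by auto
  have invK: "inv\<^bsub>?K\<^esub> h = inv\<^bsub>G\<^esub> h" if "h \<in> H" for h
    using G.m_inv_consistent[OF subH that] by simp
  have invH: "inv\<^bsub>G\<^esub> h \<in> H" if "h \<in> H" for h
    using subgroup.m_inv_closed[OF subH that] .
  have multH: "g \<otimes>\<^bsub>G\<^esub> h \<in> H" if "g \<in> H" "h \<in> H" for g h
    using subgroup.m_closed[OF subH that] .
  have Ucar: "u \<in> carrier_mat n n" if "u \<in> Units ?A" for u
    using A.Units_closed[OF that] by (simp add: module_mat_simps)
  have det_inv: "det u * det (inv\<^bsub>?A\<^esub> u) = 1" if "u \<in> Units ?A" for u
  proof -
    have "u * inv\<^bsub>?A\<^esub> u = 1\<^sub>m n"
      using A.Units_r_inv[OF that] by (simp add: module_mat_simps)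
    then have "det (u * inv\<^bsub>?A\<^esub> u) = 1"
      by simp
    then show ?thesis
      using det_mult[OF Ucar[OF that] Ucar[OF A.Units_inv_Units[OF that]]] by simp
  qed
  have det1_unit: "P \<in> Units ?A" if P: "P \<in> carrier_mat n n" "det P = 1" for P
    \<comment> \<open>The slot filled by \<open>undefined\<close> is the extension field of the
      matrix ring record, on which the units do not depend.\<close>
    using det_non_zero_imp_unit[OF P(1), of undefined] P(2) by (auto simp: Units_def module_mat_simps ring_mat_simps)
  have PSL: "PSL n = {line ?A P |P. P \<in> Units ?A \<and> det P = 1}"
    unfolding PSL_def using A.rcoset_line Ucar det1_unit by (auto simp: module_mat_simps)
  have rep: "\<exists>u\<in>Units ?A. f g = line ?A u" if "g \<in> carrier G" for g
    using f.hom_closed[OF that] unfolding A.proj_units_carrier by blast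
  define L where "L = {h \<in> H. f h \<in> PSL n}"
  have L_mult: "g \<otimes>\<^bsub>G\<^esub> h \<in> L" if g: "g \<in> L" and h: "h \<in> L" for g h
  proof -
    obtain P Q where P: "f g = line ?A P" "P \<in> Units ?A" "det P = 1"
      and Q: "f h = line ?A Q" "Q \<in> Units ?A" "det Q = 1"
      using g h unfolding L_def PSL by blast
    have "f (g \<otimes>\<^bsub>G\<^esub> h) = line ?A (P \<otimes>\<^bsub>?A\<^esub> Q)"
      using g h P Q HG by (simp add: L_def A.proj_units_mult)
    moreover have "det (P \<otimes>\<^bsub>?A\<^esub> Q) = 1"
      using det_mult[OF Ucar[OF P(2)] Ucar[OF Q(2)]] P Q by (simp add: module_mat_simps)
    moreover have "P \<otimes>\<^bsub>?A\<^esub> Q \<in> Units ?A"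
      using P Q by simp
    ultimately show ?thesis
      using g h multH unfolding L_def PSL by blast
  qed
  have L_inv: "inv\<^bsub>G\<^esub> h \<in> L" if h: "h \<in> L" for h
  proof -
    obtain P where P: "f h = line ?A P" "P \<in> Units ?A" "det P = 1"
      using h unfolding L_def PSL by blast
    have "f (inv\<^bsub>G\<^esub> h) = line ?A (inv\<^bsub>?A\<^esub> P)"
      using h P HG by (simp add: L_def f.hom_inv A.proj_units_inv)
    moreover have "det (inv\<^bsub>?A\<^esub> P) = 1"
      using det_inv[OF P(2)] P(3) by simp
    moreover have "inv\<^bsub>?A\<^esub> P \<in> Units ?A"
      using P by simp
    ultimately show ?thesis
      using h invH unfolding L_def PSL by blast
  qed
  \<comment> \<open>Whatever representatives \<open>x\<close>, \<open>y\<close> of the images are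
    taken, their commutator has determinant 1.\<close>
  have L_comm: "g \<otimes>\<^bsub>G\<^esub> h \<otimes>\<^bsub>G\<^esub> inv\<^bsub>G\<^esub> g \<otimes>\<^bsub>G\<^esub> inv\<^bsub>G\<^esub> h \<in> L" if g: "g \<in> H" and h: "h \<in> H" for g h
  proof -
    obtain x y where x: "x \<in> Units ?A" "f g = line ?A x" and y: "y \<in> Units ?A" "f h = line ?A y"
      using rep[OF HG[OF g]] rep[OF HG[OF h]] by blast
    let ?c = "x \<otimes>\<^bsub>?A\<^esub> y \<otimes>\<^bsub>?A\<^esub> inv\<^bsub>?A\<^esub> x \<otimes>\<^bsub>?A\<^esub> inv\<^bsub>?A\<^esub> y"
    have 1: "f (g \<otimes>\<^bsub>G\<^esub> h \<otimes>\<^bsub>G\<^esub> inv\<^bsub>G\<^esub> g \<otimes>\<^bsub>G\<^esub> inv\<^bsub>G\<^esub> h) = line ?A ?c"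
      using HG[OF g] HG[OF h] x y by (simp add: f.hom_inv A.proj_units_inv A.proj_units_mult)
    have 2: "?c \<in> Units ?A"
      using x y by simp
    have 3: "det ?c = 1"
    proof -
      have car: "x \<in> carrier_mat n n" "y \<in> carrier_mat n n" "inv\<^bsub>?A\<^esub> x \<in> carrier_mat n n" "inv\<^bsub>?A\<^esub> y \<in> carrier_mat n n"
        using Ucar x y by auto
      have "det ?c = det x * det y * det (inv\<^bsub>?A\<^esub> x) * det (inv\<^bsub>?A\<^esub> y)"
        using car by (simp add: module_mat_simps det_mult[of _ n])
      also have "\<dots> = (det x * det (inv\<^bsub>?A\<^esub> x)) * (det y * det (inv\<^bsub>?A\<^esub> y))"
        by (simp add: mult_ac)
      finally show ?thesis
        using det_inv x y by simp
    qed
    have "g \<otimes>\<^bsub>G\<^esub> h \<otimes>\<^bsub>G\<^esub> inv\<^bsub>G\<^esub> g \<otimes>\<^bsub>G\<^esub> inv\<^bsub>G\<^esub> h \<in> H"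
      by (intro multH invH g h)
    then show ?thesis
      unfolding L_def PSL mem_Collect_eq by (intro conjI exI[of _ ?c] 1 2 3)
  qed
  have LH: "L \<subseteq> H"
    by (auto simp: L_def)
  have one: "\<one>\<^bsub>G\<^esub> \<in> H"
    using subgroup.one_closed[OF subH] .
  have "L \<lhd> ?K"
  proof (rule K.normal_invI)
    show "subgroup L ?K"
    proof (rule K.subgroupI)
      show "L \<noteq> {}"
        using L_comm[OF one one] by blast
      show "inv\<^bsub>?K\<^esub> h \<in> L" if "h \<in> L" for h
        using L_inv[OF that] invK that LH by auto
    qed (use LH L_mult in auto)
    fix x h assume x: "x \<in> carrier ?K" and h: "h \<in> L"
    have xH: "x \<in> H" "h \<in> H"
      using x h LH by auto
    \<comment> \<open>The conjugate of \<open>h\<close> by \<open>x\<close> is their commutator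
      times \<open>h\<close>.\<close>
    have "x \<otimes>\<^bsub>G\<^esub> h \<otimes>\<^bsub>G\<^esub> inv\<^bsub>G\<^esub> x \<otimes>\<^bsub>G\<^esub> inv\<^bsub>G\<^esub> h \<otimes>\<^bsub>G\<^esub> h \<in> L"
      by (rule L_mult[OF L_comm[OF xH] h])
    then show "x \<otimes>\<^bsub>?K\<^esub> h \<otimes>\<^bsub>?K\<^esub> inv\<^bsub>?K\<^esub> x \<in> L"
      using HG[OF xH(1)] HG[OF xH(2)] invK[OF xH(1)] by (simp add: G.m_assoc)
  qed
  then have "L = {\<one>\<^bsub>?K\<^esub>} \<or> L = carrier ?K"
    using simple unfolding is_simple_group_def by blast
  then have "L = {\<one>\<^bsub>G\<^esub>} \<or> L = H"
    by simp
  moreover have "L \<noteq> {\<one>\<^bsub>G\<^esub>}"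
  proof
    assume L1: "L = {\<one>\<^bsub>G\<^esub>}"
    have "comm_group ?K"
    proof (rule K.group_comm_groupI)
      fix g h assume "g \<in> carrier ?K" "h \<in> carrier ?K"
      then have gh: "g \<in> H" "h \<in> H" by auto
      have c: "g \<in> carrier G" "h \<in> carrier G"
        using HG gh by auto
      have "g \<otimes>\<^bsub>G\<^esub> h \<otimes>\<^bsub>G\<^esub> inv\<^bsub>G\<^esub> g \<otimes>\<^bsub>G\<^esub> inv\<^bsub>G\<^esub> h = \<one>\<^bsub>G\<^esub>"
        using L_comm[OF gh] L1 by simp
      then have "g \<otimes>\<^bsub>G\<^esub> h \<otimes>\<^bsub>G\<^esub> inv\<^bsub>G\<^esub> (h \<otimes>\<^bsub>G\<^esub> g) = \<one>\<^bsub>G\<^esub>"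
        using c by (simp add: G.inv_mult_group G.m_assoc)
      then have "g \<otimes>\<^bsub>G\<^esub> h = h \<otimes>\<^bsub>G\<^esub> g"
        using c G.inv_equality[of "g \<otimes>\<^bsub>G\<^esub> h" "inv\<^bsub>G\<^esub> (h \<otimes>\<^bsub>G\<^esub> g)"] by simp
      then show "g \<otimes>\<^bsub>?K\<^esub> h = h \<otimes>\<^bsub>?K\<^esub> g"
        by simp
    qed
    then show False
      using noncomm by blast
  qed
  ultimately show ?thesis
    by (auto simp: L_def)
qed

section \<open>The adjoint action on a stable algebra\<close>

context linear_representation begin

lemma Ad_eq: "g \<in> carrier K \<Longrightarrow> Ad \<rho> S g = restrict (conj g) S"
  by (auto simp: Ad_def conj_def inv_rep intro!: restrict_ext)

lemma conj_inv': "g \<in> carrier K \<Longrightarrow> conj (inv g) (conj g u) = u"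
  using conj_inv[of "inv g" u] by simp

lemma normal_subalgebra_iff_stable:
  "normal_subalgebra scale \<rho> (carrier K) R \<longleftrightarrow> stable_algebra R"
  by (auto simp: normal_subalgebra_def stable_algebra_def unital_subalgebra_iff_operator_algebra conj_def inv_rep)

lemma Ad_hom:
  assumes S: "stable_algebra S"
  shows "Ad \<rho> S \<in> hom K (alg_Aut (op_alg scale S))"
proof -
  have alg: "operator_algebra S" and st: "\<And>g u. g \<in> carrier K \<Longrightarrow> u \<in> S \<Longrightarrow> conj g u \<in> S"
    using S by (auto simp: stable_algebra_def)
  have aut: "Ad \<rho> S g \<in> alg_iso (op_alg scale S) (op_alg scale S) \<inter> Bij S" if g: "g \<in> carrier K" for g
  proof -
    have bij: "bij_betw (restrict (conj g) S) S S"
    proof (rule bij_betwI[where g = "conj (inv g)"])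
      show "restrict (conj g) S \<in> S \<rightarrow> S"
        using st[OF g] by auto
      show "conj (inv g) \<in> S \<rightarrow> S"
        using st[of "inv g"] g by auto
      show "conj (inv g) (restrict (conj g) S x) = x" if "x \<in> S" for x
        using that conj_inv'[OF g] by simp
      show "restrict (conj g) S (conj (inv g) y) = y" if "y \<in> S" for y
        using that conj_inv[OF g] st[of "inv g" y] g by simp
    qed
    note lin = operator_algebraD(1)[OF alg]
    have add: "conj g (\<lambda>v. x v + y v) = (\<lambda>v. conj g x v + conj g y v)" for x y
      by (auto simp: conj_def lin_add[OF rep_linear[OF g]])
    have sc: "conj g (\<lambda>v. scale c (x v)) = (\<lambda>v. scale c (conj g x v))" for c x
      by (auto simp: conj_def lin_scale[OF rep_linear[OF g]])
    have one: "conj g id = id"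
      using g by (auto simp: conj_def)
    show ?thesis
      using bij operator_algebraD[OF alg] st[OF g]
      by (auto simp: Ad_eq[OF g] alg_iso_def ring_iso_def Ring.ring_hom_def Bij_def add sc one conj_comp[OF g])
  qed
  have "Ad \<rho> S (g \<otimes> h) = compose S (Ad \<rho> S g) (Ad \<rho> S h)" if g: "g \<in> carrier K" and h: "h \<in> carrier K" for g h
    unfolding Ad_eq[OF g] Ad_eq[OF h] Ad_eq[OF K.m_closed[OF g h]] compose_def
    using st[OF h] conj_mult[OF g h] by (intro restrict_ext) simp
  then show ?thesis
    using aut by (auto simp: hom_def alg_Aut_def BijGroup_def)
qed

lemma Ad_kernel_normal:
  assumes S: "stable_algebra S"
  shows "{g \<in> carrier K. \<forall>x\<in>S. conj g x = x} \<lhd> K" (is "?L \<lhd> K")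
proof (rule K.normal_invI)
  have st: "\<And>g u. g \<in> carrier K \<Longrightarrow> u \<in> S \<Longrightarrow> conj g u \<in> S"
    using S by (auto simp: stable_algebra_def)
  show "subgroup ?L K"
  proof (rule K.subgroupI)
    show "?L \<noteq> {}"
      using conj_one K.one_closed by blast
    show "inv g \<in> ?L" if "g \<in> ?L" for g
    proof -
      have g: "g \<in> carrier K" "\<And>x. x \<in> S \<Longrightarrow> conj g x = x"
        using that by auto
      have "conj (inv g) x = x" if "x \<in> S" for x
        using conj_inv'[OF g(1), of x] g(2)[OF that] by simp
      then show ?thesis
        using g(1) by simp
    qed
  qed (auto simp: conj_mult)
  fix g h assume g: "g \<in> carrier K" and h: "h \<in> ?L"
  have "conj (g \<otimes> h \<otimes> inv g) x = x" if x: "x \<in> S" for x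
  proof -
    have "conj (g \<otimes> h \<otimes> inv g) x = conj g (conj h (conj (inv g) x))"
      using g h by (simp add: conj_mult)
    also have "\<dots> = conj g (conj (inv g) x)"
      using h st[of "inv g" x] g x by simp
    also have "\<dots> = x"
      by (rule conj_inv[OF g])
    finally show ?thesis .
  qed
  then show "g \<otimes> h \<otimes> inv g \<in> ?L"
    using g h by simp
qed

lemma Ad_inj:
  assumes S: "stable_algebra S" and triv: "{g \<in> carrier K. \<forall>x\<in>S. conj g x = x} \<subseteq> {\<one>}"
  shows "inj_on (Ad \<rho> S) (carrier K)"
proof (rule inj_onI)
  fix g h assume g: "g \<in> carrier K" and h: "h \<in> carrier K" and eq: "Ad \<rho> S g = Ad \<rho> S h"
  have "conj (inv h \<otimes> g) x = x" if x: "x \<in> S" for x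
  proof -
    have "conj g x = conj h x"
      using fun_cong[OF eq, of x] x by (simp add: Ad_eq[OF g] Ad_eq[OF h])
    then show ?thesis
      using g h by (simp add: conj_mult conj_inv')
  qed
  then have "inv h \<otimes> g \<in> {g \<in> carrier K. \<forall>x\<in>S. conj g x = x}"
    using g h by simp
  then have "inv h \<otimes> g = \<one>"
    using triv by blast
  then have "inv (inv h) = g"
    using g h K.inv_comm K.inv_equality by (metis K.inv_closed)
  then show "g = h"
    using h by simp
qed

text \<open>\<open>Ad_PGL\<close> is \<open>Ad\<close> followed by two group isomorphisms, so it
  inherits the homomorphism property and injectivity. Matrix units supply the two inputs of the
  first isomorphism: scalar centre and Skolem-Noether.\<close>

lemma projective_Ad:
  assumes S: "stable_algebra S" and E: "matrix_units scale Basis S n E" and inj: "inj_on (Ad \<rho> S) (carrier K)"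
  shows "inner_class (op_alg scale S) \<in> iso (alg_Aut (op_alg scale S)) (proj_units (op_alg scale S))"
    and "\<phi> \<in> alg_iso (op_alg scale S) (Mat n) \<Longrightarrow> (\<lambda>C. \<phi> ` C) \<in> iso (proj_units (op_alg scale S)) (PGL n)"
    and "\<phi> \<in> alg_iso (op_alg scale S) (Mat n) \<Longrightarrow> Ad_PGL scale \<rho> S \<phi> \<in> hom K (PGL n)"
    and "\<phi> \<in> alg_iso (op_alg scale S) (Mat n) \<Longrightarrow> inj_on (Ad_PGL scale \<rho> S \<phi>) (carrier K)"
proof -
  interpret E: matrix_units scale Basis S n E by fact
  let ?A = "op_alg scale S"
  have alg: "operator_algebra S"
    using S by (simp add: stable_algebra_def)
  have FA: "F_algebra ?A"
    by (rule op_alg_F_algebra[OF alg])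
  interpret A: F_alg ?A by (rule F_algI[OF FA])
  show ic: "inner_class ?A \<in> iso (alg_Aut ?A) (proj_units ?A)"
  proof (rule A.inner_class_iso)
    show "\<one>\<^bsub>?A\<^esub> \<noteq> \<zero>\<^bsub>?A\<^esub>"
      using E.nonzero by (auto simp: fun_eq_iff)
    show "\<exists>c. z = c \<odot>\<^bsub>?A\<^esub> \<one>\<^bsub>?A\<^esub>" if z: "z \<in> carrier ?A" and comm: "\<And>x. x \<in> carrier ?A \<Longrightarrow> z \<otimes>\<^bsub>?A\<^esub> x = x \<otimes>\<^bsub>?A\<^esub> z" for z
    proof -
      have "z (E i j v) = E i j (z v)" if "i < n" "j < n" for i j v
        using fun_cong[OF comm, of "E i j" v] E.E_in[OF that] by simp
      then obtain c where "z = scale c"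
        using E.center_scalar[of z] z by auto
      then show ?thesis
        by (intro exI[of _ c]) auto
    qed
    show "\<exists>u\<in>Units ?A. \<forall>x\<in>carrier ?A. f x = u \<otimes>\<^bsub>?A\<^esub> x \<otimes>\<^bsub>?A\<^esub> inv\<^bsub>?A\<^esub> u" if f: "f \<in> alg_iso ?A ?A" for f
    proof -
      obtain u t where u: "u \<in> S" "t \<in> S" "u \<circ> t = id" "t \<circ> u = id" "\<forall>x\<in>S. f x = u \<circ> x \<circ> t"
        using E.skolem_noether[OF f] by blast
      have "u \<in> Units ?A"
        using u(1-4) by (auto simp: Units_def)
      moreover have "inv\<^bsub>?A\<^esub> u = t"
        using u(1-4) by (intro A.inv_char) auto
      ultimately show ?thesis
        using u(5) by auto
    qed
  qed
  assume \<phi>: "\<phi> \<in> alg_iso ?A (Mat n)"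
  show img: "(\<lambda>C. \<phi> ` C) \<in> iso (proj_units ?A) (PGL n)"
    by (rule alg_iso_proj_units[OF FA Mat_F_algebra \<phi>])
  have eq: "Ad_PGL scale \<rho> S \<phi> = (\<lambda>C. \<phi> ` C) \<circ> (inner_class ?A \<circ> Ad \<rho> S)"
    by (auto simp: Ad_PGL_def)
  have hom1: "inner_class ?A \<in> hom (alg_Aut ?A) (proj_units ?A)"
    and bij1: "bij_betw (inner_class ?A) (carrier (alg_Aut ?A)) (carrier (proj_units ?A))"
    using ic by (auto simp: iso_def)
  have hom2: "(\<lambda>C. \<phi> ` C) \<in> hom (proj_units ?A) (PGL n)"
    and bij2: "bij_betw (\<lambda>C. \<phi> ` C) (carrier (proj_units ?A)) (carrier (PGL n :: 'a mat set monoid))"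
    using img by (auto simp: iso_def)
  have Ad: "Ad \<rho> S \<in> hom K (alg_Aut ?A)"
    by (rule Ad_hom[OF S])
  show "Ad_PGL scale \<rho> S \<phi> \<in> hom K (PGL n)"
    unfolding eq by (rule hom_compose[OF hom_compose[OF Ad hom1] hom2])
  have sub1: "Ad \<rho> S ` carrier K \<subseteq> carrier (alg_Aut ?A)"
    using hom_carrier[OF Ad] .
  have sub2: "inner_class ?A ` Ad \<rho> S ` carrier K \<subseteq> carrier (proj_units ?A)"
    using sub1 hom_carrier[OF hom1] by blast
  show "inj_on (Ad_PGL scale \<rho> S \<phi>) (carrier K)"
    unfolding eq
  proof (intro comp_inj_on)
    show "inj_on (Ad \<rho> S) (carrier K)" by (rule inj)
    show "inj_on (inner_class ?A) (Ad \<rho> S ` carrier K)"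
      using bij1 sub1 by (auto simp: bij_betw_def intro: inj_on_subset)
    show "inj_on (\<lambda>C. \<phi> ` C) ((inner_class ?A \<circ> Ad \<rho> S) ` carrier K)"
      using bij2 sub2 by (auto simp: bij_betw_def image_comp intro: inj_on_subset)
  qed
qed

end

section \<open>Matrix units of stable algebras, the kernel of \<open>Ad\<close>, and the five
  clauses\<close>

context irreducible_operators begin

lemma stable_matrix_units:
  assumes br: "brauer_trivial TYPE('a)" and R: "stable_algebra R"
  shows "\<exists>n E. matrix_units scale Basis R n E"
proof -
  have alg: "operator_algebra R"
    using R by (simp add: stable_algebra_def)
  note lin = operator_algebraD(1)[OF alg]
  obtain e where e: "e \<in> R" "e \<noteq> (\<lambda>_. 0)" "e \<circ> e = e"
    and rank_one: "\<And>x. x \<in> R \<Longrightarrow> \<exists>c. e \<circ> x \<circ> e = (\<lambda>v. scale c (e v))"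
    using brauer_trivial_op_alg_idempotent[OF br alg stable_central_simple[OF R]] by blast
  \<comment> \<open>Primeness from simplicity: the \<open>g\<close> with \<open>eRgRe = 0\<close>
    form a two-sided ideal. A nonzero member would bring \<open>id\<close> into it, and then
    \<open>e = e e\<close> would vanish.\<close>
  define I where "I = {g \<in> R. \<forall>x\<in>R. \<forall>y\<in>R. \<forall>v. e (x (g (y (e v)))) = 0}"
  have "\<exists>x\<in>R. \<exists>y\<in>R. e \<circ> x \<circ> g \<circ> y \<circ> e \<noteq> (\<lambda>_. 0)" if g: "g \<in> R" "g \<noteq> (\<lambda>_. 0)" for g
  proof (rule ccontr)
    assume no: "\<not> ?thesis"
    have gI: "g \<in> I"
      unfolding I_def
    proof (intro CollectI conjI ballI allI g(1))
      fix x y v assume "x \<in> R" "y \<in> R"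
      then have "e \<circ> x \<circ> g \<circ> y \<circ> e = (\<lambda>_. 0)"
        using no by blast
      from fun_cong[OF this, of v] show "e (x (g (y (e v)))) = 0"
        by simp
    qed
    have "id \<in> I"
    proof (rule stable_simple[OF R])
      show "I \<subseteq> R"
        by (auto simp: I_def)
      show "(\<lambda>v. x v + y v) \<in> I" if x: "x \<in> I" and y: "y \<in> I" for x y
      proof -
        have "e (z (x (w (e v)) + y (w (e v)))) = 0" if z: "z \<in> R" and w: "w \<in> R" for z w v
          using x y z w by (simp add: I_def lin_add[OF lin[OF z]] lin_add[OF lin[OF e(1)]])
        then show ?thesis
          using x y operator_algebraD(3)[OF alg] unfolding I_def by blast
      qed
      show "r \<circ> x \<in> I" if r: "r \<in> R" and x: "x \<in> I" for r x
      proof -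
        have "e (z ((r \<circ> x) (y (e v)))) = 0" if "z \<in> R" "y \<in> R" for z y v
        proof -
          have "z \<circ> r \<in> R"
            using operator_algebraD(4)[OF alg that(1) r] .
          then have "e ((z \<circ> r) (x (y (e v)))) = 0"
            using x that(2) unfolding I_def by blast
          then show ?thesis by simp
        qed
        then show ?thesis
          using x r operator_algebraD(4)[OF alg] unfolding I_def by blast
      qed
      show "x \<circ> r \<in> I" if r: "r \<in> R" and x: "x \<in> I" for r x
      proof -
        have "e (z ((x \<circ> r) (y (e v)))) = 0" if "z \<in> R" "y \<in> R" for z y v
        proof -
          have "r \<circ> y \<in> R"
            using operator_algebraD(4)[OF alg r that(2)] .
          then have "e (z (x ((r \<circ> y) (e v)))) = 0"
            using x that(1) unfolding I_def by blast
          then show ?thesis by simp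
        qed
        then show ?thesis
          using x r operator_algebraD(4)[OF alg] unfolding I_def by blast
      qed
      show "g \<in> I" by (rule gI)
      show "g \<noteq> (\<lambda>_. 0)" by (rule g(2))
    qed
    then have "e (id (id (id (e v)))) = 0" for v
      using operator_algebraD(2)[OF alg] unfolding I_def by blast
    then have "e v = 0" for v
      using fun_cong[OF e(3), of v] by simp
    then show False
      using e(2) by auto
  qed
  then show ?thesis
    using matrix_units_exist[OF alg nonzero_space e rank_one] by blast
qed

end

text \<open>If \<open>E 0 0\<close> were a scalar, it would be nonzero; from
  \<open>E 0 0 (E 1 0 v) = 0\<close> it would follow that \<open>E 1 0 v = 0\<close>, hence
  \<open>E 0 0 v = E 0 1 (E 1 0 v) = 0\<close>.\<close>

lemma (in matrix_units) not_all_scalar: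
  assumes "n \<noteq> 1"
  shows "\<exists>x\<in>R. \<forall>c. x \<noteq> scale c"
proof (rule ccontr)
  assume "\<not> ?thesis"
  then obtain c where c: "E 0 0 = scale c"
    using E_in[OF pos pos] by blast
  have n: "1 < n"
    using pos assms by simp
  obtain v where v: "E 0 0 v \<noteq> 0"
    using E_nonzero by blast
  have "scale c (E 1 0 v) = 0"
    using E_mult[OF pos pos n pos, of v] c by simp
  moreover have "c \<noteq> 0"
    using c v by auto
  ultimately have "E 1 0 v = 0"
    by simp
  then have "E 0 0 v = 0"
    using E_mult[OF pos n n pos, of v] lin_zero[OF E_lin[OF pos n]] by simp
  then show False
    using v by simp
qed

theorem theorem4p5:
  fixes scale :: "'f::field \<Rightarrow> 'v::ab_group_add \<Rightarrow> 'v"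
    and Basis :: "'v set"
    and N :: nat
    and G :: "('g, 'm) monoid_scheme"
    and \<rho> :: "'g \<Rightarrow> 'v \<Rightarrow> 'v"
    and H :: "'g set"
    and R :: "('v \<Rightarrow> 'v) set"
  assumes Br: "brauer_trivial TYPE('f)"
    and V: "finite_dimensional_vector_space scale Basis"
    and N: "N = Vector_Spaces.vector_space.dim scale (UNIV :: 'v set)" "N > 1"
    and G: "group G"
    and \<rho>: "\<rho> \<in> hom G (Aut_V scale)"
    and H: "H \<lhd> G"
    and i: "\<And>H'. subgroup H' (G\<lparr>carrier := H\<rparr>) \<Longrightarrow>
               finite (rcosets\<^bsub>G\<lparr>carrier := H\<rparr>\<^esub> H') \<Longrightarrow>
               card (rcosets\<^bsub>G\<lparr>carrier := H\<rparr>\<^esub> H') dvd N \<Longrightarrow> H' = H"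
    and ii: "is_simple_group (G\<lparr>carrier := H\<rparr>)" "\<not> comm_group (G\<lparr>carrier := H\<rparr>)"
            "H = carrier G \<or> {K. K \<lhd> G \<and> K \<noteq> {\<one>\<^bsub>G\<^esub>} \<and> K \<noteq> carrier G} = {H}"
    and iii: "abs_simple_rep scale \<rho> H"
    and R: "normal_subalgebra scale \<rho> (carrier G) R"
  shows "\<exists>a b :: nat. a > 0 \<and> b > 0 \<and>
    N = a * b \<and>
    (alg_iso (op_alg scale R) (Mat a) \<noteq> {} \<and>
     semisimple_mod scale R \<and> isotypic_mod scale R \<and>
     (\<exists>W. simple_submod scale R W \<and> Vector_Spaces.vector_space.dim scale W = a \<and> iso_copies scale R b W)) \<and>
    (normal_subalgebra scale \<rho> (carrier G) (End_over scale R) \<and>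
     alg_iso (op_alg scale (End_over scale R)) (Mat b) \<noteq> {}) \<and>
    (a \<noteq> 1 \<and> b \<noteq> 1 \<longrightarrow>
      (\<forall>(S, n) \<in> {(R, a), (End_over scale R, b)}.
        Ad \<rho> S \<in> hom G (alg_Aut (op_alg scale S)) \<and>
        inj_on (Ad \<rho> S) (carrier G) \<and>
        inner_class (op_alg scale S) \<in> iso (alg_Aut (op_alg scale S)) (proj_units (op_alg scale S)) \<and>
        (\<forall>\<phi> \<in> alg_iso (op_alg scale S) (Mat n).
          (\<lambda>C. \<phi> ` C) \<in> iso (proj_units (op_alg scale S)) (PGL n) \<and>
          Ad_PGL scale \<rho> S \<phi> \<in> hom G (PGL n) \<and>
          inj_on (Ad_PGL scale \<rho> S \<phi>) (carrier G) \<and>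
          Ad_PGL scale \<rho> S \<phi> ` H \<subseteq> PSL n))) \<and>
    central_simple_rep scale \<rho> H"
  proof -
  interpret operator_space scale Basis
    using V by (simp add: operator_space_def)
  interpret G: group G by (rule G)
  interpret rG: linear_representation scale Basis G \<rho>
    by unfold_locales (rule \<rho>)
  let ?K = "G\<lparr>carrier := H\<rparr>"
  have subH: "subgroup H G"
    by (rule G.normal_invE(1)[OF H])
  have HG: "H \<subseteq> carrier G"
    by (rule subgroup.subset[OF subH])
  interpret K: group ?K
    by (rule subgroup.subgroup_is_group[OF subH G])
  have nonzero: "(UNIV :: 'v set) \<noteq> {0}"
  proof
    assume "(UNIV :: 'v set) = {0}"
    then have "dim (UNIV :: 'v set) = 0"
      using dim_eq_0 by blast
    then show False
      using N by simp
  qed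
  \<comment> \<open>From here unqualified names such as \<open>conj\<close> and
    \<open>stable_algebra\<close> refer to \<open>H\<close>; the prefix \<open>rG\<close> marks
    those of \<open>G\<close>.\<close>
  interpret irreducible_operators scale Basis ?K \<rho>
  proof unfold_locales
    show "\<rho> \<in> hom ?K (Aut_V scale)"
      using \<rho> HG by (auto simp: hom_def)
    show "W = {0} \<or> W = UNIV" if "submod scale (\<rho> ` carrier ?K) W" for W
      using iii that by (auto simp: abs_simple_rep_def simple_submod_def)
    show "(UNIV :: 'v set) \<noteq> {0}" by (rule nonzero)
    show "\<exists>c. f = scale c"
      if "Vector_Spaces.linear scale scale f" "\<And>g. g \<in> carrier ?K \<Longrightarrow> f \<circ> \<rho> g = \<rho> g \<circ> f" for f
    proof -
      have "f \<in> End_over scale (\<rho> ` H)"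
        using that by (auto simp: End_over_def)
      then show ?thesis
        using iii by (auto simp: abs_simple_rep_def)
    qed
    show "S = carrier ?K"
      if "subgroup S ?K" "finite (rcosets\<^bsub>?K\<^esub> S)" "card (rcosets\<^bsub>?K\<^esub> S) dvd dim UNIV" for S
      using i[OF that(1,2)] that(3) N(1) by simp
  qed
  have invK: "inv\<^bsub>?K\<^esub> h = inv\<^bsub>G\<^esub> h" if "h \<in> H" for h
    using G.m_inv_consistent[OF subH that] by simp
  have conj_K: "conj h u = rG.conj h u" if "h \<in> H" for h u
    using invK[OF that] by (simp add: conj_def rG.conj_def)
  have stable_K: "stable_algebra S" if "rG.stable_algebra S" for S
    using that HG conj_K by (auto simp: stable_algebra_def rG.stable_algebra_def)
  have RG: "rG.stable_algebra R"
    using R rG.normal_subalgebra_iff_stable by simp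
  have csr: "central_simple_rep scale \<rho> H"
    unfolding central_simple_rep_def using normal_subalgebra_iff_stable stable_central_simple by simp
  obtain a E where E: "matrix_units scale Basis R a E"
    using stable_matrix_units[OF Br stable_K[OF RG]] by blast
  interpret E: matrix_units scale Basis R a E by (rule E)
  obtain b F u where ab: "dim UNIV = a * b" and F: "matrix_units scale Basis (End_over scale R) b F"
    and u: "u \<noteq> 0" "E 0 0 u = u" and range: "range (F 0 0) = {x u |x. x \<in> R}"
    using E.commutant_matrix_units by blast
  interpret F: matrix_units scale Basis "End_over scale R" b F by (rule F)
  have RtG: "rG.stable_algebra (End_over scale R)"
    by (rule rG.stable_End_over[OF RG])
  \<comment> \<open>Clause (d) for a single algebra, stated generally so as to serve both
    \<open>R\<close> and its commutant.\<close>
  have projective: "Ad \<rho> S \<in> hom G (alg_Aut (op_alg scale S)) \<and>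
        inj_on (Ad \<rho> S) (carrier G) \<and>
        inner_class (op_alg scale S) \<in> iso (alg_Aut (op_alg scale S)) (proj_units (op_alg scale S)) \<and>
        (\<forall>\<phi> \<in> alg_iso (op_alg scale S) (Mat n).
          (\<lambda>C. \<phi> ` C) \<in> iso (proj_units (op_alg scale S)) (PGL n) \<and>
          Ad_PGL scale \<rho> S \<phi> \<in> hom G (PGL n) \<and>
          inj_on (Ad_PGL scale \<rho> S \<phi>) (carrier G) \<and>
          Ad_PGL scale \<rho> S \<phi> ` H \<subseteq> PSL n)"
    if S: "rG.stable_algebra S" and M: "matrix_units scale Basis S n M" and n: "n \<noteq> 1" for S n M
  proof -
    interpret M: matrix_units scale Basis S n M by (rule M)
    define L where "L = {g \<in> carrier G. \<forall>x\<in>S. rG.conj g x = x}"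
    have L: "L \<lhd> G"
      unfolding L_def by (rule rG.Ad_kernel_normal[OF S])
    \<comment> \<open>If \<open>H\<close> acted trivially on \<open>S\<close>, every element of
      \<open>S\<close> would commute with \<open>H\<close> and be scalar, which
      \<open>n \<noteq> 1\<close> excludes.\<close>
    have notH: "\<not> H \<subseteq> L"
    proof
      assume HL: "H \<subseteq> L"
      have "\<exists>c. x = scale c" if x: "x \<in> S" for x
      proof (rule conj_fixed_imp_scalar[OF M.lin[OF x]])
        fix g assume "g \<in> carrier ?K"
        then show "conj g x = x"
          using HL x conj_K by (auto simp: L_def)
      qed
      then show False
        using M.not_all_scalar[OF n] by blast
    qed
    \<comment> \<open>By (ii) a normal subgroup of \<open>G\<close> is trivial, \<open>H\<close> or
      \<open>G\<close>; the last two contain \<open>H\<close>.\<close>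
    have "L \<subseteq> {\<one>\<^bsub>G\<^esub>}"
    proof (cases "H = carrier G")
      case True
      then have "is_simple_group G"
        using ii(1) by simp
      then have "L = {\<one>\<^bsub>G\<^esub>} \<or> L = carrier G"
        using L by (simp add: is_simple_group_def)
      then show ?thesis
        using notH HG by auto
    next
      case False
      then have "{K. K \<lhd> G \<and> K \<noteq> {\<one>\<^bsub>G\<^esub>} \<and> K \<noteq> carrier G} = {H}"
        using ii(3) by blast
      then have "L = {\<one>\<^bsub>G\<^esub>} \<or> L = carrier G \<or> L = H"
        using L by blast
      then show ?thesis
        using notH HG by auto
    qed
    then have inj: "inj_on (Ad \<rho> S) (carrier G)"
      unfolding L_def by (rule rG.Ad_inj[OF S])
    note P = rG.projective_Ad[OF S M inj]
    show ?thesis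
    proof (intro conjI ballI)
      fix \<phi> assume \<phi>: "\<phi> \<in> alg_iso (op_alg scale S) (Mat n)"
      show "Ad_PGL scale \<rho> S \<phi> ` H \<subseteq> PSL n"
        by (rule simple_hom_into_PSL[OF G H ii(1,2) P(3)[OF \<phi>]])
    qed (use P inj rG.Ad_hom[OF S] in auto)
  qed
  show ?thesis
  proof (rule exI[of _ a], rule exI[of _ b], intro conjI)
    show "a > 0" "b > 0"
      by (rule E.pos, rule F.pos)
    show "N = a * b"
      using N(1) ab by simp
    show "alg_iso (op_alg scale R) (Mat a) \<noteq> {}"
      using E.iso_Mat by blast
    show "alg_iso (op_alg scale (End_over scale R)) (Mat b) \<noteq> {}"
      using F.iso_Mat by blast
    show "semisimple_mod scale R" "isotypic_mod scale R"
      by (rule E.semisimple, rule E.isotypic)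
    \<comment> \<open>The witness is \<open>R u\<close>, the image of \<open>F 0 0\<close>: simple
      of dimension \<open>a\<close> as a cyclic module, and repeated \<open>b\<close> times as a
      corner of the commutant.\<close>
    show "\<exists>W. simple_submod scale R W \<and> dim W = a \<and> iso_copies scale R b W"
      using E.cyclic_simple[OF u] E.iso_copies_commutant[OF F] unfolding range by blast
    show "normal_subalgebra scale \<rho> (carrier G) (End_over scale R)"
      using RtG rG.normal_subalgebra_iff_stable by simp
    show "a \<noteq> 1 \<and> b \<noteq> 1 \<longrightarrow>
      (\<forall>(S, n) \<in> {(R, a), (End_over scale R, b)}.
        Ad \<rho> S \<in> hom G (alg_Aut (op_alg scale S)) \<and>
        inj_on (Ad \<rho> S) (carrier G) \<and>
        inner_class (op_alg scale S) \<in> iso (alg_Aut (op_alg scale S)) (proj_units (op_alg scale S)) \<and>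
        (\<forall>\<phi> \<in> alg_iso (op_alg scale S) (Mat n).
          (\<lambda>C. \<phi> ` C) \<in> iso (proj_units (op_alg scale S)) (PGL n) \<and>
          Ad_PGL scale \<rho> S \<phi> \<in> hom G (PGL n) \<and>
          inj_on (Ad_PGL scale \<rho> S \<phi>) (carrier G) \<and>
          Ad_PGL scale \<rho> S \<phi> ` H \<subseteq> PSL n))"
      using projective[OF RG E] projective[OF RtG F] by simp
    show "central_simple_rep scale \<rho> H" by (rule csr)
  qed
qed

end
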